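(* Let $I\subset S=K[x_1,\ldots,x_n]$ be a nonzero proper ideal of Borel type. Then $\operatorname{sdepth}S/I\ge\operatorname{depth}S/I$ and $\operatorname{sdepth}I\ge\operatorname{depth}I$. In particular, Stanley's conjecture (the inequality $\operatorname{depth}M\le\operatorname{sdepth}M$) holds for $M=I$ and $M=S/I$.
   Context: $K$ is a field and $S=K[x_1,\ldots,x_n]$ with its $\mathbb{Z}^n$-grading. A monomial ideal $I\subset S$ is of Borel type if it satisfies one of the following equivalent conditions: (i) for each monomial $u\in I$ and all integers $i,j,s$ with $1\le j<i\le n$ and $s>0$ such that $x_i^s\mid u$ there exists an integer $t\ge0$ such that $x_j^t(u/x_i^s)\in I$; (ii) if $P\in\operatorname{Ass}(S/I)$, then $P=(x_1,\ldots,x_j)$ for some $j$. For a nonzero finitely generated $\mathbb{Z}^n$-graded $S$-module $M$, $\operatorname{depth}M$ is the depth with respect to $(x_1,\ldots,x_n)$. For a homogeneous $u\in M$ and $Z\subset\{x_1,\ldots,x_n\}$, $uK[Z]$ denotes the $K$-subspace of $M$ generated by all $uv$ with $v$ a monomial in $K[Z]$; it is a Stanley space of dimension $|Z|$ if it is a free $K[Z]$-module. A Stanley decomposition of $M$ is a presentation $\mathcal{D}: M=\bigoplus_{i=1}^m u_iK[Z_i]$ of $M$ as a finite direct sum of Stanley spaces, as $\mathbb{Z}^n$-graded $K$-vector spaces; $\operatorname{sdepth}\mathcal{D}=\min\{|Z_i|\}$, and $\operatorname{sdepth}M$ is the maximum of $\operatorname{sdepth}\mathcal{D}$ over all Stanley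 decompositions $\mathcal{D}$ of $M$. *)

theory Defs
  imports "HOL-Algebra.QuotRing" "HOL-Algebra.Module"
    "HOL-Library.Poly_Mapping" "HOL-Library.Extended_Nat"
begin

section \<open>Polynomial rings and monomials\<close>

text \<open>A monomial is an exponent vector of type \<^typ>\<open>nat \<Rightarrow>\<^sub>0 nat\<close>; a polynomial
  is a finitely supported function from monomials to coefficients, with the convolution product.
  The ring \<open>poly_ring Z\<close> is $K[Z]$, so $S = K[x_1,\ldots,x_n]$ is \<open>poly_ring {1..n}\<close>
  and the field of constants $K \subset S$ is \<open>poly_ring {}\<close>.\<close>

type_synonym 'k mpoly = "(nat \<Rightarrow>\<^sub>0 nat) \<Rightarrow>\<^sub>0 'k"

definition poly_ring :: "nat set \<Rightarrow> 'k::field mpoly ring" where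
  "poly_ring Z = \<lparr>carrier = {p. \<forall>m\<in>Poly_Mapping.keys p. Poly_Mapping.keys m \<subseteq> Z},
     monoid.mult = (*), one = 1, zero = 0, add = (+)\<rparr>"

definition indet :: "nat \<Rightarrow> 'k::field mpoly" where
  "indet i = Poly_Mapping.single (Poly_Mapping.single i 1) 1"

definition monomials :: "nat set \<Rightarrow> 'k::field mpoly set" where
  "monomials Z = {Poly_Mapping.single m 1 | m. Poly_Mapping.keys m \<subseteq> Z}"

definition irrelevant_ideal :: "nat \<Rightarrow> 'k::field mpoly set" where
  "irrelevant_ideal n = genideal (poly_ring {1..n}) (indet ` {1..n})"


section \<open>Ideals of Borel type\<close>

definition monomial_ideal :: "nat \<Rightarrow> 'k::field mpoly set \<Rightarrow> bool" where
  "monomial_ideal n I \<longleftrightarrow> (\<exists>G\<subseteq>monomials {1..n}. I = genideal (poly_ring {1..n}) G)"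

text \<open>The divisibility of \<open>u\<close> by $x_i^s$ and the quotient $u/x_i^s$ are expressed
  by writing $u = x_i^s v$ with a monomial \<open>v\<close>.\<close>

definition borel_type :: "nat \<Rightarrow> 'k::field mpoly set \<Rightarrow> bool" where
  "borel_type n I \<longleftrightarrow> monomial_ideal n I \<and>
     (\<forall>u\<in>monomials {1..n} \<inter> I. \<forall>v\<in>monomials {1..n}. \<forall>i j s.
        1 \<le> j \<and> j < i \<and> i \<le> n \<and> 0 < s \<and> u = indet i ^ s * v \<longrightarrow>
        (\<exists>t. indet j ^ t * v \<in> I))"


section \<open>Depth\<close>

definition seq_mult :: "('a, 'b, 'e) module_scheme \<Rightarrow> 'a list \<Rightarrow> 'b set" where
  "seq_mult M fs =
     {finsum M (\<lambda>k. fs ! k \<odot>\<^bsub>M\<^esub> y k) {..<length fs} | y. y \<in> {..<length fs} \<rightarrow> carrier M}"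

text \<open>\<open>seq_mult M [f\<^sub>1, \<dots>, f\<^sub>r]\<close> is the submodule $(f_1,\ldots,f_r)M$.  The second conjunct of the next
  definition says that multiplication by \<open>fs ! k\<close> is injective on
  $M/(f_1,\ldots,f_k)M$ (\<open>fs ! k\<close> being $f_{k+1}$).\<close>

definition regular_sequence ::
    "('a, 'c) ring_scheme \<Rightarrow> ('a, 'b, 'e) module_scheme \<Rightarrow> 'a list \<Rightarrow> bool" where
  "regular_sequence R M fs \<longleftrightarrow> set fs \<subseteq> carrier R \<and>
     (\<forall>k<length fs. \<forall>x\<in>carrier M.
        fs ! k \<odot>\<^bsub>M\<^esub> x \<in> seq_mult M (take k fs) \<longrightarrow> x \<in> seq_mult M (take k fs)) \<and>
     seq_mult M fs \<noteq> carrier M"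

definition depth_wrt ::
    "('a, 'c) ring_scheme \<Rightarrow> 'a set \<Rightarrow> ('a, 'b, 'e) module_scheme \<Rightarrow> enat" where
  "depth_wrt R J M = (SUP fs \<in> {fs. regular_sequence R M fs \<and> set fs \<subseteq> J}. enat (length fs))"

definition depth :: "nat \<Rightarrow> ('k::field mpoly, 'b, 'e) module_scheme \<Rightarrow> enat" where
  "depth n M = depth_wrt (poly_ring {1..n}) (irrelevant_ideal n) M"


section \<open>Stanley decompositions and Stanley depth\<close>

definition lin_span ::
    "('a, 'c) ring_scheme \<Rightarrow> ('a, 'b, 'e) module_scheme \<Rightarrow> 'b set \<Rightarrow> 'b set" where
  "lin_span R M B =
     {finsum M (\<lambda>b. c b \<odot>\<^bsub>M\<^esub> b) F | c F. finite F \<and> F \<subseteq> B \<and> c \<in> F \<rightarrow> carrier R}"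

text \<open>A module is free if it has a basis: a subset \<open>B\<close> such that every element is in a unique way
  a linear combination of elements of \<open>B\<close> (with finitely supported coefficients).\<close>

definition free_module :: "('a, 'c) ring_scheme \<Rightarrow> ('a, 'b, 'e) module_scheme \<Rightarrow> bool" where
  "free_module R M \<longleftrightarrow> Module.module R M \<and> (\<exists>B\<subseteq>carrier M. \<forall>x\<in>carrier M.
     \<exists>!c. range c \<subseteq> carrier R \<and> finite {b. c b \<noteq> \<zero>\<^bsub>R\<^esub>} \<and> {b. c b \<noteq> \<zero>\<^bsub>R\<^esub>} \<subseteq> B \<and>
       x = finsum M (\<lambda>b. c b \<odot>\<^bsub>M\<^esub> b) {b. c b \<noteq> \<zero>\<^bsub>R\<^esub>})"

text \<open>The subspace $uK[Z]$ of \<open>M\<close>.\<close>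

definition monomial_span ::
    "('k::field mpoly, 'b, 'e) module_scheme \<Rightarrow> 'b \<Rightarrow> nat set \<Rightarrow> 'b set" where
  "monomial_span M u Z = lin_span (poly_ring {}) M {v \<odot>\<^bsub>M\<^esub> u | v. v \<in> monomials Z}"

definition stanley_space ::
    "('k::field mpoly, 'b, 'e) module_scheme \<Rightarrow> 'b \<Rightarrow> nat set \<Rightarrow> bool" where
  "stanley_space M u Z \<longleftrightarrow> free_module (poly_ring Z) (M\<lparr>carrier := monomial_span M u Z\<rparr>)"

text \<open>A $\mathbf{Z}^n$-grading of an \<open>S\<close>-module is given by the family \<open>gr\<close> of its homogeneous components;
  degrees are integer vectors supported on \<open>{1..n}\<close>.\<close>

definition degrees :: "nat \<Rightarrow> (nat \<Rightarrow> int) set" where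
  "degrees n = {a. \<forall>i. i \<notin> {1..n} \<longrightarrow> a i = 0}"

definition homogeneous :: "nat \<Rightarrow> ((nat \<Rightarrow> int) \<Rightarrow> 'b set) \<Rightarrow> 'b \<Rightarrow> bool" where
  "homogeneous n gr u \<longleftrightarrow> (\<exists>a\<in>degrees n. u \<in> gr a)"

text \<open>\<open>M\<close> is the internal direct sum of the subspaces \<open>U i\<close>, \<open>i < m\<close>.\<close>

definition direct_sum ::
    "('a, 'b, 'e) module_scheme \<Rightarrow> nat \<Rightarrow> (nat \<Rightarrow> 'b set) \<Rightarrow> bool" where
  "direct_sum M m U \<longleftrightarrow> (\<forall>i<m. U i \<subseteq> carrier M) \<and>
     (\<forall>x\<in>carrier M. \<exists>!y. y \<in> (\<Pi>\<^sub>E i\<in>{..<m}. U i) \<and> x = finsum M y {..<m})"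

text \<open>A decomposition is the list of its pairs $(u_i, Z_i)$.  Since the $u_i$ are homogeneous, the
  subspaces $u_iK[Z_i]$ are graded, and the decomposition is one of graded vector spaces.\<close>

definition stanley_decomposition :: "nat \<Rightarrow> ('k::field mpoly, 'b, 'e) module_scheme \<Rightarrow>
    ((nat \<Rightarrow> int) \<Rightarrow> 'b set) \<Rightarrow> ('b \<times> nat set) list \<Rightarrow> bool" where
  "stanley_decomposition n M gr D \<longleftrightarrow>
     (\<forall>(u, Z)\<in>set D. u \<in> carrier M \<and> homogeneous n gr u \<and> Z \<subseteq> {1..n} \<and> stanley_space M u Z) \<and>
     direct_sum M (length D) (\<lambda>i. monomial_span M (fst (D ! i)) (snd (D ! i)))"

definition sdepth_decomposition :: "('b \<times> nat set) list \<Rightarrow> nat" where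
  "sdepth_decomposition D = Min {card Z | u Z. (u, Z) \<in> set D}"

text \<open>Only meant for nonzero finitely generated modules, where decompositions exist and
  are nonempty lists.\<close>

definition sdepth :: "nat \<Rightarrow> ('k::field mpoly, 'b, 'e) module_scheme \<Rightarrow>
    ((nat \<Rightarrow> int) \<Rightarrow> 'b set) \<Rightarrow> nat" where
  "sdepth n M gr = Max {sdepth_decomposition D | D. stanley_decomposition n M gr D}"


section \<open>The graded modules \<open>I\<close> and \<open>S/I\<close>\<close>

definition poly_component :: "nat \<Rightarrow> (nat \<Rightarrow> int) \<Rightarrow> 'k::field mpoly set" where
  "poly_component n a = {p \<in> carrier (poly_ring {1..n}).
     \<forall>m\<in>Poly_Mapping.keys p. \<forall>i. int (Poly_Mapping.lookup m i) = a i}"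

definition ideal_module :: "('a, 'c) ring_scheme \<Rightarrow> 'a set \<Rightarrow> ('a, 'a) module" where
  "ideal_module R I = \<lparr>carrier = I, monoid.mult = monoid.mult R, one = one R, zero = zero R,
     add = add R, smult = monoid.mult R\<rparr>"

definition quotient_module :: "('a, 'c) ring_scheme \<Rightarrow> 'a set \<Rightarrow> ('a, 'a set) module" where
  "quotient_module R I = ring.extend (R Quot I)
     \<lparr>smult = \<lambda>a A. (I +>\<^bsub>R\<^esub> a) \<otimes>\<^bsub>R Quot I\<^esub> A\<rparr>"

definition ideal_component ::
    "nat \<Rightarrow> 'k::field mpoly set \<Rightarrow> (nat \<Rightarrow> int) \<Rightarrow> 'k mpoly set" where
  "ideal_component n I a = I \<inter> poly_component n a"

definition quotient_component ::
    "nat \<Rightarrow> 'k::field mpoly set \<Rightarrow> (nat \<Rightarrow> int) \<Rightarrow> 'k mpoly set set" where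
  "quotient_component n I a = (\<lambda>p. I +>\<^bsub>poly_ring {1..n}\<^esub> p) ` poly_component n a"

lemma cring_poly_ring: "cring (poly_ring Z :: 'k::field mpoly ring)"
proof (rule cringI)
  have [simp]: "x \<oplus>\<^bsub>poly_ring Z\<^esub> y = x + y" "\<zero>\<^bsub>poly_ring Z\<^esub> = 0"
    "x \<otimes>\<^bsub>poly_ring Z\<^esub> y = x * y" "\<one>\<^bsub>poly_ring Z\<^esub> = 1" for x y :: "'k mpoly"
    by (simp_all add: poly_ring_def)
  have [simp]: "(0 :: 'k mpoly) \<in> carrier (poly_ring Z)" "(1 :: 'k mpoly) \<in> carrier (poly_ring Z)"
    by (simp_all add: poly_ring_def)
  have add: "p + q \<in> carrier (poly_ring Z)"
    if "p \<in> carrier (poly_ring Z)" "q \<in> carrier (poly_ring Z)" for p q :: "'k mpoly"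
    using that Poly_Mapping.keys_add[of p q] unfolding poly_ring_def by (simp add: subset_iff) blast
  have uminus: "- p \<in> carrier (poly_ring Z)" if "p \<in> carrier (poly_ring Z)" for p :: "'k mpoly"
    using that unfolding poly_ring_def by (simp add: in_keys_iff)
  have mult: "p * q \<in> carrier (poly_ring Z)"
    if "p \<in> carrier (poly_ring Z)" "q \<in> carrier (poly_ring Z)" for p q :: "'k mpoly"
  proof -
    have "Poly_Mapping.keys m \<subseteq> Z" if m: "m \<in> Poly_Mapping.keys (p * q)" for m
    proof -
      obtain a b where "a \<in> Poly_Mapping.keys p" "b \<in> Poly_Mapping.keys q" "m = a + b"
        using m Poly_Mapping.keys_mult[of p q] by blast
      then show ?thesis
        using \<open>p \<in> _\<close> \<open>q \<in> _\<close> Poly_Mapping.keys_add[of a b] unfolding poly_ring_def by fastforce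
    qed
    then show ?thesis by (simp add: poly_ring_def)
  qed
  show "abelian_group (poly_ring Z :: 'k mpoly ring)"
  proof (rule abelian_groupI)
    fix p :: "'k mpoly" assume "p \<in> carrier (poly_ring Z)"
    then show "\<exists>y\<in>carrier (poly_ring Z). y \<oplus>\<^bsub>poly_ring Z\<^esub> p = \<zero>\<^bsub>poly_ring Z\<^esub>"
      using uminus by (intro bexI[of _ "- p"]) auto
  qed (simp_all add: add add_ac)
  show "Group.comm_monoid (poly_ring Z :: 'k mpoly ring)"
    by (rule comm_monoidI) (simp_all add: mult mult_ac)
qed (simp add: poly_ring_def distrib_right)

lemma module_ideal_module:
  assumes "cring R" "ideal I R" shows "Module.module R (ideal_module R I)"
proof -
  interpret cring R by fact
  interpret ideal I R by fact
  have *: "x \<in> I \<Longrightarrow> x \<in> carrier R" for x using a_subset by blast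
  show ?thesis
  proof (rule Module.moduleI)
    show "abelian_group (ideal_module R I)"
    proof (rule abelian_groupI)
      fix x assume "x \<in> carrier (ideal_module R I)"
      then show "\<exists>y\<in>carrier (ideal_module R I). y \<oplus>\<^bsub>ideal_module R I\<^esub> x = \<zero>\<^bsub>ideal_module R I\<^esub>"
        by (intro bexI[of _ "\<ominus>\<^bsub>R\<^esub> x"]) (auto simp: ideal_module_def * l_neg)
    qed (auto simp: ideal_module_def * a_ac)
  qed (auto simp: ideal_module_def * l_distr r_distr m_assoc I_l_closed is_cring)
qed

lemma module_quotient_module:
  assumes "cring R" "ideal I R" shows "Module.module R (quotient_module R I)"
proof -
  interpret cring R by fact
  interpret ideal I R by fact
  interpret Q: cring "R Quot I" by (rule quotient_is_cring[OF is_cring])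
  interpret h: ring_hom_ring R "R Quot I" "a_r_coset R I" by (rule rcos_ring_hom_ring)
  have [simp]: "carrier (quotient_module R I) = carrier (R Quot I)"
    "add (quotient_module R I) = add (R Quot I)" "zero (quotient_module R I) = zero (R Quot I)"
    "smult (quotient_module R I) a A = (I +>\<^bsub>R\<^esub> a) \<otimes>\<^bsub>R Quot I\<^esub> A" for a A
    by (simp_all add: quotient_module_def ring.defs)
  show ?thesis
  proof (rule Module.moduleI)
    show "abelian_group (quotient_module R I)"
    proof (rule abelian_groupI)
      fix x assume "x \<in> carrier (quotient_module R I)"
      then show "\<exists>y\<in>carrier (quotient_module R I). y \<oplus>\<^bsub>quotient_module R I\<^esub> x = \<zero>\<^bsub>quotient_module R I\<^esub>"
        by (intro bexI[of _ "\<ominus>\<^bsub>R Quot I\<^esub> x"]) (auto simp: Q.l_neg)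
    qed (simp_all add: Q.a_ac)
  qed (simp_all add: Q.l_distr Q.r_distr Q.m_assoc is_cring)
qed

end

theory Submission
  imports Defs "HOL-Library.Product_Lexorder"
begin

text \<open>Let \<open>q\<close> be the largest index of a variable occurring in a minimal generator of \<open>I\<close>. Both
  inequalities are compared with \<open>n - q\<close>, respectively \<open>n - q + 1\<close>.

  Stanley depth. The monomials in \<open>x\<^sub>1, \<dots>, x\<^sub>q\<close> inside or outside \<open>I\<close> can be partitioned into finitely
  many boxes \<open>u + \<nat>\<^sup>Z\<close>, by induction on the number of variables; inside \<open>I\<close> all \<open>Z\<close> can be taken
  nonempty. Adding the variables \<open>x\<^sub>q\<^sub>+\<^sub>1, \<dots>, x\<^sub>n\<close> to every \<open>Z\<close> gives Stanley decompositions.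

  Depth. Since \<open>I\<close> is of Borel type, there is a monomial \<open>w\<close> outside \<open>I\<close> that
  \<open>P = (x\<^sub>1, \<dots>, x\<^sub>q)\<close> multiplies into \<open>I\<close>. Any \<open>n - q + 1\<close> polynomials \<open>f\<^sub>i\<close> satisfy a nontrivial
  relation \<open>F(f) \<in> P\<close>, so that \<open>F(f) w \<in> I\<close>. If \<open>f\<close> is a regular sequence on \<open>M\<close>, then it
  is quasi-regular, so elements of \<open>M\<close> have leading exponents with respect to the \<open>f\<close>-adic
  filtration refined by the degree lexicographic order, and these are additive under
  multiplication by \<open>F(f)\<close>. For \<open>M = S/I\<close> this contradicts \<open>F(f) w = 0\<close>. For \<open>M = I\<close> and
  \<open>n - q + 2\<close> elements \<open>f\<^sub>i\<close> there is, for each \<open>i\<close>, a relation \<open>F\<^sub>i\<close> not involving \<open>f\<^sub>i\<close>.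
  For \<open>v \<in> w + I\<close> the difference of the leading exponents of \<open>F\<^sub>i(f) v \<in> I\<close> and of \<open>F\<^sub>i\<close> does not
  depend on \<open>i\<close>, hence has no negative entry. So the leading term of \<open>F\<^sub>0(f) v\<close> can be cancelled
  by subtracting an element of \<open>I\<close> from \<open>v\<close>, over and over again, but the order of \<open>F\<^sub>0(f) v\<close> is
  bounded because \<open>w\<close> always occurs in \<open>v\<close>.\<close>

section \<open>Exponents\<close>

abbreviation keys :: "('a \<Rightarrow>\<^sub>0 'b::zero) \<Rightarrow> 'a set" where "keys \<equiv> Poly_Mapping.keys"
abbreviation lookup :: "('a \<Rightarrow>\<^sub>0 'b::zero) \<Rightarrow> 'a \<Rightarrow> 'b" where "lookup \<equiv> Poly_Mapping.lookup"
abbreviation single :: "'a \<Rightarrow> 'b \<Rightarrow> 'a \<Rightarrow>\<^sub>0 'b::zero" where "single \<equiv> Poly_Mapping.single"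

type_synonym expo = "nat \<Rightarrow>\<^sub>0 nat"

lemma keys_plus_nat: "keys (a + b) = keys a \<union> keys (b :: expo)"
  by (auto simp: in_keys_iff lookup_add)

lemma keys_uminus: "keys (- p) = keys (p :: 'a \<Rightarrow>\<^sub>0 'b::ab_group_add)"
  by (auto simp: in_keys_iff)

lemma sum_keys_superset:
  assumes "finite A" "keys p \<subseteq> A" "\<And>x. f x 0 = 0"
  shows "(\<Sum>x\<in>keys p. f x (lookup p x)) = (\<Sum>x\<in>A. f x (lookup p x))"
  using assms by (intro sum.mono_neutral_left) (auto simp: in_keys_iff)

definition deg :: "expo \<Rightarrow> nat" where "deg a = (\<Sum>i\<in>keys a. lookup a i)"

lemma deg_zero [simp]: "deg 0 = 0" by (simp add: deg_def)

lemma deg_single [simp]: "deg (single i k) = k"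
  by (simp add: deg_def)

lemma deg_plus [simp]: "deg (a + b) = deg a + deg b"
proof -
  have "deg a = (\<Sum>i\<in>keys a \<union> keys b. lookup a i)" "deg b = (\<Sum>i\<in>keys a \<union> keys b. lookup b i)"
    unfolding deg_def by (intro sum_keys_superset[where f="\<lambda>_ x. x"]; simp)+
  then show ?thesis
    by (simp add: deg_def keys_plus_nat lookup_add sum.distrib)
qed

lemma lookup_le_deg: "lookup a i \<le> deg a"
  by (cases "i \<in> keys a") (auto simp: deg_def in_keys_iff intro: member_le_sum[of i "keys a" "lookup a"])

lemma deg_le_bound:
  assumes "finite Z" "keys a \<subseteq> Z" "\<And>i. i \<in> Z \<Longrightarrow> lookup a i \<le> L"
  shows "deg a \<le> card Z * L"
proof -
  have "deg a = (\<Sum>i\<in>Z. lookup a i)"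
    unfolding deg_def using assms by (intro sum_keys_superset[where f="\<lambda>_ x. x"]) auto
  also have "\<dots> \<le> card Z * L" using sum_bounded_above[of Z "lookup a" L] assms by simp
  finally show ?thesis .
qed

lemma deg_eq_0_iff [simp]: "deg a = 0 \<longleftrightarrow> a = 0"
proof
  assume "deg a = 0"
  then have "lookup a i = 0" for i using lookup_le_deg[of a i] by simp
  then show "a = 0" by (intro poly_mapping_eqI) simp
qed simp

lemma expo_split_single:
  assumes "k \<le> lookup a i"
  obtains b :: expo where "a = b + single i k" "keys b \<subseteq> keys a"
proof
  let ?b = "a - single i k"
  show "a = ?b + single i k"
    using assms by (intro poly_mapping_eqI) (auto simp: lookup_add lookup_minus lookup_single when_def)
  show "keys ?b \<subseteq> keys a" by (auto simp: in_keys_iff lookup_minus)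
qed

text \<open>Variables are stripped off one at a time until degree d is left. In this way products of
  more than d elements become forms of degree exactly d.\<close>

lemma expo_split_deg:
  assumes "d \<le> deg a"
  obtains b c :: expo where "a = b + c" "deg b = d" 
proof -
  have "\<exists>b c. a = b + c \<and> deg b = d" using assms
  proof (induction "deg a - d" arbitrary: a)
    case 0
    then show ?case by (intro exI[of _ a] exI[of _ 0]) simp
  next
    case (Suc m)
    then have "a \<noteq> 0" by auto
    then obtain i where "i \<in> keys a"
      by (metis ex_in_conv in_keys_iff lookup_zero poly_mapping_eqI)
    then obtain b where b: "a = b + single i 1" using expo_split_single[of 1 a i] by (auto simp: in_keys_iff)
    then have "m = deg b - d" "d \<le> deg b" using Suc by auto
    from Suc(1)[OF this] obtain b' c where "b = b' + c" "deg b' = d" by auto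
    then show ?case using b by (intro exI[of _ b'] exI[of _ "c + single i 1"]) (simp add: ac_simps)
  qed
  then show ?thesis using that by blast
qed

section \<open>Counting exponent vectors\<close>

definition bounded_expos :: "nat set \<Rightarrow> nat \<Rightarrow> expo set" where
  "bounded_expos Z L = {a. keys a \<subseteq> Z \<and> (\<forall>i. lookup a i \<le> L)}"

text \<open>Restriction to Z turns these exponents into functions from Z to {0,...,L}. This gives
  both finiteness and the count (L + 1)^|Z| on which the existence of algebraic relations
  rests.\<close>

lemma bij_bounded_expos:
  assumes "finite Z"
  shows "bij_betw (\<lambda>a. restrict (lookup a) Z) (bounded_expos Z L) (Z \<rightarrow>\<^sub>E {..L})"
proof (rule bij_betw_byWitness[where f'="\<lambda>g. Abs_poly_mapping (\<lambda>i. if i \<in> Z then g i else 0)"])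
  have fin: "finite {i. (if i \<in> Z then g i else 0) \<noteq> (0::nat)}" for g
    by (rule finite_subset[OF _ assms]) auto
  have L: "lookup (Abs_poly_mapping (\<lambda>i. if i \<in> Z then g i else (0::nat))) j = (if j \<in> Z then g j else 0)" for g j
    using fin by (simp add: lookup_Abs_poly_mapping)
  show "\<forall>a\<in>bounded_expos Z L. Abs_poly_mapping (\<lambda>i. if i \<in> Z then restrict (lookup a) Z i else 0) = a"
    by (auto intro!: poly_mapping_eqI simp: bounded_expos_def L in_keys_iff simp del: restrict_apply) (auto simp: in_keys_iff)
  show "\<forall>g\<in>Z \<rightarrow>\<^sub>E {..L}. restrict (lookup (Abs_poly_mapping (\<lambda>i. if i \<in> Z then g i else 0))) Z = g"
    by (auto simp: L fun_eq_iff restrict_def PiE_def extensional_def)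
  show "(\<lambda>a. restrict (lookup a) Z) ` bounded_expos Z L \<subseteq> Z \<rightarrow>\<^sub>E {..L}"
    by (auto simp: bounded_expos_def)
  show "(\<lambda>g. Abs_poly_mapping (\<lambda>i. if i \<in> Z then g i else 0)) ` (Z \<rightarrow>\<^sub>E {..L}) \<subseteq> bounded_expos Z L"
    by (auto simp: bounded_expos_def L in_keys_iff PiE_def Pi_def split: if_splits)
qed

lemma finite_bounded_expos: "finite Z \<Longrightarrow> finite (bounded_expos Z L)"
  using bij_betw_finite[OF bij_bounded_expos] by (simp add: finite_PiE)

lemma card_bounded_expos: "finite Z \<Longrightarrow> card (bounded_expos Z L) = Suc L ^ card Z"
  using bij_betw_same_card[OF bij_bounded_expos] by (simp add: card_PiE)

text \<open>These are exponents for a family f_0, ..., f_{k-1} of ring elements, hence indices start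
  at 0, whereas the variables of S are numbered from 1.\<close>

definition expos_deg :: "nat \<Rightarrow> nat \<Rightarrow> expo set" where
  "expos_deg k d = {a. keys a \<subseteq> {..<k} \<and> deg a = d}"

lemma finite_expos_deg [simp]: "finite (expos_deg k d)"
  by (rule finite_subset[OF _ finite_bounded_expos[of "{..<k}" d]])
    (auto simp: expos_deg_def bounded_expos_def intro: lookup_le_deg)

lemma expos_deg_0 [simp]: "expos_deg k 0 = {0}"
  by (auto simp: expos_deg_def)

text \<open>Exponents are separated by whether the last index occurs in them. The two halves become
  the parts G and f_k H of a form in the proof of Rees' theorem.\<close>

lemma expos_deg_Suc:
  "expos_deg (Suc k) (Suc d) = expos_deg k (Suc d) \<union> (\<lambda>b. b + single k 1) ` expos_deg (Suc k) d"
  "expos_deg k (Suc d) \<inter> (\<lambda>b. b + single k 1) ` expos_deg (Suc k) d = {}"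
proof -
  show "expos_deg k (Suc d) \<inter> (\<lambda>b. b + single k 1) ` expos_deg (Suc k) d = {}"
    by (auto simp: expos_deg_def keys_plus_nat)
  show "expos_deg (Suc k) (Suc d) = expos_deg k (Suc d) \<union> (\<lambda>b. b + single k 1) ` expos_deg (Suc k) d"
  proof (intro equalityI subsetI)
    fix a assume a: "a \<in> expos_deg (Suc k) (Suc d)"
    show "a \<in> expos_deg k (Suc d) \<union> (\<lambda>b. b + single k 1) ` expos_deg (Suc k) d"
    proof (cases "k \<in> keys a")
      case True
      then obtain b where b: "a = b + single k 1" "keys b \<subseteq> keys a"
        using expo_split_single[of 1 a k] by (auto simp: in_keys_iff)
      then show ?thesis using a by (auto simp: expos_deg_def)
    next
      case False
      then show ?thesis using a by (auto simp: expos_deg_def subset_iff less_Suc_eq)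
    qed
  next
    fix a assume "a \<in> expos_deg k (Suc d) \<union> (\<lambda>b. b + single k 1) ` expos_deg (Suc k) d"
    then show "a \<in> expos_deg (Suc k) (Suc d)"
      by (auto simp: expos_deg_def keys_plus_nat)
  qed
qed

section \<open>Monomials evaluated at a family of ring elements\<close>

definition mon :: "(nat \<Rightarrow> 'a::comm_ring_1) \<Rightarrow> expo \<Rightarrow> 'a" where
  "mon f a = (\<Prod>i\<in>keys a. f i ^ lookup a i)"

lemma mon_superset: "finite A \<Longrightarrow> keys a \<subseteq> A \<Longrightarrow> mon f a = (\<Prod>i\<in>A. f i ^ lookup a i)"
  unfolding mon_def by (intro prod.mono_neutral_left) (auto simp: in_keys_iff)

lemma mon_zero [simp]: "mon f 0 = 1" by (simp add: mon_def)

lemma mon_single [simp]: "mon f (single i k) = f i ^ k"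
  by (simp add: mon_def)

lemma mon_plus: "mon f (a + b) = mon f a * mon f b"
  using mon_superset[of "keys a \<union> keys b" a f] mon_superset[of "keys a \<union> keys b" b f]
  by (simp add: mon_superset[of "keys a \<union> keys b"] keys_plus_nat lookup_add power_add prod.distrib)

section \<open>Regular sequences and quasi-regularity\<close>

text \<open>The pair stands for the R-module A/B, so that computations in the quotient are done with
  elements of A modulo B. The ring R is a subset of the type, and \<open>- 1 \<in> R\<close> makes
  the submodules closed under negation.\<close>

locale ideal_pair =
  fixes R A B :: "'a::comm_ring_1 set"
  assumes R_one: "1 \<in> R" and R_minus_one: "- 1 \<in> R"
    and R_mult: "\<And>x y. x \<in> R \<Longrightarrow> y \<in> R \<Longrightarrow> x * y \<in> R"
    and A_zero: "0 \<in> A"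
    and A_add: "\<And>x y. x \<in> A \<Longrightarrow> y \<in> A \<Longrightarrow> x + y \<in> A"
    and A_mult: "\<And>r x. r \<in> R \<Longrightarrow> x \<in> A \<Longrightarrow> r * x \<in> A"
    and B_zero: "0 \<in> B"
    and B_add: "\<And>x y. x \<in> B \<Longrightarrow> y \<in> B \<Longrightarrow> x + y \<in> B"
    and B_mult: "\<And>r x. r \<in> R \<Longrightarrow> x \<in> B \<Longrightarrow> r * x \<in> B"
    and B_subset: "B \<subseteq> A"
begin

lemma A_uminus: "x \<in> A \<Longrightarrow> - x \<in> A"
  using A_mult[OF R_minus_one, of x] by simp

lemma B_uminus: "x \<in> B \<Longrightarrow> - x \<in> B"
  using B_mult[OF R_minus_one, of x] by simp

lemma A_diff: "x \<in> A \<Longrightarrow> y \<in> A \<Longrightarrow> x - y \<in> A"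
  using A_add[of x "- y"] A_uminus by simp

lemma B_diff: "x \<in> B \<Longrightarrow> y \<in> B \<Longrightarrow> x - y \<in> B"
  using B_add[of x "- y"] B_uminus by simp

lemma A_sum: "(\<And>i. i \<in> I \<Longrightarrow> g i \<in> A) \<Longrightarrow> sum g I \<in> A"
  by (induction I rule: infinite_finite_induct) (auto simp: A_zero A_add)

lemma R_power: "x \<in> R \<Longrightarrow> x ^ k \<in> R"
  by (induction k) (auto simp: R_one R_mult)

lemma R_prod: "(\<And>i. i \<in> I \<Longrightarrow> g i \<in> R) \<Longrightarrow> prod g I \<in> R"
  by (induction I rule: infinite_finite_induct) (auto simp: R_one R_mult)

lemma R_mon: "(\<And>i. i \<in> keys a \<Longrightarrow> f i \<in> R) \<Longrightarrow> mon f a \<in> R"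
  unfolding mon_def by (intro R_prod R_power) auto

text \<open>For \<open>G \<subseteq> R\<close> this is the submodule \<open>B + G A\<close>.\<close>

inductive_set gen :: "'a set \<Rightarrow> 'a set" for G where
  gen_B: "b \<in> B \<Longrightarrow> b \<in> gen G"
| gen_mult: "g \<in> G \<Longrightarrow> a \<in> A \<Longrightarrow> g * a \<in> gen G"
| gen_add: "x \<in> gen G \<Longrightarrow> y \<in> gen G \<Longrightarrow> x + y \<in> gen G"

lemma gen_zero: "0 \<in> gen G" by (rule gen_B[OF B_zero])

lemma gen_scale: "x \<in> gen G \<Longrightarrow> r \<in> R \<Longrightarrow> r * x \<in> gen G"
proof (induction rule: gen.induct)
  case (gen_mult g a)
  then have "g * (r * a) \<in> gen G" using A_mult by (intro gen.gen_mult) auto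
  then show ?case by (simp add: ac_simps)
qed (auto simp: distrib_left intro: gen.intros B_mult)

lemma gen_uminus: "x \<in> gen G \<Longrightarrow> - x \<in> gen G"
  using gen_scale[OF _ R_minus_one] by simp

lemma gen_diff: "x \<in> gen G \<Longrightarrow> y \<in> gen G \<Longrightarrow> x - y \<in> gen G"
  using gen_add[of x G "- y"] gen_uminus by simp

lemma gen_sum: "(\<And>i. i \<in> I \<Longrightarrow> g i \<in> gen G) \<Longrightarrow> sum g I \<in> gen G"
  by (induction I rule: infinite_finite_induct) (auto simp: gen_zero gen_add)

lemma gen_least:
  assumes "\<And>g a. g \<in> G \<Longrightarrow> a \<in> A \<Longrightarrow> g * a \<in> gen H"
  shows "gen G \<subseteq> gen H"
proof
  fix x assume "x \<in> gen G" then show "x \<in> gen H"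
    by induction (auto intro: gen.intros assms)
qed

lemma gen_mono: "G \<subseteq> H \<Longrightarrow> gen G \<subseteq> gen H"
  by (rule gen_least) (auto intro: gen_mult)

lemma gen_mult_left:
  assumes "x \<in> gen G" "r \<in> R" "\<And>g a. g \<in> G \<Longrightarrow> a \<in> A \<Longrightarrow> r * g * a \<in> gen H"
  shows "r * x \<in> gen H"
  using assms(1)
proof induction
  case (gen_mult g a) then show ?case using assms(3)[of g a] by (simp add: ac_simps)
qed (auto simp: distrib_left intro: gen.intros B_mult assms)

end

text \<open>The condition \<open>regular\<close> says that f_k is a nonzerodivisor on A/(B + (f_0,
  ..., f_{k-1})A), expressed through preimages in A.\<close>

locale regular_family = ideal_pair R A B for R A B :: "'a::comm_ring_1 set" +
  fixes f :: "nat \<Rightarrow> 'a" and r :: nat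
  assumes f_R: "\<And>i. i < r \<Longrightarrow> f i \<in> R"
    and regular: "\<And>k x. k < r \<Longrightarrow> x \<in> A \<Longrightarrow> f k * x \<in> gen (f ` {..<k}) \<Longrightarrow> x \<in> gen (f ` {..<k})"
begin

abbreviation J :: "nat \<Rightarrow> 'a set" where "J k \<equiv> gen (f ` {..<k})"

lemma mon_R: "k \<le> r \<Longrightarrow> keys a \<subseteq> {..<k} \<Longrightarrow> mon f a \<in> R"
  by (rule R_mon) (auto intro!: f_R)

lemma mon_mult_J:
  assumes "k \<le> r" "keys a \<subseteq> {..<k}" "a \<noteq> 0" "x \<in> A"
  shows "mon f a * x \<in> J k"
proof -
  obtain i where i: "i \<in> keys a"
    using assms(3) by (metis ex_in_conv in_keys_iff lookup_zero poly_mapping_eqI)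
  then obtain b where b: "a = b + single i 1" "keys b \<subseteq> keys a"
    using expo_split_single[of 1 a i] by (auto simp: in_keys_iff)
  have "f i * (mon f b * x) \<in> J k"
    using i assms b by (intro gen_mult A_mult[OF mon_R[of k]]) auto
  then show ?thesis by (simp add: b mon_plus ac_simps)
qed

text \<open>A generator f^b y with b in Y is read as f^a (f^c y) with b = a + c and deg a = d. If a
  is not in Y, then c is nonzero and the coefficient f^c y falls into \<open>J k\<close>; this
  clause is what allows terms of higher degree to be absorbed.\<close>

lemma gen_mon_expansion:
  assumes k: "k \<le> r" and Y: "\<And>b. b \<in> Y \<Longrightarrow> keys b \<subseteq> {..<k} \<and> d \<le> deg b"
    and x: "x \<in> gen (mon f ` Y)"
  obtains m where "x - (\<Sum>a\<in>expos_deg k d. mon f a * m a) \<in> B"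
    "\<And>a. a \<in> expos_deg k d \<Longrightarrow> m a \<in> A"
    "\<And>a. a \<in> expos_deg k d \<Longrightarrow> a \<notin> Y \<Longrightarrow> m a \<in> J k"
proof -
  have "\<exists>m. x - (\<Sum>a\<in>expos_deg k d. mon f a * m a) \<in> B \<and>
     (\<forall>a\<in>expos_deg k d. m a \<in> A \<and> (a \<notin> Y \<longrightarrow> m a \<in> J k))" using x
  proof induction
    case (gen_B b)
    then show ?case by (intro exI[of _ "\<lambda>_. 0"]) (simp add: A_zero gen_zero)
  next
    case (gen_mult g y)
    then obtain b where b: "b \<in> Y" "g = mon f b" by auto
    have kb: "keys b \<subseteq> {..<k}" "d \<le> deg b" using Y b by auto
    then obtain a c where ac: "b = a + c" "deg a = d" using expo_split_deg by blast
    have kac: "keys a \<subseteq> {..<k}" "keys c \<subseteq> {..<k}" using kb ac by (auto simp: keys_plus_nat)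
    have a: "a \<in> expos_deg k d" using ac kac by (simp add: expos_deg_def)
    define m where "m = (\<lambda>a'. if a' = a then mon f c * y else 0)"
    have "(\<Sum>a\<in>expos_deg k d. mon f a * m a) = mon f a * (mon f c * y)"
      using a by (simp add: m_def if_distrib cong: if_cong)
    then have "g * y - (\<Sum>a\<in>expos_deg k d. mon f a * m a) = 0"
      by (simp add: b ac mon_plus ac_simps)
    moreover have "m a' \<in> A" for a'
      using A_mult[OF mon_R[OF k kac(2)] gen_mult(2)] by (simp add: m_def A_zero)
    moreover have "m a' \<in> J k" if "a' \<notin> Y" for a'
    proof (cases "a' = a \<and> c \<noteq> 0")
      case True
      then show ?thesis using mon_mult_J[OF k kac(2) _ gen_mult(2)] by (simp add: m_def)
    next
      case False
      then have "a' \<noteq> a" using that b ac by auto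
      then show ?thesis by (simp add: m_def gen_zero)
    qed
    ultimately show ?case using B_zero by (intro exI[of _ m]) auto
  next
    case (gen_add x y)
    then obtain m m' where m: "x - (\<Sum>a\<in>expos_deg k d. mon f a * m a) \<in> B"
      "(\<forall>a\<in>expos_deg k d. m a \<in> A \<and> (a \<notin> Y \<longrightarrow> m a \<in> J k))"
      and m': "y - (\<Sum>a\<in>expos_deg k d. mon f a * m' a) \<in> B"
      "(\<forall>a\<in>expos_deg k d. m' a \<in> A \<and> (a \<notin> Y \<longrightarrow> m' a \<in> J k))" by blast
    have "x + y - (\<Sum>a\<in>expos_deg k d. mon f a * (m a + m' a)) =
       (x - (\<Sum>a\<in>expos_deg k d. mon f a * m a)) + (y - (\<Sum>a\<in>expos_deg k d. mon f a * m' a))"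
      by (simp add: distrib_left sum.distrib)
    have "x + y - (\<Sum>a\<in>expos_deg k d. mon f a * (m a + m' a)) \<in> B"
      unfolding \<open>_ = _\<close> by (rule B_add[OF m(1) m'(1)])
    then show ?case
      using m(2) m'(2)
      by (intro exI[of _ "\<lambda>a. m a + m' a"]) (auto intro: A_add gen.gen_add)
  qed
  then show ?thesis using that by blast
qed

text \<open>This is quasi-regularity of f_0, ..., f_{k-1} on A/B in degree d. Over all d it makes
  the associated graded module a polynomial extension of A modulo \<open>J k\<close>.\<close>

definition indep :: "nat \<Rightarrow> nat \<Rightarrow> bool" where
  "indep k d \<longleftrightarrow> (\<forall>m. (\<forall>a\<in>expos_deg k d. m a \<in> A) \<longrightarrow>
     (\<Sum>a\<in>expos_deg k d. mon f a * m a) \<in> B \<longrightarrow> (\<forall>a\<in>expos_deg k d. m a \<in> J k))"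

text \<open>A form that is only known to lie in the submodule generated by monomials of degree at
  least d is made to vanish modulo B by subtracting the expansion from
  \<open>gen_mon_expansion\<close>. The coefficient at an exponent outside Y changes only by an
  element of \<open>J k\<close>.\<close>

lemma indep_gen:
  assumes "indep k d" and k: "k \<le> r" and Y: "\<And>b. b \<in> Y \<Longrightarrow> keys b \<subseteq> {..<k} \<and> d \<le> deg b"
    and m: "\<And>a. a \<in> expos_deg k d \<Longrightarrow> m a \<in> A"
    and x: "(\<Sum>a\<in>expos_deg k d. mon f a * m a) \<in> gen (mon f ` Y)"
    and a: "a \<in> expos_deg k d" "a \<notin> Y"
  shows "m a \<in> J k"
proof -
  obtain m' where m': "(\<Sum>a\<in>expos_deg k d. mon f a * m a) - (\<Sum>a\<in>expos_deg k d. mon f a * m' a) \<in> B"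
    "\<And>a. a \<in> expos_deg k d \<Longrightarrow> m' a \<in> A" "\<And>a. a \<in> expos_deg k d \<Longrightarrow> a \<notin> Y \<Longrightarrow> m' a \<in> J k"
    using gen_mon_expansion[OF k Y x] by blast
  have "(\<Sum>a\<in>expos_deg k d. mon f a * (m a - m' a)) \<in> B"
    using m'(1) by (simp add: right_diff_distrib sum_subtractf)
  moreover have "\<forall>a\<in>expos_deg k d. m a - m' a \<in> A" using m m'(2) A_diff by blast
  ultimately have "m a - m' a \<in> J k"
    using \<open>indep k d\<close> a(1) unfolding indep_def by (auto dest!: spec[of _ "\<lambda>a. m a - m' a"])
  from gen_add[OF this m'(3)[OF a]] show ?thesis by simp
qed

lemma gen_mon_step:
  assumes "k \<le> r" "a \<in> expos_deg k d" "x \<in> J k"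
  shows "mon f a * x \<in> gen (mon f ` expos_deg k (Suc d))"
proof (rule gen_mult_left[OF assms(3)])
  show "mon f a \<in> R" using assms mon_R by (auto simp: expos_deg_def)
  fix g y assume "g \<in> f ` {..<k}" "y \<in> A"
  then obtain i where i: "i < k" "g = f i" by auto
  have "mon f (a + single i 1) * y \<in> gen (mon f ` expos_deg k (Suc d))"
    using i assms \<open>y \<in> A\<close> by (intro gen_mult imageI) (auto simp: expos_deg_def keys_plus_nat)
  then show "mon f a * g * y \<in> gen (mon f ` expos_deg k (Suc d))"
    by (simp add: mon_plus i)
qed

lemma gen_mon_Suc_subset:
  assumes "k \<le> r"
  shows "gen (mon f ` expos_deg k (Suc d)) \<subseteq> gen (mon f ` expos_deg k d)"
proof (rule gen_least, clarify)
  fix b y assume b: "b \<in> expos_deg k (Suc d)" and y: "y \<in> A"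
  then obtain a c where ac: "b = a + c" "deg a = d"
    using expo_split_deg[of d b] by (auto simp: expos_deg_def)
  then have "keys a \<subseteq> {..<k}" "keys c \<subseteq> {..<k}" using b by (auto simp: expos_deg_def keys_plus_nat)
  then have "mon f a * (mon f c * y) \<in> gen (mon f ` expos_deg k d)"
    using ac y assms by (intro gen_mult A_mult[OF mon_R[of k]] imageI) (auto simp: expos_deg_def)
  then show "mon f b * y \<in> gen (mon f ` expos_deg k d)" by (simp add: ac mon_plus ac_simps)
qed

text \<open>Thus f_k remains a nonzerodivisor modulo every power of (f_0, ..., f_{k-1}). If y is a
  form of degree d and f_k y lies in the next power, then quasi-regularity puts the f_k m_a into
  \<open>J k\<close>, regularity puts the coefficients m_a there, and so y itself moves up to the
  next power.\<close>

lemma regular_mod_powers: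
  assumes k: "k < r" and indep: "\<And>d. indep k d"
  shows "y \<in> A \<Longrightarrow> f k * y \<in> gen (mon f ` expos_deg k d) \<Longrightarrow> y \<in> gen (mon f ` expos_deg k d)"
proof (induction d)
  case 0
  then show ?case using gen_mult[of 1 "{1}" y] by simp
next
  case (Suc d)
  have "y \<in> gen (mon f ` expos_deg k d)"
    using Suc gen_mon_Suc_subset[of k d] k by auto
  then obtain m where m: "y - (\<Sum>a\<in>expos_deg k d. mon f a * m a) \<in> B" "\<And>a. a \<in> expos_deg k d \<Longrightarrow> m a \<in> A"
    using gen_mon_expansion[of k "expos_deg k d" d y] k by (auto simp: expos_deg_def)
  have fk: "f k \<in> R" using k f_R by simp
  have "(\<Sum>a\<in>expos_deg k d. mon f a * (f k * m a)) =
      f k * y - f k * (y - (\<Sum>a\<in>expos_deg k d. mon f a * m a))"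
    by (simp add: sum_distrib_left algebra_simps)
  also have "\<dots> \<in> gen (mon f ` expos_deg k (Suc d))"
    by (rule gen_diff[OF Suc.prems(2) gen_B[OF B_mult[OF fk m(1)]]])
  finally have *: "(\<Sum>a\<in>expos_deg k d. mon f a * (f k * m a)) \<in> gen (mon f ` expos_deg k (Suc d))" .
  have "f k * m a \<in> J k" if "a \<in> expos_deg k d" for a
    using that k fk m(2) A_mult by (intro indep_gen[OF indep _ _ _ *]) (auto simp: expos_deg_def)
  then have "m a \<in> J k" if "a \<in> expos_deg k d" for a
    using that regular[OF k m(2)] by blast
  then have "(\<Sum>a\<in>expos_deg k d. mon f a * m a) \<in> gen (mon f ` expos_deg k (Suc d))"
    using k by (intro gen_sum gen_mon_step) auto
  from gen_add[OF gen_B[OF m(1)] this] show ?case by simp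
qed

text \<open>Rees' theorem that regular sequences are quasi-regular, also for non-local rings: split a
  form of degree \<open>d + 1\<close> in \<open>k + 1\<close> elements as \<open>G + f\<^sub>k H\<close>, with \<open>G\<close> free of \<open>f\<^sub>k\<close>.\<close>

lemma indep_all: "k \<le> r \<Longrightarrow> indep k d"
proof (induction k arbitrary: d)
  case (0 d)
  have "expos_deg 0 d = (if d = 0 then {0} else {})" for d
    by (auto simp: expos_deg_def deg_def)
  then show ?case by (auto simp: indep_def intro: gen_B)
next
  case (Suc k d)
  then have k: "k < r" "k \<le> r" by auto
  note IHk = Suc.IH[OF k(2)]
  have sub: "J k \<subseteq> J (Suc k)" by (rule gen_mono) auto
  show ?case
  proof (induction d)
    case 0
    then show ?case by (auto simp: indep_def intro: gen_B)
  next
    case (Suc d)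
    show ?case unfolding indep_def
    proof (intro allI impI ballI)
      fix m a
      assume mA: "\<forall>a\<in>expos_deg (Suc k) (Suc d). m a \<in> A"
        and mB: "(\<Sum>a\<in>expos_deg (Suc k) (Suc d). mon f a * m a) \<in> B"
        and a: "a \<in> expos_deg (Suc k) (Suc d)"
      define G H where "G = (\<Sum>a\<in>expos_deg k (Suc d). mon f a * m a)"
        and "H = (\<Sum>b\<in>expos_deg (Suc k) d. mon f b * m (b + single k 1))"
      have inj: "inj_on (\<lambda>b. b + single k 1) (expos_deg (Suc k) d)" by (auto simp: inj_on_def)
      have "(\<Sum>a\<in>expos_deg (Suc k) (Suc d). mon f a * m a) =
          G + (\<Sum>a\<in>(\<lambda>b. b + single k 1) ` expos_deg (Suc k) d. mon f a * m a)"
        unfolding expos_deg_Suc(1) G_def by (intro sum.union_disjoint expos_deg_Suc(2)) auto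
      also have "\<dots> = G + f k * H"
        unfolding sum.reindex[OF inj] H_def by (simp add: mon_plus sum_distrib_left ac_simps)
      finally have GH: "G + f k * H \<in> B" using mB by simp
      have fk: "f k \<in> R" using k f_R by simp
      have mA1: "m b \<in> A" if "b \<in> expos_deg k (Suc d)" for b
        using that mA by (auto simp: expos_deg_Suc)
      have mA2: "m (b + single k 1) \<in> A" if "b \<in> expos_deg (Suc k) d" for b
        using that mA by (auto simp: expos_deg_Suc)
      have HA: "H \<in> A" unfolding H_def
        using Suc.prems mA2 k by (intro A_sum A_mult[OF mon_R[of "Suc k"]]) (auto simp: expos_deg_def)
      have "G \<in> gen (mon f ` expos_deg k (Suc d))"
        unfolding G_def using mA1 by (intro gen_sum gen_mult) auto
      from gen_diff[OF gen_B[OF GH] this]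
      have "f k * H \<in> gen (mon f ` expos_deg k (Suc d))" by simp
      \<comment> \<open>Modulo B the element f_k H equals - G, which lies in the power d + 1 of
        (f_0, ..., f_{k-1}); there f_k can be cancelled.\<close>
      then have H: "H \<in> gen (mon f ` expos_deg k (Suc d))"
        using regular_mod_powers[OF k(1) IHk HA] by blast
      show "m a \<in> J (Suc k)"
      proof (cases "a \<in> expos_deg k (Suc d)")
        case True
        obtain g where g: "H - (\<Sum>a\<in>expos_deg k (Suc d). mon f a * g a) \<in> B"
          "\<And>a. a \<in> expos_deg k (Suc d) \<Longrightarrow> g a \<in> A"
          using gen_mon_expansion[OF k(2) _ H, of "Suc d"] by (auto simp: expos_deg_def)
        \<comment> \<open>Inserting the expansion of H leaves a form in the first k elements only,
          to which the induction hypothesis on k applies.\<close>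
        have "(\<Sum>a\<in>expos_deg k (Suc d). mon f a * (m a + f k * g a)) =
           (G + f k * H) - f k * (H - (\<Sum>a\<in>expos_deg k (Suc d). mon f a * g a))"
          by (simp add: G_def sum_distrib_left sum.distrib algebra_simps)
        also have "\<dots> \<in> B" by (rule B_diff[OF GH B_mult[OF fk g(1)]])
        finally have sum: "(\<Sum>a\<in>expos_deg k (Suc d). mon f a * (m a + f k * g a)) \<in> B" .
        have "\<forall>a\<in>expos_deg k (Suc d). m a + f k * g a \<in> A"
          by (intro ballI A_add A_mult fk mA1 g(2))
        with IHk[of "Suc d"] sum have "m a + f k * g a \<in> J k"
          unfolding indep_def using True by (auto dest!: spec[of _ "\<lambda>a. m a + f k * g a"])
        moreover have "f k * g a \<in> J (Suc k)" using g(2)[OF True] by (intro gen_mult) auto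
        ultimately have "(m a + f k * g a) - f k * g a \<in> J (Suc k)" using sub by (intro gen_diff) auto
        then show ?thesis by simp
      next
        case False
        then obtain b where b: "b \<in> expos_deg (Suc k) d" "a = b + single k 1"
          using a by (auto simp: expos_deg_Suc)
        have "mon f ` expos_deg k (Suc d) \<subseteq> mon f ` expos_deg (Suc k) (Suc d)" 
          by (auto simp: expos_deg_Suc)
        \<comment> \<open>H is a form of degree d in k + 1 elements that lies in the power d + 1, so
          the induction on d puts its coefficients into \<open>J (Suc k)\<close>.\<close>
        then have "H \<in> gen (mon f ` expos_deg (Suc k) (Suc d))" using H gen_mono by blast
        then have "(\<lambda>b. m (b + single k 1)) b \<in> J (Suc k)"
          using Suc.prems k b mA2
          by (intro indep_gen[OF Suc.IH, of "expos_deg (Suc k) (Suc d)"]) (auto simp: expos_deg_def H_def)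
        then show ?thesis by (simp add: b)
      qed
    qed
  qed
qed

end

section \<open>Leading exponents\<close>

text \<open>Degree comes first, so that a bound on keys leaves only finitely many exponents in
  finitely many variables. Ties are broken by the order of \<open>expo\<close>, which is compatible
  with addition. Leading exponents below are the smallest ones.\<close>

definition key :: "expo \<Rightarrow> nat \<times> expo" where "key a = (deg a, a)"

lemma key_inject [simp]: "key a = key b \<longleftrightarrow> a = b" by (auto simp: key_def)

lemma key_less_iff: "key a < key b \<longleftrightarrow> deg a < deg b \<or> deg a = deg b \<and> a < b"
  by (auto simp: key_def)

lemma key_plus_less: "key a < key b \<Longrightarrow> key (a + c) < key (b + c)"
  by (auto simp: key_less_iff intro: add_strict_right_mono)

lemma key_plus_le: "key a \<le> key b \<Longrightarrow> key (a + c) \<le> key (b + c)"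
  using key_plus_less[of a b c] by (auto simp: le_less)

lemma deg_le_of_key_le: "key a \<le> key b \<Longrightarrow> deg a \<le> deg b"
  by (auto simp: key_less_iff le_less)

lemma finite_has_min_key:
  assumes "finite S" "S \<noteq> {}"
  obtains a where "a \<in> S" "\<And>b. b \<in> S \<Longrightarrow> b \<noteq> a \<Longrightarrow> key a < key b"
proof -
  from assms have "Min (key ` S) \<in> key ` S" by simp
  then obtain a where a: "a \<in> S" "key a = Min (key ` S)" by force
  moreover have "key a < key b" if "b \<in> S" "b \<noteq> a" for b
    using that a Min_le[of "key ` S" "key b"] assms by (metis finite_imageI imageI key_inject order_le_neq_trans)
  ultimately show ?thesis using that by blast
qed

lemma finite_has_max_key:
  assumes "finite S" "S \<noteq> {}"
  obtains a where "a \<in> S" "\<And>b. b \<in> S \<Longrightarrow> key b \<le> key a"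
proof -
  from assms have "Max (key ` S) \<in> key ` S" by simp
  then obtain a where a: "a \<in> S" "key a = Max (key ` S)" by force
  then show ?thesis using that Max_ge[of "key ` S"] assms by (metis finite_imageI imageI)
qed

definition expos :: "nat \<Rightarrow> expo set" where "expos r = {a. keys a \<subseteq> {..<r}}"

lemma expos_plus: "a + b \<in> expos r \<longleftrightarrow> a \<in> expos r \<and> b \<in> expos r"
  by (auto simp: expos_def keys_plus_nat)

lemma zero_in_expos [simp]: "0 \<in> expos r" by (simp add: expos_def)

context regular_family
begin

text \<open>The monomials in f with exponents in \<open>geq a\<close> and in \<open>above a\<close>
  generate, together with B, the steps F_{>=a} and F_{>a} of the f-adic filtration refined by
  \<open>key\<close>.\<close>

definition above :: "expo \<Rightarrow> expo set" where "above a = {b \<in> expos r. key a < key b}"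
definition geq :: "expo \<Rightarrow> expo set" where "geq a = {b \<in> expos r. key a \<le> key b}"

lemma mon_R_expos: "a \<in> expos r \<Longrightarrow> mon f a \<in> R"
  using mon_R[of r a] by (simp add: expos_def)

lemma from_anti_mono: "key a \<le> key b \<Longrightarrow> gen (mon f ` geq b) \<subseteq> gen (mon f ` geq a)"
  by (intro gen_mono image_mono) (auto simp: geq_def)

lemma from_subset_above: "key a < key b \<Longrightarrow> gen (mon f ` geq b) \<subseteq> gen (mon f ` above a)"
  by (intro gen_mono image_mono) (auto simp: geq_def above_def)

lemma above_subset_from: "gen (mon f ` above a) \<subseteq> gen (mon f ` geq a)"
  by (intro gen_mono image_mono) (auto simp: geq_def above_def)

lemma mon_mult_above:
  assumes "b \<in> expos r" "x \<in> gen (mon f ` above a)"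
  shows "mon f b * x \<in> gen (mon f ` above (b + a))"
proof (rule gen_mult_left[OF assms(2) mon_R_expos[OF assms(1)]], clarify)
  fix c y assume "c \<in> above a" "y \<in> A"
  then have "mon f (b + c) * y \<in> gen (mon f ` above (b + a))"
    using assms key_plus_less[of a c b]
    by (intro gen_mult imageI) (auto simp: above_def expos_plus ac_simps)
  then show "mon f b * mon f c * y \<in> gen (mon f ` above (b + a))"
    by (simp add: mon_plus)
qed

lemma mon_mult_from:
  assumes "b \<in> expos r" "x \<in> gen (mon f ` geq a)"
  shows "mon f b * x \<in> gen (mon f ` geq (b + a))"
proof (rule gen_mult_left[OF assms(2) mon_R_expos[OF assms(1)]], clarify)
  fix c y assume "c \<in> geq a" "y \<in> A"
  then have "mon f (b + c) * y \<in> gen (mon f ` geq (b + a))"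
    using assms key_plus_le[of a c b]
    by (intro gen_mult imageI) (auto simp: geq_def expos_plus ac_simps)
  then show "mon f b * mon f c * y \<in> gen (mon f ` geq (b + a))"
    by (simp add: mon_plus)
qed

lemma mon_mult_A_from: "a \<in> expos r \<Longrightarrow> x \<in> A \<Longrightarrow> mon f a * x \<in> gen (mon f ` geq a)"
  by (intro gen_mult imageI) (auto simp: geq_def)

lemma A_subset_from_0: "x \<in> A \<Longrightarrow> x \<in> gen (mon f ` geq 0)"
  using mon_mult_A_from[of 0 x] by simp

lemma mon_mult_J_above:
  assumes "a \<in> expos r" "x \<in> J r"
  shows "mon f a * x \<in> gen (mon f ` above a)"
proof (rule gen_mult_left[OF assms(2) mon_R_expos[OF assms(1)]], clarify)
  fix i y assume "i < r" "y \<in> A"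
  then have "mon f (a + single i 1) * y \<in> gen (mon f ` above a)"
    using assms(1) by (intro gen_mult imageI) (auto simp: above_def expos_def keys_plus_nat key_less_iff)
  then show "mon f a * f i * y \<in> gen (mon f ` above a)"
    by (simp add: mon_plus)
qed

text \<open>With its converse \<open>mon_mult_J_above\<close> this says that multiplication by f^a
  embeds A modulo \<open>J r\<close> into F_{>=a}/F_{>a}. It is quasi-regularity for the form with
  the single term f^a x: exponents in \<open>above a\<close> have at least the degree of a and
  differ from a.\<close>

lemma J_of_mon_mult_above:
  assumes "a \<in> expos r" "x \<in> A" "mon f a * x \<in> gen (mon f ` above a)"
  shows "x \<in> J r"
proof -
  define m where "m = (\<lambda>b. if b = a then x else 0)"
  have a: "a \<in> expos_deg r (deg a)" using assms(1) by (simp add: expos_deg_def expos_def)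
  then have "(\<Sum>b\<in>expos_deg r (deg a). mon f b * m b) = mon f a * x"
    by (simp add: m_def if_distrib cong: if_cong)
  then have "m a \<in> J r"
    using a assms A_zero deg_le_of_key_le[OF less_imp_le]
    by (intro indep_gen[OF indep_all, of r "above a" "deg a" m a])
      (auto simp: above_def expos_def m_def)
  then show ?thesis by (simp add: m_def)
qed

text \<open>The coefficient c has to avoid \<open>J r\<close>, and not merely be nonzero, because
  f^a maps \<open>J r\<close> into F_{>a}. Under this condition the initial form f^a c survives in
  F_{>=a}/F_{>a}.\<close>

definition lead :: "'a \<Rightarrow> expo \<Rightarrow> bool" where
  "lead x a \<longleftrightarrow> a \<in> expos r \<and> (\<exists>c\<in>A. c \<notin> J r \<and> x - mon f a * c \<in> gen (mon f ` above a))"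

lemma lead_expos: "lead x a \<Longrightarrow> a \<in> expos r" by (simp add: lead_def)

lemma lead_from: "lead x a \<Longrightarrow> x \<in> gen (mon f ` geq a)"
  unfolding lead_def using mon_mult_A_from above_subset_from gen_add
  by (metis diff_add_cancel subsetD)

lemma lead_not_above: "lead x a \<Longrightarrow> x \<notin> gen (mon f ` above a)"
proof
  assume "lead x a" and x: "x \<in> gen (mon f ` above a)"
  then obtain c where c: "a \<in> expos r" "c \<in> A" "c \<notin> J r" "x - mon f a * c \<in> gen (mon f ` above a)"
    by (auto simp: lead_def)
  have "mon f a * c \<in> gen (mon f ` above a)" using gen_diff[OF x c(4)] by simp
  then show False using J_of_mon_mult_above c by blast
qed

lemma lead_not_B: "lead x a \<Longrightarrow> x \<notin> B"
  using lead_not_above gen_B by blast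

lemma lead_unique:
  assumes "lead x a" "lead x b" shows "a = b"
proof -
  have "\<not> key a < key b" if "lead x a" "lead x b" for a b
    using that lead_from[of x b] lead_not_above[of x a] from_subset_above[of a b] by blast
  from this[OF assms] this[OF assms(2,1)] show ?thesis by (metis key_inject linorder_cases)
qed

text \<open>The summand for g0 contributes the initial term with exponent g0 + a, and all other
  summands lie strictly higher in the filtration. The coefficient at g0 is a unit with inverse u,
  which keeps its product with c outside \<open>J r\<close>.\<close>

lemma lead_sum_mult:
  assumes x: "lead x a" and S: "finite S" "S \<subseteq> expos r" and g0: "g0 \<in> S"
    "\<And>g. g \<in> S \<Longrightarrow> g \<noteq> g0 \<Longrightarrow> key g0 < key g"
    and k: "\<And>g. g \<in> S \<Longrightarrow> k g \<in> R" and u: "u \<in> R" "u * k g0 = 1"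
  shows "lead ((\<Sum>g\<in>S. k g * mon f g) * x) (g0 + a)"
proof -
  obtain c where c: "a \<in> expos r" "c \<in> A" "c \<notin> J r" "x - mon f a * c \<in> gen (mon f ` above a)"
    using x by (auto simp: lead_def)
  have g0': "g0 \<in> expos r" using g0 S by auto
  have "k g0 * c \<notin> J r"
  proof
    assume "k g0 * c \<in> J r"
    from gen_scale[OF this u(1)] c(3) show False by (simp add: mult.assoc[symmetric] u)
  qed
  moreover have "k g0 * c \<in> A" using A_mult k g0 c by blast
  moreover have "(\<Sum>g\<in>S. k g * mon f g) * x - mon f (g0 + a) * (k g0 * c) \<in> gen (mon f ` above (g0 + a))"
  proof -
    have "(\<Sum>g\<in>S. k g * mon f g) * x - mon f (g0 + a) * (k g0 * c) =
       k g0 * (mon f g0 * (x - mon f a * c)) + (\<Sum>g\<in>S - {g0}. k g * (mon f g * x))"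
      using S(1) g0(1) by (simp add: sum.remove sum_distrib_right sum_distrib_left mon_plus algebra_simps)
    also have "\<dots> \<in> gen (mon f ` above (g0 + a))"
    proof (rule gen_add[OF gen_scale[OF mon_mult_above[OF g0' c(4)] k[OF g0(1)]] gen_sum], rule gen_scale)
      fix g assume g: "g \<in> S - {g0}"
      then have "mon f g * x \<in> gen (mon f ` geq (g + a))"
        using S lead_from[OF x] by (intro mon_mult_from) auto
      then show "mon f g * x \<in> gen (mon f ` above (g0 + a))"
        using from_subset_above[of "g0 + a" "g + a"] key_plus_less[of g0 g a] g0 g by auto
    qed (use k g0 in auto)
    finally show ?thesis .
  qed
  ultimately show ?thesis using c g0' by (auto simp: lead_def expos_plus)
qed

text \<open>A division step: if the leading exponent of P(f) v is a multiple of the initial exponent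
  g0 of P, then f^a u c, multiplied by P(f), has the same initial term, and subtracting it from v
  raises the order. Here v may lie outside A, where it has no leading exponent of its own.\<close>

lemma lead_cancel:
  assumes x: "lead ((\<Sum>g\<in>S. k g * mon f g) * v) (g0 + a)"
    and S: "finite S" "S \<subseteq> expos r" and g0: "g0 \<in> S"
    "\<And>g. g \<in> S \<Longrightarrow> g \<noteq> g0 \<Longrightarrow> key g0 < key g"
    and k: "\<And>g. g \<in> S \<Longrightarrow> k g \<in> R" and u: "u \<in> R" "u * k g0 = 1"
  obtains c where "c \<in> A" "(\<Sum>g\<in>S. k g * mon f g) * (v - c) \<in> gen (mon f ` above (g0 + a))"
proof -
  define P where "P = (\<Sum>g\<in>S. k g * mon f g)"
  obtain c where c: "c \<in> A" "P * v - mon f (g0 + a) * c \<in> gen (mon f ` above (g0 + a))"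
    and a: "g0 \<in> expos r" "a \<in> expos r"
    using x by (auto simp: lead_def P_def expos_plus)
  have uc: "u * c \<in> A" using A_mult u c by blast
  have "P * (v - mon f a * (u * c)) =
    (P * v - mon f (g0 + a) * ((u * k g0) * c)) - (\<Sum>g\<in>S - {g0}. k g * (mon f (g + a) * (u * c)))"
    unfolding P_def using S(1) g0(1)
    by (simp add: sum.remove sum_distrib_right sum_distrib_left mon_plus algebra_simps flip: sum.distrib)
  also have "\<dots> \<in> gen (mon f ` above (g0 + a))"
  proof (rule gen_diff[OF _ gen_sum], use c(2) u in simp, rule gen_scale)
    fix g assume g: "g \<in> S - {g0}"
    then have "mon f (g + a) * (u * c) \<in> gen (mon f ` geq (g + a))"
      using S a uc by (intro mon_mult_A_from) (auto simp: expos_plus)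
    then show "mon f (g + a) * (u * c) \<in> gen (mon f ` above (g0 + a))"
      using from_subset_above[of "g0 + a" "g + a"] key_plus_less[of g0 g a] g0 g by auto
  qed (use k in auto)
  finally show ?thesis using that[of "mon f a * (u * c)"] A_mult[OF mon_R_expos[OF a(2)] uc] by (simp add: P_def)
qed

text \<open>Take the largest a with x in F_{>=a}; the bound leaves finitely many candidates. Then x
  is not in F_{>a}, so the coefficient of f^a in x cannot lie in \<open>J r\<close>.\<close>

lemma lead_exists:
  assumes x: "x \<in> A" "x \<notin> B"
    and bound: "\<And>a. a \<in> expos r \<Longrightarrow> x \<in> gen (mon f ` geq a) \<Longrightarrow> deg a \<le> N"
  shows "\<exists>a. lead x a"
proof -
  let ?S = "{a \<in> expos r. x \<in> gen (mon f ` geq a)}"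
  have "finite ?S"
    by (rule finite_subset[OF _ finite_bounded_expos[of "{..<r}" N]])
      (auto simp: bounded_expos_def expos_def intro: order_trans[OF lookup_le_deg bound])
  moreover have "0 \<in> ?S" using A_subset_from_0[OF x(1)] by simp
  ultimately obtain a where a: "a \<in> ?S" and max: "\<And>b. b \<in> ?S \<Longrightarrow> key b \<le> key a"
    using finite_has_max_key[of ?S] by blast
  \<comment> \<open>F_{>a} is the union of B and the steps F_{>=b} with b above a, since a finite
    sum lies in the step of its smallest exponent.\<close>
  have split: "y \<in> B \<or> (\<exists>b\<in>above a. y \<in> gen (mon f ` geq b))" if "y \<in> gen (mon f ` above a)" for y
    using that
  proof induction
    case (gen_mult g z)
    then show ?case using mon_mult_A_from by (auto simp: above_def)
  next
    case (gen_add y z)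
    have B: "b \<in> gen (mon f ` geq c)" if "b \<in> B" for b c using that by (rule gen_B)
    show ?case
    proof (cases "y \<in> B \<or> z \<in> B")
      case True
      then show ?thesis using gen_add.IH B_add gen.gen_add[OF B] gen.gen_add[OF _ B] by meson
    next
      case False
      then obtain b c where bc: "b \<in> above a" "y \<in> gen (mon f ` geq b)" "c \<in> above a" "z \<in> gen (mon f ` geq c)"
        using gen_add.IH by blast
      show ?thesis
      proof (cases "key b \<le> key c")
        case True
        then show ?thesis using bc from_anti_mono[OF True] gen.gen_add[of y "mon f ` geq b" z] by blast
      next
        case False
        then have "key c \<le> key b" by simp
        then show ?thesis using bc from_anti_mono[of c b] gen.gen_add[of y "mon f ` geq c" z] by blast
      qed
    qed
  qed auto
  have not_above: "x \<notin> gen (mon f ` above a)"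
    using split[of x] x(2) max by (fastforce simp: above_def)
  have "\<exists>c\<in>A. y - mon f a * c \<in> gen (mon f ` above a)" if "y \<in> gen (mon f ` geq a)" for y
    using that
  proof induction
    case (gen_B b)
    then show ?case using A_zero by (intro bexI[of _ 0]) (auto intro: gen.gen_B)
  next
    case (gen_mult g z)
    then obtain b where b: "b \<in> geq a" "g = mon f b" by auto
    show ?case
    proof (cases "b = a")
      case True
      then show ?thesis using b gen_mult gen_zero by (intro bexI[of _ z]) auto
    next
      case False
      then have "b \<in> above a" using b by (auto simp: geq_def above_def le_less)
      then show ?thesis using b gen_mult A_zero by (intro bexI[of _ 0]) (auto intro: gen.gen_mult)
    qed
  next
    case (gen_add y z)
    then obtain c d where "c \<in> A" "d \<in> A" "y - mon f a * c \<in> gen (mon f ` above a)"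
      "z - mon f a * d \<in> gen (mon f ` above a)" by blast
    moreover have "y + z - mon f a * (c + d) = (y - mon f a * c) + (z - mon f a * d)"
      by (simp add: algebra_simps)
    ultimately show ?case using A_add gen.gen_add by metis
  qed
  then obtain c where c: "c \<in> A" "x - mon f a * c \<in> gen (mon f ` above a)" using a by blast
  have "c \<notin> J r"
  proof
    assume "c \<in> J r"
    then have "mon f a * c \<in> gen (mon f ` above a)" using a by (intro mon_mult_J_above) auto
    from gen_add[OF c(2) this] show False using not_above by simp
  qed
  then show ?thesis using a c by (auto simp: lead_def)
qed

end

section \<open>Algebraic relations\<close>

text \<open>Gaussian elimination: an equation with a nonzero coefficient at x0 removes this unknown
  from the others, leaving one unknown and one equation fewer.\<close>

lemma homogeneous_system_nontrivial_solution:
  fixes a :: "'x \<Rightarrow> 'y \<Rightarrow> 'k::field"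
  assumes "finite Y" "finite X" "card Y < card X"
  shows "\<exists>c. (\<exists>x\<in>X. c x \<noteq> 0) \<and> (\<forall>y\<in>Y. (\<Sum>x\<in>X. c x * a x y) = 0)"
  using assms
proof (induction Y arbitrary: X a rule: finite_induct)
  case empty
  then show ?case by (intro exI[of _ "\<lambda>_. 1"]) (auto simp: card_gt_0_iff)
next
  case (insert y Y)
  show ?case
  proof (cases "\<forall>x\<in>X. a x y = 0")
    case True
    then show ?thesis using insert.IH[of X a] insert.prems insert.hyps by auto
  next
    case False
    then obtain x0 where x0: "x0 \<in> X" "a x0 y \<noteq> 0" by blast
    have "card Y < card (X - {x0})" using insert.prems insert.hyps x0 by simp
    then obtain c where c: "\<exists>x\<in>X - {x0}. c x \<noteq> 0"
      "\<And>z. z \<in> Y \<Longrightarrow> (\<Sum>x\<in>X - {x0}. c x * (a x z - a x y / a x0 y * a x0 z)) = 0"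
      using insert.IH[of "X - {x0}" "\<lambda>x z. a x z - a x y / a x0 y * a x0 z"] insert.prems by auto
    \<comment> \<open>This value of the unknown x0 is forced by the equation y.\<close>
    define c0 where "c0 = - (\<Sum>x\<in>X - {x0}. c x * a x y) / a x0 y"
    define c' where "c' = c(x0 := c0)"
    have S: "(\<Sum>x\<in>X. c' x * a x z) = c0 * a x0 z + (\<Sum>x\<in>X - {x0}. c x * a x z)" for z
      using insert.prems x0 by (simp add: sum.remove c'_def)
    have "(\<Sum>x\<in>X. c' x * a x z) = 0" if "z \<in> insert y Y" for z
    proof (cases "z = y")
      case True
      then show ?thesis using x0 by (simp add: S c0_def)
    next
      case False
      then have "0 = (\<Sum>x\<in>X - {x0}. c x * (a x z - a x y / a x0 y * a x0 z))" using c that by simp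
      also have "\<dots> = (\<Sum>x\<in>X - {x0}. c x * a x z) - (\<Sum>x\<in>X - {x0}. c x * a x y) / a x0 y * a x0 z"
        by (simp add: algebra_simps sum_subtractf sum_distrib_left sum_divide_distrib sum_distrib_right)
      finally show ?thesis by (simp add: S c0_def)
    qed
    moreover have "\<exists>x\<in>X. c' x \<noteq> 0" using c(1) by (auto simp: c'_def)
    ultimately show ?thesis by blast
  qed
qed

section \<open>Polynomials with prescribed support\<close>

definition polys :: "expo set \<Rightarrow> 'k::field mpoly set" where "polys X = {p. keys p \<subseteq> X}"

definition full :: "nat \<Rightarrow> expo set" where "full n = {a. keys a \<subseteq> {1..n}}"

lemma full_plus: "a + b \<in> full n \<longleftrightarrow> a \<in> full n \<and> b \<in> full n"
  by (auto simp: full_def keys_plus_nat)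

lemma zero_in_full [simp]: "0 \<in> full n" by (simp add: full_def)

text \<open>These are the exponent sets of the monomials in a monomial ideal, which is then
  \<open>polys E\<close>.\<close>

definition upset :: "nat \<Rightarrow> expo set \<Rightarrow> bool" where
  "upset n E \<longleftrightarrow> E \<subseteq> full n \<and> (\<forall>a\<in>E. \<forall>b\<in>full n. b + a \<in> E)"

lemma upset_full: "upset n (full n)" and upset_empty: "upset n {}"
  by (auto simp: upset_def full_plus)

lemma polys_zero: "0 \<in> polys X" by (simp add: polys_def)

lemma polys_add: "p \<in> polys X \<Longrightarrow> q \<in> polys X \<Longrightarrow> p + q \<in> polys X"
  using Poly_Mapping.keys_add[of p q] by (auto simp: polys_def)

lemma polys_uminus: "p \<in> polys X \<Longrightarrow> - p \<in> polys X"
  by (auto simp: polys_def keys_uminus)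

lemma polys_diff: "p \<in> polys X \<Longrightarrow> q \<in> polys X \<Longrightarrow> p - q \<in> polys X"
  using polys_add[of p X "- q"] polys_uminus[of q] by simp

lemma polys_sum: "(\<And>i. i \<in> I \<Longrightarrow> g i \<in> polys X) \<Longrightarrow> sum g I \<in> polys X"
  by (induction I rule: infinite_finite_induct) (auto simp: polys_zero polys_add)

lemma polys_mult:
  assumes "p \<in> polys X" "q \<in> polys Y" "\<And>a b. a \<in> X \<Longrightarrow> b \<in> Y \<Longrightarrow> a + b \<in> Z"
  shows "p * q \<in> polys Z"
  using assms Poly_Mapping.keys_mult[of p q] unfolding polys_def by blast

lemma polys_single: "a \<in> X \<Longrightarrow> single a c \<in> polys X" by (simp add: polys_def)

lemma polys_empty [simp]: "polys {} = {0}"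
  by (auto simp: polys_def in_keys_iff intro: poly_mapping_eqI)

lemma polys_mono: "X \<subseteq> Y \<Longrightarrow> polys X \<subseteq> polys Y" by (auto simp: polys_def)

lemma lookup_const_mult: "lookup (single 0 c * p) a = c * lookup p (a :: expo)"
proof -
  have "single 0 c * p = Poly_Mapping.map ((*) c) p" by (simp add: mult_map_scale_conv_mult)
  then show ?thesis by (simp add: Poly_Mapping.map.rep_eq when_def)
qed

lemma carrier_poly_ring: "carrier (poly_ring {1..n}) = polys (full n)"
  by (auto simp: poly_ring_def polys_def full_def)

lemma ideal_pair_polys:
  assumes "upset n EA" "upset n EB" "EB \<subseteq> EA"
  shows "ideal_pair (polys (full n) :: 'k::field mpoly set) (polys EA) (polys EB)"
proof
  show "1 \<in> (polys (full n) :: 'k mpoly set)" by (simp add: polys_def)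
  then show "- 1 \<in> (polys (full n) :: 'k mpoly set)" by (rule polys_uminus)
  have "p * q \<in> polys E" if "p \<in> polys (full n)" "q \<in> polys E" "upset n E" for p q :: "'k mpoly" and E
    using that by (intro polys_mult[of p "full n" q E]) (auto simp: upset_def)
  note mult = this
  show "p \<in> polys (full n) \<Longrightarrow> q \<in> polys EA \<Longrightarrow> p * q \<in> polys EA" for p q :: "'k mpoly"
    by (rule mult[OF _ _ assms(1)])
  show "p \<in> polys (full n) \<Longrightarrow> q \<in> polys EB \<Longrightarrow> p * q \<in> polys EB" for p q :: "'k mpoly"
    by (rule mult[OF _ _ assms(2)])
  show "p \<in> polys (full n) \<Longrightarrow> q \<in> polys (full n) \<Longrightarrow> p * q \<in> polys (full n)" for p q :: "'k mpoly"
    by (rule mult[OF _ _ upset_full])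
qed (use assms polys_mono in \<open>auto simp: polys_zero polys_add\<close>)

text \<open>P is meant as a condition on exponents graded by the degree in g, such as a degree
  bound. Being additive, it passes from the factors to every product of deg a of them.\<close>

lemma keys_mon_induct:
  fixes g :: "nat \<Rightarrow> 'k::field mpoly" and P :: "nat \<Rightarrow> expo \<Rightarrow> bool"
  assumes "P 0 0" and "\<And>d e x y. P d x \<Longrightarrow> P e y \<Longrightarrow> P (d + e) (x + y)"
    and "\<And>i x. i \<in> keys a \<Longrightarrow> x \<in> keys (g i) \<Longrightarrow> P 1 x"
  shows "x \<in> keys (mon g a) \<Longrightarrow> P (deg a) x"
proof -
  have mult: "\<forall>x\<in>keys (p * q). P (d + e) x" if "\<forall>x\<in>keys p. P d x" "\<forall>x\<in>keys q. P e x"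
    for p q :: "'k mpoly" and d e
    using that assms(2) Poly_Mapping.keys_mult[of p q] by blast
  have pow: "\<forall>x\<in>keys (p ^ k). P k x" if "\<forall>x\<in>keys p. P 1 x" for p :: "'k mpoly" and k
    using that mult[OF that] by (induction k) (auto simp: assms(1))
  have "\<forall>x\<in>keys (\<Prod>i\<in>I. g i ^ lookup a i). P (\<Sum>i\<in>I. lookup a i) x" if "finite I" "I \<subseteq> keys a" for I
    using that
  proof (induction rule: finite_induct)
    case (insert i I)
    then have "\<forall>x\<in>keys (g i ^ lookup a i). P (lookup a i) x"
      by (intro pow ballI assms(3)) auto
    moreover have "\<forall>x\<in>keys (\<Prod>i\<in>I. g i ^ lookup a i). P (\<Sum>i\<in>I. lookup a i) x"
      using insert by simp
    ultimately show ?case unfolding prod.insert[OF insert.hyps] sum.insert[OF insert.hyps] by (rule mult)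
  qed (simp add: assms(1))
  from this[of "keys a"] show "x \<in> keys (mon g a) \<Longrightarrow> P (deg a) x" by (auto simp: mon_def deg_def)
qed

text \<open>A dimension count: \<open>(N + 1)\<^sup>s\<close> products of powers of \<open>s > n - q\<close> elements are linearly
  dependent modulo \<open>(x\<^sub>1, \<dots>, x\<^sub>q)\<close>, because only the \<open>n - q\<close> remaining variables count there.\<close>

lemma algebraic_relation_exists:
  fixes g :: "nat \<Rightarrow> 'k::field mpoly"
  assumes Z: "finite Z" and g: "\<And>i. i \<in> Z \<Longrightarrow> g i \<in> polys (full n)"
    and q: "q \<le> n" "n - q < card Z"
  obtains S c where "finite S" "S \<noteq> {}" "\<And>a. a \<in> S \<Longrightarrow> keys a \<subseteq> Z" "\<And>a. a \<in> S \<Longrightarrow> c a \<noteq> 0"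
    "(\<Sum>a\<in>S. single 0 (c a) * mon g a) \<in> polys {b \<in> full n. keys b \<inter> {1..q} \<noteq> {}}"
proof -
  define d s where "d = n - q" and "s = card Z"
  define D where "D = (\<Sum>i\<in>Z. \<Sum>x\<in>keys (g i). deg x)"
  have D: "lookup x j \<le> D" if "i \<in> Z" "x \<in> keys (g i)" for i x j
  proof -
    have "lookup x j \<le> deg x" by (rule lookup_le_deg)
    also have "\<dots> \<le> (\<Sum>x\<in>keys (g i). deg x)" using that by (intro member_le_sum) auto
    also have "\<dots> \<le> D" unfolding D_def
      using that Z by (intro member_le_sum[where f="\<lambda>i. \<Sum>x\<in>keys (g i). deg x"]) auto
    finally show ?thesis .
  qed
  \<comment> \<open>N makes the unknowns outnumber the equations: (s N D + 1)^d <= ((D s + 1)(N +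
    1))^d = N (N + 1)^d < (N + 1)^(d + 1) <= (N + 1)^s.\<close>
  define N where "N = (D * s + 1) ^ d"
  define X Y where "X = bounded_expos Z N" and "Y = bounded_expos {q+1..n} (s * N * D)"
  have "card Y = Suc (s * N * D) ^ d" unfolding Y_def d_def by (subst card_bounded_expos) auto
  also have "\<dots> \<le> ((D * s + 1) * (N + 1)) ^ d" by (intro power_mono) (auto simp: algebra_simps)
  also have "\<dots> = N * (N + 1) ^ d" by (simp only: power_mult_distrib N_def)
  also have "\<dots> < (N + 1) ^ Suc d" by simp
  also have "\<dots> \<le> (N + 1) ^ s" using q by (intro power_increasing) (auto simp: d_def s_def)
  also have "\<dots> = card X" unfolding X_def s_def by (subst card_bounded_expos) (auto simp: Z)
  finally have card: "card Y < card X" .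
  have fin: "finite X" "finite Y" by (auto simp: X_def Y_def Z intro: finite_bounded_expos)
  \<comment> \<open>There is one unknown for each product of powers with exponents at most N, and
    one equation for each monomial in x_{q+1}, ..., x_n that can occur in such a product.\<close>
  obtain c where c: "\<exists>x\<in>X. c x \<noteq> 0" "\<forall>y\<in>Y. (\<Sum>x\<in>X. c x * lookup (mon g x) y) = 0"
    using homogeneous_system_nontrivial_solution[OF fin(2,1) card, of "\<lambda>x y. lookup (mon g x) y"] by blast
  define S where "S = {x \<in> X. c x \<noteq> 0}"
  define p where "p = (\<Sum>a\<in>S. single 0 (c a) * mon g a)"
  have "lookup x j \<le> s * N * D" if "a \<in> X" "x \<in> keys (mon g a)" for a x j
  proof -
    have a: "keys a \<subseteq> Z" "\<And>i. lookup a i \<le> N" using that by (auto simp: X_def bounded_expos_def)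
    have "\<forall>j. lookup x j \<le> deg a * D"
      by (rule keys_mon_induct[where P="\<lambda>d x. \<forall>j. lookup x j \<le> d * D", OF _ _ _ that(2)])
        (use a(1) in \<open>auto simp: lookup_add distrib_right intro: add_mono D\<close>)
    moreover have "deg a * D \<le> s * N * D" using deg_le_bound[OF Z a(1), of N] a(2) by (simp add: s_def)
    ultimately show ?thesis using le_trans by blast
  qed
  note bound = this
  have mon: "mon g a \<in> polys (full n)" if "a \<in> X" for a
  proof -
    have "x \<in> full n" if "x \<in> keys (mon g a)" for x
      by (rule keys_mon_induct[where P="\<lambda>_ x. x \<in> full n" and g=g and a=a, OF _ _ _ that])
        (use \<open>a \<in> X\<close> g in \<open>auto simp: full_plus X_def bounded_expos_def polys_def\<close>)
    then show ?thesis by (auto simp: polys_def)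
  qed
  have "p \<in> polys (full n)"
    unfolding p_def S_def using mon by (intro polys_sum polys_mult[of _ "{0}" _ "full n"]) (auto simp: polys_def)
  moreover have "keys b \<inter> {1..q} \<noteq> {}" if b: "b \<in> keys p" for b
  proof
    assume *: "keys b \<inter> {1..q} = {}"
    have "p = (\<Sum>a\<in>X. single 0 (c a) * mon g a)"
      unfolding p_def S_def by (intro sum.mono_neutral_left) (auto simp: fin)
    then have lp: "lookup p b = (\<Sum>a\<in>X. c a * lookup (mon g a) b)"
      by (simp add: lookup_sum lookup_const_mult)
    then have "(\<Sum>a\<in>X. c a * lookup (mon g a) b) \<noteq> 0" using b by (simp add: in_keys_iff)
    then obtain a where a: "a \<in> X" "c a * lookup (mon g a) b \<noteq> 0"
      using sum.not_neutral_contains_not_neutral by blast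
    then have "\<And>j. lookup b j \<le> s * N * D" using bound[OF a(1), of b] by (simp add: in_keys_iff)
    moreover have "b \<in> full n" using b \<open>p \<in> polys (full n)\<close> by (auto simp: polys_def)
    ultimately have "b \<in> Y" using * unfolding Y_def bounded_expos_def full_def by force
    then show False using c(2) lp b by (simp add: in_keys_iff)
  qed
  ultimately have "p \<in> polys {b \<in> full n. keys b \<inter> {1..q} \<noteq> {}}" by (auto simp: polys_def)
  moreover have "finite S" using fin by (simp add: S_def)
  moreover have "S \<noteq> {}" "\<And>a. a \<in> S \<Longrightarrow> keys a \<subseteq> Z" "\<And>a. a \<in> S \<Longrightarrow> c a \<noteq> 0"
    using c(1) by (auto simp: S_def X_def bounded_expos_def)
  ultimately show ?thesis unfolding p_def by (intro that)
qed

text \<open>No other pair of exponents has the sum a + b, since a larger exponent in either place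
  enlarges the sum. Hence nothing cancels there.\<close>

lemma min_keys_plus_in_keys_mult:
  fixes p q :: "'k::field mpoly"
  assumes a: "a \<in> keys p" "\<And>x. x \<in> keys p \<Longrightarrow> x \<noteq> a \<Longrightarrow> key a < key x"
    and b: "b \<in> keys q" "\<And>x. x \<in> keys q \<Longrightarrow> x \<noteq> b \<Longrightarrow> key b < key x"
  shows "a + b \<in> keys (p * q)"
proof -
  define p' q' where "p' = p - single a (lookup p a)" and "q' = q - single b (lookup q b)"
  have p': "x \<noteq> a \<and> x \<in> keys p" if "x \<in> keys p'" for x
    using that by (auto simp: in_keys_iff p'_def lookup_minus lookup_single when_def split: if_splits)
  have q': "x \<noteq> b \<and> x \<in> keys q" if "x \<in> keys q'" for x
    using that by (auto simp: in_keys_iff q'_def lookup_minus lookup_single when_def split: if_splits)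
  have 1: "a + b \<notin> keys (p' * q)"
  proof
    assume "a + b \<in> keys (p' * q)"
    then obtain x y where xy: "x \<in> keys p'" "y \<in> keys q" "a + b = x + y"
      using Poly_Mapping.keys_mult[of p' q] by blast
    have "key (a + b) < key (x + b)" using p'[OF xy(1)] a(2) key_plus_less by blast
    also have "\<dots> \<le> key (x + y)" using key_plus_le[of b y x] b(2)[OF xy(2)] by (cases "y = b") (auto simp: ac_simps)
    finally show False using xy by simp
  qed
  have 2: "a + b \<notin> keys (single a (lookup p a) * q')"
  proof
    assume "a + b \<in> keys (single a (lookup p a) * q')"
    then obtain x y where "x = a" "y \<in> keys q'" "a + b = x + y"
      using Poly_Mapping.keys_mult[of "single a (lookup p a)" q'] by (auto split: if_splits)
    then show False using q'[of y] by simp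
  qed
  have "p * q = single (a + b) (lookup p a * lookup q b) + single a (lookup p a) * q' + p' * q"
    by (simp add: p'_def q'_def algebra_simps flip: mult_single)
  then have "lookup (p * q) (a + b) = lookup p a * lookup q b"
    using 1 2 by (simp add: lookup_add in_keys_iff)
  then show ?thesis using a b by (simp add: in_keys_iff)
qed

lemma min_key_exists:
  fixes p :: "'k::field mpoly"
  assumes "p \<noteq> 0"
  obtains a where "a \<in> keys p" "\<And>x. x \<in> keys p \<Longrightarrow> x \<noteq> a \<Longrightarrow> key a < key x"
proof -
  have "keys p \<noteq> {}" using assms polys_empty by (auto simp: polys_def)
  then show ?thesis using finite_has_min_key[of "keys p"] that by auto
qed

section \<open>Lengths of regular sequences\<close>

text \<open>Sequences from the irrelevant ideal have no constant terms, which ties the f-adic order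
  to the degree in the variables.\<close>

locale monomial_quotient = regular_family "polys (full n)" "polys EA" "polys EB" f r
  for n :: nat and EA EB :: "expo set" and f :: "nat \<Rightarrow> 'k::field mpoly" and r :: nat +
  assumes EA: "upset n EA" and EB: "upset n EB" and EB_subset: "EB \<subseteq> EA"
    and no_constant_term: "\<And>i. i < r \<Longrightarrow> 0 \<notin> keys (f i)"
begin

lemma deg_keys_mon: "a \<in> expos r \<Longrightarrow> x \<in> keys (mon f a) \<Longrightarrow> deg a \<le> deg x"
  by (rule keys_mon_induct[where P="\<lambda>d x. d \<le> deg x"])
    (use no_constant_term in \<open>auto simp: expos_def Suc_le_eq simp flip: neq0_conv\<close>)

text \<open>All terms of f^b have degree at least deg b. A single term of p outside EB therefore
  bounds the filtration steps containing p; this replaces Krull's intersection theorem and supplies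
  the bound for \<open>lead_exists\<close>.\<close>

lemma deg_keys_geq:
  assumes "p \<in> gen (mon f ` geq a)" "x \<in> keys p" "x \<notin> EB"
  shows "deg a \<le> deg x"
proof -
  have "\<forall>x\<in>keys p. x \<in> EB \<or> deg a \<le> deg x" using assms(1)
  proof induction
    case (gen_B b)
    then show ?case by (auto simp: polys_def)
  next
    case (gen_mult g p)
    then obtain b where b: "b \<in> expos r" "key a \<le> key b" "g = mon f b" by (auto simp: geq_def)
    show ?case
    proof
      fix x assume "x \<in> keys (g * p)"
      then obtain y z where "x = y + z" "y \<in> keys (mon f b)"
        using Poly_Mapping.keys_mult[of g p] b by blast
      then show "x \<in> EB \<or> deg a \<le> deg x"
        using deg_keys_mon[OF b(1)] deg_le_of_key_le[OF b(2)] by fastforce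
    qed
  next
    case (gen_add p q)
    then show ?case using Poly_Mapping.keys_add[of p q] by blast
  qed
  then show ?thesis using assms by blast
qed

lemma lead_exists_outside_B:
  assumes "p \<in> polys EA" "p \<notin> polys EB"
  shows "\<exists>a. lead p a"
proof -
  from assms(2) obtain x where "x \<in> keys p" "x \<notin> EB" by (auto simp: polys_def)
  then show ?thesis using assms by (intro lead_exists[of p "deg x"]) (auto intro: deg_keys_geq)
qed

lemma lead_relation_mult:
  assumes "lead p a" "finite S" "S \<subseteq> expos r" "\<And>g. g \<in> S \<Longrightarrow> c g \<noteq> 0"
    "g0 \<in> S" "\<And>g. g \<in> S \<Longrightarrow> g \<noteq> g0 \<Longrightarrow> key g0 < key g"
  shows "lead ((\<Sum>g\<in>S. single 0 (c g) * mon f g) * p) (g0 + a)"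
  using assms
  by (intro lead_sum_mult[where u="single 0 (inverse (c g0))"])
    (auto simp: polys_single mult_single)

end

text \<open>Each monomial of p is divisible by some x_i with i <= q, and x_i already multiplies the
  monomial of w into the ideal.\<close>

lemma mult_single_in_polys:
  assumes w: "w \<in> full n" "\<And>i. i \<in> {1..q} \<Longrightarrow> single i 1 + w \<in> E" and E: "upset n E"
    and p: "p \<in> polys {b \<in> full n. keys b \<inter> {1..q} \<noteq> {}}"
  shows "p * single w 1 \<in> polys E"
proof (rule polys_mult[OF p, of _ "{w}"])
  fix a b assume "a \<in> {b \<in> full n. keys b \<inter> {1..q} \<noteq> {}}" "b \<in> {w}"
  then obtain i where i: "i \<in> keys a" "i \<in> {1..q}" "a \<in> full n" "b = w" by blast
  then obtain c where c: "a = c + single i 1" "keys c \<subseteq> keys a"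
    using expo_split_single[of 1 a i] by (auto simp: in_keys_iff)
  then have "c \<in> full n" using i by (auto simp: full_def)
  then have "c + (single i 1 + w) \<in> E" using E w(2)[OF i(2)] unfolding upset_def by blast
  then show "a + b \<in> E" by (simp add: c i add.assoc)
qed (simp add: polys_def)

text \<open>With more than n - q elements, a relation P(f) in (x_1, ..., x_q) would kill the nonzero
  class of w in S/I. But the product has a leading exponent, the sum of those of P and w, and so is
  not zero.\<close>

lemma regular_length_quotient_le:
  assumes "monomial_quotient n (full n) E f r"
    and w: "w \<in> full n" "w \<notin> E" "\<And>i. i \<in> {1..q} \<Longrightarrow> single i 1 + w \<in> E" and q: "q \<le> n"
  shows "r \<le> n - q"
proof (rule ccontr)
  interpret monomial_quotient n "full n" E f r by fact
  assume "\<not> r \<le> n - q"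
  then have r: "n - q < card {..<r}" by simp
  obtain S c where S: "finite S" "S \<noteq> {}" "\<And>a. a \<in> S \<Longrightarrow> keys a \<subseteq> {..<r}" "\<And>a. a \<in> S \<Longrightarrow> c a \<noteq> 0"
    and rel: "(\<Sum>a\<in>S. single 0 (c a) * mon f a) \<in> polys {b \<in> full n. keys b \<inter> {1..q} \<noteq> {}}"
    using algebraic_relation_exists[OF _ _ q r, of f] f_R by auto
  obtain g0 where g0: "g0 \<in> S" "\<And>g. g \<in> S \<Longrightarrow> g \<noteq> g0 \<Longrightarrow> key g0 < key g"
    using finite_has_min_key[OF S(1,2)] by blast
  obtain a where "lead (single w 1) a"
    using lead_exists_outside_B[of "single w 1"] w by (auto simp: polys_def)
  moreover have "S \<subseteq> expos r" using S(3) by (auto simp: expos_def)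
  ultimately have "lead ((\<Sum>g\<in>S. single 0 (c g) * mon f g) * single w 1) (g0 + a)"
    using S(1,4) g0 by (intro lead_relation_mult) auto
  from lead_not_B[OF this] mult_single_in_polys[OF w(1,3) EB rel] show False by simp
qed

text \<open>From at least n - q + 2 elements any f_i can be left out, and the others still satisfy a
  relation \<open>P i\<close>. As w lies outside the module I, it has no leading exponent there; the
  members v of its coset are studied through the products of v with the \<open>P i\<close>, which
  lie in I.\<close>

lemma regular_length_ideal_le:
  assumes "monomial_quotient n E {} f r"
    and w: "w \<in> full n" "w \<notin> E" "\<And>i. i \<in> {1..q} \<Longrightarrow> single i 1 + w \<in> E" and q: "q \<le> n" "1 \<le> q"
  shows "r \<le> n - q + 1"
proof (rule ccontr)
  interpret monomial_quotient n E "{}" f r by fact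
  assume "\<not> r \<le> n - q + 1"
  then have r: "n - q < r - 1" "0 < r" by auto
  define relation where "relation i S c g0 \<longleftrightarrow>
     finite S \<and> S \<subseteq> expos r \<and> (\<forall>a\<in>S. i \<notin> keys a \<and> c a \<noteq> 0) \<and>
     (\<Sum>a\<in>S. single 0 (c a) * mon f a) \<in> polys {b \<in> full n. keys b \<inter> {1..q} \<noteq> {}} \<and>
     g0 \<in> S \<and> (\<forall>g\<in>S. g \<noteq> g0 \<longrightarrow> key g0 < key g)" for i :: nat and S :: "expo set" and c :: "expo \<Rightarrow> 'a" and g0
  have "\<exists>S c g0. relation i S c g0" if "i < r" for i
  proof -
    have "n - q < card ({..<r} - {i})" using r that by simp
    then obtain S c where S: "finite S" "S \<noteq> {}" "\<And>a. a \<in> S \<Longrightarrow> keys a \<subseteq> {..<r} - {i}"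
      "\<And>a. a \<in> S \<Longrightarrow> c a \<noteq> 0"
      and rel: "(\<Sum>a\<in>S. single 0 (c a) * mon f a) \<in> polys {b \<in> full n. keys b \<inter> {1..q} \<noteq> {}}"
      using algebraic_relation_exists[of "{..<r} - {i}" f n q] q f_R by auto
    obtain g0 where g0: "g0 \<in> S" "\<And>g. g \<in> S \<Longrightarrow> g \<noteq> g0 \<Longrightarrow> key g0 < key g"
      using finite_has_min_key[OF S(1,2)] by blast
    have "S \<subseteq> expos r" "\<And>a. a \<in> S \<Longrightarrow> i \<notin> keys a" using S(3) by (auto simp: expos_def)
    then have "relation i S c g0" using S rel g0 unfolding relation_def by simp
    then show ?thesis by blast
  qed
  then obtain S c g0 where "\<And>i. i < r \<Longrightarrow> relation i (S i) (c i) (g0 i)" by metis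
  then have rel: "\<And>i. i < r \<Longrightarrow> finite (S i) \<and> S i \<subseteq> expos r \<and> (\<forall>a\<in>S i. i \<notin> keys a \<and> c i a \<noteq> 0) \<and>
     (\<Sum>a\<in>S i. single 0 (c i a) * mon f a) \<in> polys {b \<in> full n. keys b \<inter> {1..q} \<noteq> {}} \<and>
     g0 i \<in> S i \<and> (\<forall>g\<in>S i. g \<noteq> g0 i \<longrightarrow> key (g0 i) < key g)"
    by (simp add: relation_def)
  define P where "P i = (\<Sum>a\<in>S i. single 0 (c i a) * mon f a)" for i
  have lead_P: "lead (P i * p) (g0 i + a)" if "lead p a" "i < r" for p a i
    unfolding P_def using rel[OF that(2)] by (intro lead_relation_mult[OF that(1)]) auto
  have P_full: "P i \<in> polys (full n)" if "i < r" for i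
    using rel[OF that] polys_mono[of "{b \<in> full n. keys b \<inter> {1..q} \<noteq> {}}" "full n"] unfolding P_def by blast

  \<comment> \<open>The monomial x_1 w is a nonzero element of the ideal, so it has a leading
    exponent, and so has its product with \<open>P i\<close>. Hence \<open>P i\<close> is
    nonzero.\<close>
  have w1: "single (single 1 1 + w) 1 \<in> polys E" using w q by (auto simp: polys_def)
  have P_nonzero: "P i \<noteq> 0" if "i < r" for i
  proof -
    have "(single (single 1 1 + w) 1 :: 'a mpoly) \<noteq> 0"
      by (metis lookup_single_eq lookup_zero one_neq_zero)
    then obtain a where "lead (single (single 1 1 + w) 1) a"
      using lead_exists_outside_B[OF w1] by auto
    from lead_not_B[OF lead_P[OF this that]] show ?thesis by (auto simp: polys_zero)
  qed

  \<comment> \<open>V is the coset of w modulo the ideal. Since w is outside E, its coefficient is 1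
    in every member of V.\<close>
  define W where "W = (single w 1 :: 'a mpoly)"
  define V where "V = {v. v - W \<in> polys E}"
  have lookup_V: "lookup v w = 1" if "v \<in> V" for v
  proof -
    have "w \<notin> keys (v - W)" using that w(2) by (auto simp: V_def polys_def)
    then show ?thesis by (simp add: in_keys_iff lookup_minus W_def)
  qed
  have PV: "P i * v \<in> polys E" if "v \<in> V" "i < r" for v i
  proof -
    have "P i * W \<in> polys E"
      using rel[OF that(2)] mult_single_in_polys[OF w(1,3) EA] unfolding P_def W_def by blast
    moreover have "P i * (v - W) \<in> polys E"
      using A_mult[OF P_full[OF that(2)]] that(1) by (simp add: V_def)
    ultimately have "P i * W + P i * (v - W) \<in> polys E" by (rule polys_add)
    then show ?thesis by (simp add: right_diff_distrib)
  qed
  have lead_V: "\<exists>a. lead (P i * v) a" if "v \<in> V" "i < r" for v i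
  proof -
    have "v \<noteq> 0" using lookup_V[OF that(1)] by auto
    then have "P i * v \<noteq> 0" using P_nonzero[OF that(2)] by simp
    then show ?thesis using lead_exists_outside_B[OF PV[OF that]] by simp
  qed

  \<comment> \<open>These leading exponents are bounded: the smallest exponent of v is at most w,
    and its sum with the smallest exponent \<alpha> of \<open>P 0\<close> occurs in the product,
    whose order is thus at most deg \<alpha> + deg w.\<close>
  define T where "T = {a. \<exists>v\<in>V. lead (P 0 * v) a}"
  obtain \<alpha> where \<alpha>: "\<alpha> \<in> keys (P 0)" "\<And>x. x \<in> keys (P 0) \<Longrightarrow> x \<noteq> \<alpha> \<Longrightarrow> key \<alpha> < key x"
    using min_key_exists[OF P_nonzero[OF r(2)]] by blast
  have "T \<subseteq> bounded_expos {..<r} (deg \<alpha> + deg w)"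
  proof
    fix a assume "a \<in> T"
    then obtain v where v: "v \<in> V" "lead (P 0 * v) a" by (auto simp: T_def)
    have "w \<in> keys v" using lookup_V[OF v(1)] by (simp add: in_keys_iff)
    then have "v \<noteq> 0" by auto
    then obtain \<beta> where \<beta>: "\<beta> \<in> keys v" "\<And>x. x \<in> keys v \<Longrightarrow> x \<noteq> \<beta> \<Longrightarrow> key \<beta> < key x"
      using min_key_exists by blast
    have "deg a \<le> deg (\<alpha> + \<beta>)"
      using deg_keys_geq[OF lead_from[OF v(2)] min_keys_plus_in_keys_mult[OF \<alpha> \<beta>]] by simp
    also have "key \<beta> \<le> key w" using \<beta>(2)[OF \<open>w \<in> keys v\<close>] by (cases "w = \<beta>") auto
    then have "deg (\<alpha> + \<beta>) \<le> deg \<alpha> + deg w" using deg_le_of_key_le by simp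
    finally have "lookup a i \<le> deg \<alpha> + deg w" for i using lookup_le_deg[of a i] by simp
    then show "a \<in> bounded_expos {..<r} (deg \<alpha> + deg w)"
      using lead_expos[OF v(2)] by (auto simp: bounded_expos_def expos_def)
  qed
  then have "finite T" by (rule finite_subset) (simp add: finite_bounded_expos)
  moreover have "W \<in> V" by (simp add: V_def polys_zero)
  then have "T \<noteq> {}" using lead_V[OF _ r(2)] unfolding T_def by blast
  ultimately obtain a where "a \<in> T" and max: "\<And>b. b \<in> T \<Longrightarrow> key b \<le> key a"
    using finite_has_max_key by blast
  then obtain v where v: "v \<in> V" "lead (P 0 * v) a" by (auto simp: T_def)

  txt \<open>Comparing the leading exponents of \<open>P i * P 0 * v\<close> computed in two ways, and using that
    \<open>P i\<close> does not involve \<open>f i\<close>, shows that the leading exponent of \<open>P 0\<close> divides that of \<open>P 0 * v\<close>.\<close>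
  have "lookup (g0 0) i \<le> lookup a i" for i
  proof (cases "i < r")
    case True
    obtain b where b: "lead (P i * v) b" using lead_V[OF v(1) True] by blast
    have "lead (P 0 * (P i * v)) (g0 i + a)"
      using lead_P[OF v(2) True] by (simp add: ac_simps)
    then have "g0 0 + b = g0 i + a" using lead_unique[OF lead_P[OF b r(2)]] by blast
    moreover have "lookup (g0 i) i = 0" using rel[OF True] by (auto simp: in_keys_iff)
    ultimately show ?thesis by (metis add_cancel_left_left lookup_add le_add1)
  next
    case False
    then have "i \<notin> keys (g0 0)" using rel[OF r(2)] by (auto simp: expos_def)
    then show ?thesis by (simp add: in_keys_iff)
  qed
  \<comment> \<open>The entrywise inequality makes the truncated subtraction exact.\<close>
  then have "a = g0 0 + (a - g0 0)"
    by (intro poly_mapping_eqI) (simp add: lookup_add lookup_minus)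
  then obtain \<delta> where a: "a = g0 0 + \<delta>" ..
  have "\<exists>y\<in>polys E. P 0 * (v - y) \<in> gen (mon f ` above (g0 0 + \<delta>))"
  proof (rule lead_cancel[of "\<lambda>a. single 0 (c 0 a)" "S 0" v "g0 0" \<delta> "single 0 (inverse (c 0 (g0 0)))"])
    show "lead ((\<Sum>g\<in>S 0. single 0 (c 0 g) * mon f g) * v) (g0 0 + \<delta>)"
      using v(2) a by (simp add: P_def)
    show "single 0 (inverse (c 0 (g0 0))) * single 0 (c 0 (g0 0)) = (1 :: 'a mpoly)"
      using rel[OF r(2)] by (simp add: mult_single)
  qed (use rel[OF r(2)] in \<open>auto simp: P_def polys_single\<close>)
  then obtain y where y: "y \<in> polys E" "P 0 * (v - y) \<in> gen (mon f ` above a)"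
    unfolding a by blast
  \<comment> \<open>Subtracting y stays in the coset and pushes the order beyond a, against the
    maximality of a.\<close>
  have vy: "v - y \<in> V"
    using polys_diff[OF _ y(1), of "v - W"] v(1) by (simp add: V_def diff_right_commute)
  then obtain b where b: "lead (P 0 * (v - y)) b" using lead_V r(2) by blast
  then have "key b \<le> key a" using vy max by (auto simp: T_def)
  then have "above a \<subseteq> above b" by (auto simp: above_def)
  then have "P 0 * (v - y) \<in> gen (mon f ` above b)" using y(2) gen_mono[OF image_mono] by blast
  then show False using lead_not_above[OF b] by blast
qed

section \<open>Partitions into boxes\<close>

text \<open>These are the exponents of the monomials in x^u K[Z], so partitions into boxes are the
  combinatorial form of Stanley decompositions.\<close>

definition box :: "expo \<Rightarrow> nat set \<Rightarrow> expo set" where "box u Z = {u + v | v. keys v \<subseteq> Z}"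

lemma box_self: "u \<in> box u Z" by (auto simp: box_def intro: exI[of _ 0])

definition box_partition :: "(expo \<times> nat set) set \<Rightarrow> expo set \<Rightarrow> bool" where
  "box_partition D X \<longleftrightarrow> finite D \<and> (\<forall>(u, Z)\<in>D. box u Z \<subseteq> X) \<and>
     (\<forall>x\<in>X. \<exists>!d. d \<in> D \<and> x \<in> box (fst d) (snd d))"

lemma box_partition_subset: "box_partition D X \<Longrightarrow> d \<in> D \<Longrightarrow> box (fst d) (snd d) \<subseteq> X"
  unfolding box_partition_def by fastforce

lemma box_partition_apex: "box_partition D X \<Longrightarrow> d \<in> D \<Longrightarrow> fst d \<in> X"
  using box_partition_subset[of D X d] box_self by blast

lemma box_partition_empty: "box_partition D {} \<longleftrightarrow> D = {}"
  by (auto simp: box_partition_def) (use box_self in blast)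

lemma box_partition_Union:
  assumes "finite K" "\<And>k. k \<in> K \<Longrightarrow> box_partition (D k) (X k)"
    and disj: "\<And>k l. k \<in> K \<Longrightarrow> l \<in> K \<Longrightarrow> k \<noteq> l \<Longrightarrow> X k \<inter> X l = {}"
  shows "box_partition (\<Union>k\<in>K. D k) (\<Union>k\<in>K. X k)"
  unfolding box_partition_def
proof (intro conjI ballI)
  show "finite (\<Union>k\<in>K. D k)" using assms by (auto simp: box_partition_def)
  fix d assume "d \<in> (\<Union>k\<in>K. D k)"
  then show "case d of (u, Z) \<Rightarrow> box u Z \<subseteq> (\<Union>k\<in>K. X k)"
    using assms(2) box_partition_subset by fastforce
next
  fix x assume "x \<in> (\<Union>k\<in>K. X k)"
  then obtain k where k: "k \<in> K" "x \<in> X k" by auto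
  then obtain d where d: "d \<in> D k" "x \<in> box (fst d) (snd d)"
    and uniq: "\<And>e. e \<in> D k \<Longrightarrow> x \<in> box (fst e) (snd e) \<Longrightarrow> e = d"
    using assms(2)[OF k(1)] unfolding box_partition_def by blast
  show "\<exists>!d. d \<in> (\<Union>k\<in>K. D k) \<and> x \<in> box (fst d) (snd d)"
  proof (rule ex1I[of _ d])
    show "d \<in> (\<Union>k\<in>K. D k) \<and> x \<in> box (fst d) (snd d)" using d k by blast
    fix e assume e: "e \<in> (\<Union>k\<in>K. D k) \<and> x \<in> box (fst e) (snd e)"
    then obtain l where l: "l \<in> K" "e \<in> D l" by blast
    then have "x \<in> X l" using box_partition_subset[OF assms(2)] e by blast
    then have "l = k" using disj k l by blast
    then show "e = d" using uniq e l by blast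
  qed
qed

text \<open>An exponent splits uniquely into its parts inside and outside W, so the partition
  property survives the shift by w and the extension by V. This serves to put a slice at a given
  height and to adjoin x_{q+1}, ..., x_n.\<close>

lemma box_partition_product:
  assumes D: "box_partition D X" and X: "\<And>x. x \<in> X \<Longrightarrow> keys x \<inter> W = {}"
    and w: "keys w \<subseteq> W" and V: "V \<subseteq> W"
  shows "box_partition ((\<lambda>(u, Z). (u + w, Z \<union> V)) ` D) {x + w + v | x v. x \<in> X \<and> keys v \<subseteq> V}"
    (is "box_partition ?D ?X")
proof -
  \<comment> \<open>A variable of W among the free variables of a box would occur in an element of
    X.\<close>
  have Z: "snd d \<inter> W = {}" if "d \<in> D" for d
  proof (rule ccontr)
    assume "snd d \<inter> W \<noteq> {}"
    then obtain i where i: "i \<in> snd d" "i \<in> W" by blast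
    then have "fst d + single i 1 \<in> box (fst d) (snd d)" by (auto simp: box_def)
    then have "fst d + single i 1 \<in> X" using box_partition_subset[OF D that] by blast
    with X i(2) show False by (fastforce simp: keys_plus_nat)
  qed
  have eq: "x = y \<and> v = v'" if "x + v = y + v'" "keys x \<inter> W = {}" "keys y \<inter> W = {}" "keys v \<subseteq> W" "keys v' \<subseteq> W"
    for x y v v' :: expo
  proof -
    have "lookup x i = lookup y i \<and> lookup v i = lookup v' i" for i
    proof (cases "i \<in> W")
      case True
      then have "lookup x i = 0" "lookup y i = 0" using that by (auto simp flip: not_in_keys_iff_lookup_eq_zero)
      then show ?thesis using arg_cong[OF that(1), of "\<lambda>z. lookup z i"] by (simp add: lookup_add)
    next
      case False
      then have "lookup v i = 0" "lookup v' i = 0" using that by (auto simp flip: not_in_keys_iff_lookup_eq_zero)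
      then show ?thesis using arg_cong[OF that(1), of "\<lambda>z. lookup z i"] by (simp add: lookup_add)
    qed
    then show ?thesis by (auto intro: poly_mapping_eqI)
  qed
  have split: "\<exists>a b. z = a + b \<and> keys a \<subseteq> Y \<and> keys b \<subseteq> V" if "keys z \<subseteq> Y \<union> V" for z :: expo and Y
  proof -
    let ?a = "Poly_Mapping.mapp (\<lambda>i k. if i \<in> Y then k else 0) z"
    let ?b = "Poly_Mapping.mapp (\<lambda>i k. if i \<in> Y then 0 else k) z"
    have "z = ?a + ?b"
      by (intro poly_mapping_eqI) (auto simp: lookup_add lookup_mapp when_def in_keys_iff)
    moreover have "keys ?a \<subseteq> Y" by (auto simp: in_keys_iff lookup_mapp when_def split: if_splits)
    moreover have "keys ?b \<subseteq> keys z - Y" by (auto simp: in_keys_iff lookup_mapp when_def split: if_splits)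
    then have "keys ?b \<subseteq> V" using that by blast
    ultimately show ?thesis by blast
  qed
  have box_iff: "x + w + v \<in> box (fst d + w) (snd d \<union> V) \<longleftrightarrow> x \<in> box (fst d) (snd d)"
    if "d \<in> D" "x \<in> X" "keys v \<subseteq> V" for x v d
  proof
    assume "x \<in> box (fst d) (snd d)"
    then obtain z where z: "x = fst d + z" "keys z \<subseteq> snd d" by (auto simp: box_def)
    then have "x + w + v = fst d + w + (z + v)" "keys (z + v) \<subseteq> snd d \<union> V"
      using that by (auto simp: ac_simps keys_plus_nat)
    then show "x + w + v \<in> box (fst d + w) (snd d \<union> V)" unfolding box_def by blast
  next
    assume "x + w + v \<in> box (fst d + w) (snd d \<union> V)"
    then obtain z where z: "x + w + v = fst d + w + z" "keys z \<subseteq> snd d \<union> V" by (auto simp: box_def)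
    then obtain a b where ab: "z = a + b" "keys a \<subseteq> snd d" "keys b \<subseteq> V" using split by blast
    have "x + (w + v) = (fst d + a) + (w + b)" using z ab by (simp add: ac_simps)
    moreover have "keys (fst d + a) \<inter> W = {}"
      using X[OF box_partition_apex[OF D that(1)]] Z[OF that(1)] ab by (auto simp: keys_plus_nat)
    ultimately have "x = fst d + a"
      using eq[of x "w + v" "fst d + a" "w + b"] X[OF that(2)] w V ab that by (auto simp: keys_plus_nat)
    then show "x \<in> box (fst d) (snd d)" using ab by (auto simp: box_def)
  qed
  show ?thesis unfolding box_partition_def
  proof (intro conjI ballI)
    show "finite ?D" using D by (simp add: box_partition_def)
    fix e assume "e \<in> ?D"
    then obtain d where d: "d \<in> D" "e = (fst d + w, snd d \<union> V)" by force
    have "box (fst d + w) (snd d \<union> V) \<subseteq> ?X"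
    proof
      fix y assume "y \<in> box (fst d + w) (snd d \<union> V)"
      then obtain z where "y = fst d + w + z" "keys z \<subseteq> snd d \<union> V" by (auto simp: box_def)
      moreover then obtain a b where "z = a + b" "keys a \<subseteq> snd d" "keys b \<subseteq> V" using split by blast
      ultimately have "y = (fst d + a) + w + b" "fst d + a \<in> X" "keys b \<subseteq> V"
        using box_partition_subset[OF D d(1)] by (auto simp: ac_simps box_def)
      then show "y \<in> ?X" by blast
    qed
    then show "case e of (u, Z) \<Rightarrow> box u Z \<subseteq> ?X" using d by simp
  next
    fix y assume "y \<in> ?X"
    then obtain x v where x: "y = x + w + v" "x \<in> X" "keys v \<subseteq> V" by auto
    then obtain d where d: "d \<in> D" "x \<in> box (fst d) (snd d)"
      and uniq: "\<And>e. e \<in> D \<Longrightarrow> x \<in> box (fst e) (snd e) \<Longrightarrow> e = d"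
      using D unfolding box_partition_def by blast
    show "\<exists>!e. e \<in> ?D \<and> y \<in> box (fst e) (snd e)"
    proof (rule ex1I[of _ "(fst d + w, snd d \<union> V)"])
      show "(fst d + w, snd d \<union> V) \<in> ?D \<and>
          y \<in> box (fst (fst d + w, snd d \<union> V)) (snd (fst d + w, snd d \<union> V))"
        using d box_iff[OF d(1) x(2,3)] x(1) by (auto simp: case_prod_beta)
      fix e assume e: "e \<in> ?D \<and> y \<in> box (fst e) (snd e)"
      then obtain d' where d': "d' \<in> D" "e = (fst d' + w, snd d' \<union> V)" by force
      then have "x \<in> box (fst d') (snd d')" using e box_iff[OF d'(1) x(2,3)] x(1) by simp
      then show "e = (fst d + w, snd d \<union> V)" using uniq d' by simp
    qed
  qed
qed

section \<open>Slicing along one variable\<close>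

definition expos_on :: "nat set \<Rightarrow> expo set" where "expos_on Z = {a. keys a \<subseteq> Z}"

definition upset_on :: "nat set \<Rightarrow> expo set \<Rightarrow> bool" where
  "upset_on Z E \<longleftrightarrow> E \<subseteq> expos_on Z \<and> (\<forall>a\<in>E. \<forall>b\<in>expos_on Z. b + a \<in> E)"

text \<open>The slices of an upset along one variable form an increasing chain; it becomes
  stationary because its union, being a finite union of boxes, has finitely many minimal elements.\<close>

lemma upset_slices_stationary:
  assumes E: "\<And>k. upset_on Z (E k)" and mono: "\<And>k. E k \<subseteq> E (Suc k)"
    and D: "box_partition D (\<Union>k. E k)" and Z: "\<And>d. d \<in> D \<Longrightarrow> snd d \<subseteq> Z"
  obtains N where "\<And>k. N \<le> k \<Longrightarrow> E k = (\<Union>k. E k)" "\<And>k. k < N \<Longrightarrow> E k \<noteq> (\<Union>k. E k)"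
proof -
  have mono': "E k \<subseteq> E l" if "k \<le> l" for k l using lift_Suc_mono_le[of E] mono that by blast
  have "\<forall>d\<in>D. \<exists>k. fst d \<in> E k" using box_partition_apex[OF D] by blast
  then obtain m where m: "\<And>d. d \<in> D \<Longrightarrow> fst d \<in> E (m d)" by metis
  define M where "M = (\<Sum>d\<in>D. m d)"
  have fin: "finite D" using D by (simp add: box_partition_def)
  have "(\<Union>k. E k) \<subseteq> E M"
  proof
    fix x assume "x \<in> (\<Union>k. E k)"
    then obtain d where d: "d \<in> D" "x \<in> box (fst d) (snd d)" using D unfolding box_partition_def by blast
    then obtain v where v: "x = v + fst d" "v \<in> expos_on Z"
      using Z[OF d(1)] by (auto simp: box_def expos_on_def ac_simps)
    have "m d \<le> M" unfolding M_def using fin d by (intro member_le_sum) auto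
    then have "fst d \<in> E M" using m[OF d(1)] mono' by blast
    then show "x \<in> E M" using E[of M] v by (auto simp: upset_on_def)
  qed
  then have ex: "E M = (\<Union>k. E k)" by blast
  define N where "N = (LEAST k. E k = (\<Union>k. E k))"
  have "E N = (\<Union>k. E k)" unfolding N_def by (rule LeastI[of _ M]) (rule ex)
  then have "E k = (\<Union>k. E k)" if "N \<le> k" for k using mono'[OF that] by blast
  moreover have "E k \<noteq> (\<Union>k. E k)" if "k < N" for k
    using not_less_Least that unfolding N_def by blast
  ultimately show ?thesis using that by blast
qed

definition slice :: "nat \<Rightarrow> nat set \<Rightarrow> expo set \<Rightarrow> nat \<Rightarrow> expo set" where
  "slice x Z E k = {v \<in> expos_on Z. v + single x k \<in> E}"

lemma expo_split_insert:
  assumes "a \<in> expos_on (insert x Z)" "x \<notin> Z"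
  obtains v where "v \<in> expos_on Z" "a = v + single x (lookup a x)"
proof
  show "a - single x (lookup a x) \<in> expos_on Z"
    using assms by (auto simp: expos_on_def in_keys_iff lookup_minus lookup_single when_def subset_iff split: if_splits)
  show "a = a - single x (lookup a x) + single x (lookup a x)"
    by (intro poly_mapping_eqI) (auto simp: lookup_add lookup_minus lookup_single when_def)
qed

text \<open>Slices below N are placed at their own height. From N on all slices agree, so one copy
  at height N with x added to every set of free variables covers them together.\<close>

lemma box_partition_of_slices:
  assumes x: "x \<notin> Z" and X: "X \<subseteq> expos_on (insert x Z)"
    and D: "\<And>k. k < N \<Longrightarrow> box_partition (D k) (slice x Z X k)"
    and D': "box_partition D' Y" and stable: "\<And>k. N \<le> k \<Longrightarrow> slice x Z X k = Y"
  shows "box_partition ((\<Union>k<N. (\<lambda>(u, Z). (u + single x k, Z \<union> {})) ` D k) \<union>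
           (\<lambda>(u, Z). (u + single x N, Z \<union> {x})) ` D') X"
proof -
  define F where "F k = (if k < N then (\<lambda>(u, Z). (u + single x k, Z \<union> {})) ` D k
     else (\<lambda>(u, Z). (u + single x N, Z \<union> {x})) ` D')" for k
  define G where "G k = {v + single x k + a | v a. v \<in> slice x Z X k \<and> keys a \<subseteq> (if k < N then {} else {x})}" for k
  have keys: "keys v \<inter> {x} = {}" if "v \<in> slice x Z X k" for v k
    using that x by (auto simp: slice_def expos_on_def)
  have P: "box_partition (F k) (G k)" if "k \<in> {..N}" for k
  proof (cases "k < N")
    case True
    then show ?thesis
      using box_partition_product[OF D[OF True] keys, where w="single x k" and V="{}"] by (simp add: F_def G_def)
  next
    case False
    then have "k = N" "slice x Z X k = Y" using that stable by auto
    then show ?thesis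
      using box_partition_product[OF D', where W="{x}" and w="single x k" and V="{x}"] keys[of _ N] by (simp add: F_def G_def)
  qed
  have lookup_G: "lookup y x = k \<or> k = N \<and> N \<le> lookup y x" if "y \<in> G k" "k \<le> N" for y k
  proof -
    obtain v a where y: "y = v + single x k + a" "v \<in> slice x Z X k" "keys a \<subseteq> (if k < N then {} else {x})"
      using \<open>y \<in> G k\<close> by (auto simp: G_def)
    have "lookup v x = 0" using keys[OF y(2)] by (simp add: in_keys_iff)
    moreover have "lookup a x = 0" if "k < N" using y(3) that by (simp add: in_keys_iff)
    ultimately show ?thesis using \<open>k \<le> N\<close> by (auto simp: y(1) lookup_add le_less)
  qed
  have disj: "G k \<inter> G l = {}" if "k \<in> {..N}" "l \<in> {..N}" "k \<noteq> l" for k l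
    using that lookup_G[of _ k] lookup_G[of _ l] by fastforce
  have "(\<Union>k\<in>{..N}. G k) = X"
  proof (intro equalityI subsetI)
    fix y assume "y \<in> X"
    then obtain v where v: "v \<in> expos_on Z" "y = v + single x (lookup y x)"
      using expo_split_insert X x by blast
    then have sl: "v \<in> slice x Z X (lookup y x)" using \<open>y \<in> X\<close> by (simp add: slice_def)
    show "y \<in> (\<Union>k\<in>{..N}. G k)"
    proof (cases "lookup y x < N")
      case True
      then have "y \<in> G (lookup y x)" using v sl by (auto simp: G_def)
      then show ?thesis using True by auto
    next
      case False
      then have "v \<in> slice x Z X N" using stable sl by auto
      moreover have "y = v + single x N + single x (lookup y x - N)"
        using v(2) False by (simp add: add.assoc flip: single_add)
      then obtain m where "y = v + single x N + single x m" ..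
      ultimately have "\<exists>v a. y = v + single x N + a \<and> v \<in> slice x Z X N \<and> keys a \<subseteq> {x}"
        by (intro exI[of _ v] exI[of _ "single x m"]) (auto split: if_splits)
      then have "y \<in> G N" by (simp add: G_def)
      then show ?thesis by auto
    qed
  next
    fix y assume "y \<in> (\<Union>k\<in>{..N}. G k)"
    then obtain k v a where k: "k \<le> N" "y = v + single x k + a" "v \<in> slice x Z X k"
      "keys a \<subseteq> (if k < N then {} else {x})" by (auto simp: G_def)
    show "y \<in> X"
    proof (cases "k < N")
      case True
      then have "a = 0" using k(4) by (metis ex_in_conv in_keys_iff lookup_zero poly_mapping_eqI subset_empty)
      then show ?thesis using k by (simp add: slice_def)
    next
      case False
      then have "k = N" "keys a \<subseteq> {x}" using k by auto
      then have "a = single x (lookup a x)"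
        by (intro poly_mapping_eqI) (auto simp: lookup_single when_def in_keys_iff)
      then have "y = v + single x (N + lookup a x)" using k \<open>k = N\<close> by (simp add: add.assoc single_add)
      moreover have "v \<in> slice x Z X (N + lookup a x)" using k(3) \<open>k = N\<close> stable by simp
      ultimately show ?thesis by (simp add: slice_def)
    qed
  qed
  moreover have "(\<Union>k\<in>{..N}. F k) = (\<Union>k<N. F k) \<union> F N"
    by (auto simp: le_less lessThan_def atMost_def)
  moreover have "\<dots> = (\<Union>k<N. (\<lambda>(u, Z). (u + single x k, Z \<union> {})) ` D k) \<union>
           (\<lambda>(u, Z). (u + single x N, Z \<union> {x})) ` D'"
    by (simp add: F_def)
  ultimately show ?thesis using box_partition_Union[of "{..N}" F G] P disj by simp
qed

lemma upset_on_slice: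
  assumes "upset_on (insert x Z) E"
  shows "upset_on Z (slice x Z E k)" "slice x Z E k \<subseteq> slice x Z E (Suc k)"
proof -
  show "upset_on Z (slice x Z E k)"
    unfolding upset_on_def
  proof (intro conjI ballI)
    fix a b assume a: "a \<in> slice x Z E k" and b: "b \<in> expos_on Z"
    then have "a + single x k \<in> E" "b \<in> expos_on (insert x Z)" by (auto simp: slice_def expos_on_def)
    then have "b + (a + single x k) \<in> E" using assms unfolding upset_on_def by blast
    then show "b + a \<in> slice x Z E k"
      using a b by (auto simp: slice_def expos_on_def keys_plus_nat add.assoc)
  qed (auto simp: slice_def)
  show "slice x Z E k \<subseteq> slice x Z E (Suc k)"
  proof
    fix a assume a: "a \<in> slice x Z E k"
    have "single x 1 + (a + single x k) \<in> E"
      using assms a by (auto simp: upset_on_def slice_def expos_on_def)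
    moreover have "single x 1 + (a + single x k) = a + single x (Suc k)"
      by (simp add: ac_simps flip: single_add)
    ultimately show "a \<in> slice x Z E (Suc k)" using a by (simp add: slice_def)
  qed
qed

lemma upset_on_Union: "(\<And>k. upset_on Z (E k)) \<Longrightarrow> upset_on Z (\<Union>k. E k)"
  unfolding upset_on_def by blast

text \<open>Induction on the number of variables: the slices along the new variable stabilise, so
  finitely many of their partitions suffice. Slices of the complement are the complements of the
  slices and stabilise at the same height. The nonempty sets in the first claim later give the
  additional 1 in the bound for I.\<close>

lemma box_partition_exists:
  assumes "finite Z" "upset_on Z E"
  shows "(\<exists>D. box_partition D E \<and> (\<forall>d\<in>D. snd d \<subseteq> Z \<and> (Z \<noteq> {} \<longrightarrow> snd d \<noteq> {}))) \<and>
    (\<exists>D. box_partition D (expos_on Z - E) \<and> (\<forall>d\<in>D. snd d \<subseteq> Z))"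
  using assms
proof (induction Z arbitrary: E rule: finite_induct)
  case empty
  have *: "expos_on {} = {0}"
    by (auto simp: expos_on_def)
  have box: "box 0 {} = {0}" using * by (auto simp: box_def expos_on_def)
  then have "box_partition {(0, {})} {0}" by (auto simp: box_partition_def)
  moreover have "box_partition {} {}" by (simp add: box_partition_empty)
  moreover have "E = {} \<or> E = {0}" using empty * by (auto simp: upset_on_def)
  ultimately show ?case using * by (metis Diff_cancel Diff_empty empty_iff empty_subsetI insert_iff snd_conv)
next
  case (insert x Z)
  define S where "S k = slice x Z E k" for k
  define S' where "S' = (\<Union>k. S k)"
  have S: "upset_on Z (S k)" "S k \<subseteq> S (Suc k)" for k
    using upset_on_slice[OF insert.prems] by (auto simp: S_def)
  have S': "upset_on Z S'" unfolding S'_def by (rule upset_on_Union) (rule S)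
  obtain D' where D': "box_partition D' S'" "\<And>d. d \<in> D' \<Longrightarrow> snd d \<subseteq> Z" using insert.IH[OF S'] by blast
  obtain N where N: "\<And>k. N \<le> k \<Longrightarrow> S k = S'" "\<And>k. k < N \<Longrightarrow> S k \<noteq> S'"
    using upset_slices_stationary[of Z S D'] S D' unfolding S'_def by blast
  have "\<forall>k. \<exists>D. box_partition D (S k) \<and> (\<forall>d\<in>D. snd d \<subseteq> Z \<and> (Z \<noteq> {} \<longrightarrow> snd d \<noteq> {}))"
    using insert.IH[OF S(1)] by blast
  then obtain D where D: "\<And>k. box_partition (D k) (S k)"
    "\<And>k d. d \<in> D k \<Longrightarrow> snd d \<subseteq> Z \<and> (Z \<noteq> {} \<longrightarrow> snd d \<noteq> {})" by metis
  \<comment> \<open>Without old variables the final slice is contained in {0}; a slice strictly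
    below it is empty and contributes no boxes. The boxes at height N contain x in any case.\<close>
  have D_nonempty: "snd d \<noteq> {}" if "k < N" "d \<in> D k" for k d
  proof (cases "Z = {}")
    case True
    then have "expos_on Z = {0}"
      by (auto simp: expos_on_def)
    then have "S' \<subseteq> {0}" "S k \<subseteq> S'" using S' by (auto simp: upset_on_def S'_def)
    then have "S k = {}" using N(2)[OF that(1)] by blast
    then have "D k = {}" using D(1)[of k] box_partition_empty by simp
    then show ?thesis using that by simp
  qed (use D(2) that in blast)
  have "box_partition ((\<Union>k<N. (\<lambda>(u, Z). (u + single x k, Z \<union> {})) ` D k) \<union>
     (\<lambda>(u, Z). (u + single x N, Z \<union> {x})) ` D') E" (is "box_partition ?D E")
  proof (rule box_partition_of_slices[OF insert.hyps(2)])
    show "E \<subseteq> expos_on (insert x Z)" using insert.prems by (simp add: upset_on_def)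
  qed (use D(1) D'(1) N(1) in \<open>auto simp: S_def\<close>)
  moreover have "\<forall>d\<in>?D. snd d \<subseteq> insert x Z \<and> (insert x Z \<noteq> {} \<longrightarrow> snd d \<noteq> {})"
  proof
    fix d assume "d \<in> ?D"
    then consider k e where "k < N" "e \<in> D k" "snd d = snd e" | e where "e \<in> D'" "snd d = insert x (snd e)"
      by (auto simp: case_prod_beta)
    then show "snd d \<subseteq> insert x Z \<and> (insert x Z \<noteq> {} \<longrightarrow> snd d \<noteq> {})"
      by cases (use D(2) D'(2) D_nonempty in blast)+
  qed
  ultimately have 1: "\<exists>D. box_partition D E \<and>
      (\<forall>d\<in>D. snd d \<subseteq> insert x Z \<and> (insert x Z \<noteq> {} \<longrightarrow> snd d \<noteq> {}))"
    by (intro exI conjI)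
  have slice_diff: "slice x Z (expos_on (insert x Z) - E) k = expos_on Z - S k" for k
    by (auto simp: slice_def S_def expos_on_def keys_plus_nat)
  have "\<forall>k. \<exists>D. box_partition D (expos_on Z - S k) \<and> (\<forall>d\<in>D. snd d \<subseteq> Z)"
    using insert.IH[OF S(1)] by blast
  then obtain C where C: "\<And>k. box_partition (C k) (expos_on Z - S k)"
    "\<And>k d. d \<in> C k \<Longrightarrow> snd d \<subseteq> Z" by metis
  have "box_partition ((\<Union>k<N. (\<lambda>(u, Z). (u + single x k, Z \<union> {})) ` C k) \<union>
     (\<lambda>(u, Z). (u + single x N, Z \<union> {x})) ` C N) (expos_on (insert x Z) - E)" (is "box_partition ?C _")
  proof (rule box_partition_of_slices[OF insert.hyps(2)])
    show "slice x Z (expos_on (insert x Z) - E) k = expos_on Z - S N" if "N \<le> k" for k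
      using N(1)[OF that] N(1)[of N] by (simp add: slice_diff)
  qed (use C(1) in \<open>auto simp: slice_diff\<close>)
  moreover have "\<forall>d\<in>?C. snd d \<subseteq> insert x Z"
  proof
    fix d assume "d \<in> ?C"
    then consider k e where "e \<in> C k" "snd d = snd e" | e where "e \<in> C N" "snd d = insert x (snd e)"
      by (auto simp: case_prod_beta)
    then show "snd d \<subseteq> insert x Z" by cases (use C(2) in blast)+
  qed
  ultimately have 2: "\<exists>D. box_partition D (expos_on (insert x Z) - E) \<and> (\<forall>d\<in>D. snd d \<subseteq> insert x Z)"
    by (intro exI conjI)
  from 1 2 show ?case by (rule conjI)
qed

section \<open>Depth and Stanley depth of subquotients\<close>

text \<open>Otherwise \<open>{1..n}\<close> is rewritten to \<open>{Suc 0..n}\<close>.\<close>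

declare One_nat_def [simp del]

lemma poly_ring_simps [simp]:
  "x \<oplus>\<^bsub>poly_ring Z\<^esub> y = x + y" "\<zero>\<^bsub>poly_ring Z\<^esub> = 0" "x \<otimes>\<^bsub>poly_ring Z\<^esub> y = x * y" "\<one>\<^bsub>poly_ring Z\<^esub> = 1"
  by (simp_all add: poly_ring_def)

lemma carrier_poly_ring_on: "carrier (poly_ring Z) = polys (expos_on Z)"
  by (auto simp: poly_ring_def polys_def expos_on_def)

lemma expos_on_subset_full: "Z \<subseteq> {1..n} \<Longrightarrow> expos_on Z \<subseteq> full n"
  by (auto simp: expos_on_def full_def)

lemma ideal_polys:
  assumes "upset n E"
  shows "ideal (polys E :: 'k::field mpoly set) (poly_ring {1..n})"
proof (rule idealI)
  interpret R: cring "poly_ring {1..n} :: 'k mpoly ring" by (rule cring_poly_ring)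
  interpret ideal_pair "polys (full n) :: 'k mpoly set" "polys E" "polys E"
    using ideal_pair_polys[OF assms assms] by simp
  show "ring (poly_ring {1..n} :: 'k mpoly ring)" by (rule R.ring_axioms)
  show "subgroup (polys E :: 'k mpoly set) (add_monoid (poly_ring {1..n}))"
  proof (rule R.add.subgroupI)
    show "polys E \<subseteq> carrier (poly_ring {1..n} :: 'k mpoly ring)"
      using assms polys_mono by (auto simp: carrier_poly_ring upset_def)
    show "\<ominus>\<^bsub>poly_ring {1..n}\<^esub> a \<in> polys E" if "a \<in> polys E" for a :: "'k mpoly"
    proof -
      have "a \<in> carrier (poly_ring {1..n})" "- a \<in> carrier (poly_ring {1..n})"
        using that A_uminus assms polys_mono unfolding carrier_poly_ring upset_def by blast+
      then have "\<ominus>\<^bsub>poly_ring {1..n}\<^esub> a = - a" by (intro R.minus_equality) auto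
      then show ?thesis using A_uminus that by simp
    qed
  qed (use A_zero A_add in auto)
  fix a x :: "'k mpoly" assume "a \<in> polys E" "x \<in> carrier (poly_ring {1..n})"
  then have "x * a \<in> polys E" by (simp add: A_mult carrier_poly_ring)
  then show "x \<otimes>\<^bsub>poly_ring {1..n}\<^esub> a \<in> polys E" "a \<otimes>\<^bsub>poly_ring {1..n}\<^esub> x \<in> polys E"
    by (simp_all add: mult.commute)
qed

lemma irrelevant_ideal_subset: "irrelevant_ideal n \<subseteq> (polys (full n - {0}) :: 'k::field mpoly set)"
proof -
  interpret R: cring "poly_ring {1..n} :: 'k mpoly ring" by (rule cring_poly_ring)
  have "upset n (full n - {0})" by (auto simp: upset_def full_plus)
      (metis add_eq_0_iff_both_eq_0 deg_eq_0_iff deg_plus)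
  from ideal_polys[OF this] show ?thesis
    unfolding irrelevant_ideal_def
    by (rule R.genideal_minimal) (auto simp: indet_def polys_def full_def simp flip: deg_eq_0_iff)
qed

definition restr :: "expo set \<Rightarrow> 'k::field mpoly \<Rightarrow> 'k mpoly" where
  "restr X = Poly_Mapping.mapp (\<lambda>a c. if a \<in> X then c else 0)"

lemma lookup_restr: "lookup (restr X p) a = (if a \<in> X then lookup p a else 0)"
  by (auto simp: restr_def lookup_mapp when_def in_keys_iff)

lemma restr_in_polys: "restr X p \<in> polys X"
  by (auto simp: polys_def in_keys_iff lookup_restr split: if_splits)

lemma lookup_eq_0: "p \<in> polys X \<Longrightarrow> a \<notin> X \<Longrightarrow> lookup p a = 0"
  by (auto simp: polys_def in_keys_iff)

lemma poly_expansion: "p = (\<Sum>a\<in>keys p. single a (lookup p a))"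
  by (rule poly_mapping_eqI) (simp add: lookup_sum lookup_single when_def in_keys_iff sum.delta)

text \<open>The module \<open>M\<close> is the quotient of the monomial ideals \<open>polys EA\<close> and \<open>polys EB\<close> via \<open>h\<close>.\<close>

locale graded_presentation =
  fixes n :: nat and EA EB :: "expo set" and M :: "('k::field mpoly, 'b, 'e) module_scheme"
    and h :: "'k mpoly \<Rightarrow> 'b"
  assumes EA: "upset n EA" and EB: "upset n EB" and EB_subset: "EB \<subseteq> EA"
    and module_M: "Module.module (poly_ring {1..n}) M"
    and h_image: "h ` polys EA = carrier M"
    and h_add: "\<And>p q. p \<in> polys EA \<Longrightarrow> q \<in> polys EA \<Longrightarrow> h (p + q) = h p \<oplus>\<^bsub>M\<^esub> h q"
    and h_smult: "\<And>a p. a \<in> polys (full n) \<Longrightarrow> p \<in> polys EA \<Longrightarrow> h (a * p) = a \<odot>\<^bsub>M\<^esub> h p"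
    and h_eq_iff: "\<And>p q. p \<in> polys EA \<Longrightarrow> q \<in> polys EA \<Longrightarrow> h p = h q \<longleftrightarrow> p - q \<in> polys EB"
begin

sublocale M: Module.module "poly_ring {1..n}" M by (rule module_M)

sublocale ideal_pair "polys (full n) :: 'k mpoly set" "polys EA" "polys EB"
  by (rule ideal_pair_polys[OF EA EB EB_subset])

lemma h_closed: "p \<in> polys EA \<Longrightarrow> h p \<in> carrier M" using h_image by blast

lemma h_zero: "h 0 = \<zero>\<^bsub>M\<^esub>"
  using h_add[OF A_zero A_zero] h_closed[OF A_zero] by (metis M.add.r_cancel_one' add_0)

lemma h_finsum:
  assumes "finite I" "\<And>i. i \<in> I \<Longrightarrow> g i \<in> polys EA" "\<And>i. i \<in> I \<Longrightarrow> y i = h (g i)"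
  shows "finsum M y I = h (sum g I)"
  using assms
proof (induction I rule: finite_induct)
  case (insert i I)
  have "finsum M y (insert i I) = y i \<oplus>\<^bsub>M\<^esub> finsum M y I"
    using insert by (intro M.finsum_insert) (auto simp: h_closed)
  then show ?case using insert by (simp add: h_add A_sum)
qed (simp add: h_zero)

text \<open>This carries regularity on M over to the pair of monomial ideals, where the theory of
  leading exponents applies.\<close>

lemma h_in_seq_mult_iff:
  assumes p: "p \<in> polys EA" and fs: "set fs \<subseteq> polys (full n)"
  shows "h p \<in> seq_mult M fs \<longleftrightarrow> p \<in> gen (nth fs ` {..<length fs})"
proof
  assume "h p \<in> seq_mult M fs"
  then obtain y where y: "y \<in> {..<length fs} \<rightarrow> carrier M"
    "h p = finsum M (\<lambda>k. fs ! k \<odot>\<^bsub>M\<^esub> y k) {..<length fs}" by (auto simp: seq_mult_def)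
  have "\<forall>k\<in>{..<length fs}. \<exists>q\<in>polys EA. y k = h q" using y(1) h_image by blast
  then obtain q where q: "\<And>k. k < length fs \<Longrightarrow> q k \<in> polys EA" "\<And>k. k < length fs \<Longrightarrow> y k = h (q k)"
    by (metis lessThan_iff)
  have fq: "fs ! k * q k \<in> polys EA" if "k < length fs" for k
    using fs q(1)[OF that] that A_mult nth_mem by blast
  have "h p = h (\<Sum>k<length fs. fs ! k * q k)"
    unfolding y(2) using fs q fq by (intro h_finsum) (auto simp: h_smult subset_iff)
  then have *: "p - (\<Sum>k<length fs. fs ! k * q k) \<in> polys EB"
    using h_eq_iff[OF p A_sum[of "{..<length fs}" "\<lambda>k. fs ! k * q k"]] fq by auto
  have "(\<Sum>k<length fs. fs ! k * q k) \<in> gen (nth fs ` {..<length fs})"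
    using q by (intro gen_sum gen_mult) auto
  from gen_add[OF gen_B[OF *] this] show "p \<in> gen (nth fs ` {..<length fs})" by simp
next
  assume "p \<in> gen (nth fs ` {..<length fs})"
  then have "\<exists>q. (\<forall>k<length fs. q k \<in> polys EA) \<and> p - (\<Sum>k<length fs. fs ! k * q k) \<in> polys EB"
  proof induction
    case (gen_B b)
    then show ?case by (intro exI[of _ "\<lambda>_. 0"]) (simp add: A_zero)
  next
    case (gen_mult g a)
    then obtain k where k: "k < length fs" "g = fs ! k" by auto
    have "(\<Sum>l<length fs. fs ! l * (if l = k then a else 0)) = fs ! k * a"
      using k by (simp add: if_distrib cong: if_cong)
    then show ?case using k gen_mult A_zero
      by (intro exI[of _ "\<lambda>l. if l = k then a else 0"]) (simp add: polys_zero)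
  next
    case (gen_add x y)
    then obtain q q' where q: "\<forall>k<length fs. q k \<in> polys EA" "x - (\<Sum>k<length fs. fs ! k * q k) \<in> polys EB"
      and q': "\<forall>k<length fs. q' k \<in> polys EA" "y - (\<Sum>k<length fs. fs ! k * q' k) \<in> polys EB" by blast
    have "x + y - (\<Sum>k<length fs. fs ! k * (q k + q' k)) =
        (x - (\<Sum>k<length fs. fs ! k * q k)) + (y - (\<Sum>k<length fs. fs ! k * q' k))"
      by (simp add: distrib_left sum.distrib)
    also have "\<dots> \<in> polys EB" by (rule B_add[OF q(2) q'(2)])
    finally show ?case using q(1) q'(1) A_add by (intro exI[of _ "\<lambda>k. q k + q' k"]) simp
  qed
  then obtain q where q: "\<And>k. k < length fs \<Longrightarrow> q k \<in> polys EA"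
    "p - (\<Sum>k<length fs. fs ! k * q k) \<in> polys EB" by blast
  have fq: "fs ! k * q k \<in> polys EA" if "k < length fs" for k
    using fs q(1)[OF that] that A_mult nth_mem by blast
  have "h p = h (\<Sum>k<length fs. fs ! k * q k)"
    using q(2) h_eq_iff[OF p A_sum[of "{..<length fs}" "\<lambda>k. fs ! k * q k"]] fq by auto
  also have "\<dots> = finsum M (\<lambda>k. fs ! k \<odot>\<^bsub>M\<^esub> h (q k)) {..<length fs}"
    using fs q fq by (intro h_finsum[symmetric]) (auto simp: h_smult subset_iff)
  finally show "h p \<in> seq_mult M fs"
    using q(1) h_closed unfolding seq_mult_def by (auto intro!: exI[of _ "\<lambda>k. h (q k)"])
qed

lemma monomial_quotient_of_regular_sequence:
  assumes reg: "regular_sequence (poly_ring {1..n}) M fs" and fs: "set fs \<subseteq> irrelevant_ideal n"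
  shows "monomial_quotient n EA EB (nth fs) (length fs)"
proof unfold_locales
  have full: "set fs \<subseteq> polys (full n)" 
    using reg unfolding regular_sequence_def carrier_poly_ring by (rule conjunct1)
  show "fs ! i \<in> polys (full n)" if "i < length fs" for i
    using subsetD[OF full nth_mem[OF that]] .
  show "0 \<notin> keys (fs ! i)" if "i < length fs" for i
    using subsetD[OF irrelevant_ideal_subset subsetD[OF fs nth_mem[OF that]]] by (auto simp: polys_def)
  fix k x assume k: "k < length fs" and x: "x \<in> polys EA" and fx: "fs ! k * x \<in> gen (nth fs ` {..<k})"
  have img: "nth (take k fs) ` {..<length (take k fs)} = nth fs ` {..<k}"
    using k by (intro image_cong) simp_all
  have full': "set (take k fs) \<subseteq> polys (full n)" by (rule order_trans[OF set_take_subset full])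
  have fk: "fs ! k \<in> polys (full n)" using subsetD[OF full nth_mem[OF k]] .
  have "h (fs ! k * x) \<in> seq_mult M (take k fs)"
    unfolding h_in_seq_mult_iff[OF A_mult[OF fk x] full'] img by (rule fx)
  then have "fs ! k \<odot>\<^bsub>M\<^esub> h x \<in> seq_mult M (take k fs)" by (simp add: h_smult[OF fk x])
  moreover have "\<forall>x\<in>carrier M. fs ! k \<odot>\<^bsub>M\<^esub> x \<in> seq_mult M (take k fs) \<longrightarrow> x \<in> seq_mult M (take k fs)"
    using reg k unfolding regular_sequence_def by blast
  ultimately have "h x \<in> seq_mult M (take k fs)" using h_closed[OF x] by blast
  then show "x \<in> gen (nth fs ` {..<k})" unfolding h_in_seq_mult_iff[OF x full'] img .
qed (rule EA EB EB_subset)+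

lemma depth_le:
  assumes "\<And>(f :: nat \<Rightarrow> 'k mpoly) r. monomial_quotient n EA EB f r \<Longrightarrow> r \<le> d"
  shows "depth n M \<le> enat d"
  unfolding depth_def depth_wrt_def
proof (rule SUP_least)
  fix fs assume "fs \<in> {fs. regular_sequence (poly_ring {1..n}) M fs \<and> set fs \<subseteq> irrelevant_ideal n}"
  then have "monomial_quotient n EA EB (nth fs) (length fs)"
    using monomial_quotient_of_regular_sequence by simp
  from assms[OF this] show "enat (length fs) \<le> enat d" by simp
qed

end

section \<open>Stanley spaces attached to boxes\<close>

lemma monomials_eq: "monomials Z = {single a 1 | a. a \<in> expos_on Z}"
  by (simp add: monomials_def expos_on_def)

lemma box_eq: "box u Z = {v + u | v. v \<in> expos_on Z}"
  by (auto simp: box_def expos_on_def ac_simps)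

lemma expos_on_plus: "a \<in> expos_on Z \<Longrightarrow> b \<in> expos_on Z \<Longrightarrow> a + b \<in> expos_on Z"
  by (auto simp: expos_on_def keys_plus_nat)

lemma polys_box_mult: "a \<in> polys (expos_on Z) \<Longrightarrow> p \<in> polys (box u Z) \<Longrightarrow> a * p \<in> polys (box u Z)"
proof (rule polys_mult)
  fix a b assume "a \<in> expos_on Z" "b \<in> box u Z"
  then obtain v where "v \<in> expos_on Z" "b = v + u" by (auto simp: box_eq)
  then show "a + b \<in> box u Z" using expos_on_plus[of a Z v] \<open>a \<in> expos_on Z\<close>
    by (auto simp: box_eq intro!: exI[of _ "a + v"] simp flip: add.assoc)
qed

lemma polys_boxE:
  assumes "p \<in> polys (box u Z)"
  obtains c where "c \<in> polys (expos_on Z)" "p = c * single u 1"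
proof
  let ?c = "\<Sum>a\<in>keys p. single (a - u) (lookup p a)"
  have a: "a - u \<in> expos_on Z \<and> a - u + u = a" if "a \<in> keys p" for a
    using that assms by (auto simp: polys_def box_eq)
  then show "?c \<in> polys (expos_on Z)" by (intro polys_sum polys_single) auto
  have "?c * single u 1 = (\<Sum>a\<in>keys p. single a (lookup p a))"
    using a by (simp add: sum_distrib_right mult_single)
  then show "p = ?c * single u 1" using poly_expansion[of p] by simp
qed

lemma single_1_nonzero: "(single u 1 :: 'k::field mpoly) \<noteq> 0"
  by (metis lookup_single_eq lookup_zero one_neq_zero)

lemma direct_sum_cong:
  assumes "\<And>i. i < m \<Longrightarrow> U i = V i"
  shows "direct_sum M m U = direct_sum M m V"
proof -
  have "(\<Pi>\<^sub>E i\<in>{..<m}. U i) = (\<Pi>\<^sub>E i\<in>{..<m}. V i)" using assms by (intro PiE_cong) simp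
  then show ?thesis using assms by (simp add: direct_sum_def)
qed

context graded_presentation
begin

lemma polys_subset_A: "Y \<subseteq> EA - EB \<Longrightarrow> p \<in> polys Y \<Longrightarrow> p \<in> polys EA"
  using polys_mono[of Y EA] by blast

lemma h_inj:
  assumes "Y \<subseteq> EA - EB" "p \<in> polys Y" "q \<in> polys Y" "h p = h q"
  shows "p = q"
proof -
  have "p - q \<in> polys EB" using h_eq_iff polys_subset_A[OF assms(1)] assms(2-4) by blast
  moreover have "p - q \<in> polys Y" using polys_diff assms by blast
  ultimately have "p - q \<in> polys {}" using assms(1) unfolding polys_def by blast
  then show ?thesis by simp
qed

text \<open>The box avoids EB, so h is injective on the polynomials supported in it, and the images
  of the monomials in the box are linearly independent.\<close>

lemma monomial_span_eq:
  assumes Z: "Z \<subseteq> {1..n}" and box: "box u Z \<subseteq> EA - EB"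
  shows "monomial_span M (h (single u 1)) Z = h ` polys (box u Z)"
proof -
  have u: "single u 1 \<in> polys EA" using box box_self by (intro polys_single) blast
  have smult: "single a 1 \<odot>\<^bsub>M\<^esub> h (single u 1) = h (single (a + u) 1)" if "a \<in> expos_on Z" for a
  proof -
    have "single a 1 \<in> (polys (full n) :: 'k mpoly set)"
      using that expos_on_subset_full[OF Z] by (intro polys_single) blast
    from h_smult[OF this u] show ?thesis by (simp add: mult_single)
  qed
  have B: "{v \<odot>\<^bsub>M\<^esub> h (single u 1) | v. v \<in> monomials Z} = (\<lambda>a. h (single a 1)) ` box u Z"
    by (auto simp: monomials_eq box_eq smult image_iff) (metis smult)+
  have const: "carrier (poly_ring {}) = (polys {0} :: 'k mpoly set)"
    by (auto simp: carrier_poly_ring_on expos_on_def polys_def)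
  have const_full: "c \<in> polys (full n)" if "c \<in> polys {0}" for c :: "'k mpoly"
    using that by (auto simp: polys_def)
  have const_box: "c * p \<in> polys (box u Z)" if "c \<in> polys {0}" "p \<in> polys (box u Z)" for c p :: "'k mpoly"
    using that by (intro polys_mult[of c "{0}"]) auto
  show ?thesis unfolding monomial_span_def lin_span_def B const
  proof (intro equalityI subsetI)
    fix x assume "x \<in> {finsum M (\<lambda>b. c b \<odot>\<^bsub>M\<^esub> b) F | c F. finite F \<and>
       F \<subseteq> (\<lambda>a. h (single a 1)) ` box u Z \<and> c \<in> F \<rightarrow> polys {0}}"
    then obtain c F where x: "x = finsum M (\<lambda>b. c b \<odot>\<^bsub>M\<^esub> b) F" "finite F"
      "F \<subseteq> (\<lambda>a. h (single a 1)) ` box u Z" "c \<in> F \<rightarrow> polys {0}" by blast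
    have "\<forall>b\<in>F. \<exists>a. a \<in> box u Z \<and> b = h (single a 1)" using x(3) by blast
    then obtain g where g: "\<And>b. b \<in> F \<Longrightarrow> g b \<in> box u Z" "\<And>b. b \<in> F \<Longrightarrow> b = h (single (g b) 1)"
      by metis
    have cb: "c b * single (g b) 1 \<in> polys (box u Z)" if "b \<in> F" for b
      using that x(4) g(1) by (intro const_box polys_single) auto
    have "x = h (\<Sum>b\<in>F. c b * single (g b) 1)"
      unfolding x(1)
    proof (rule h_finsum[OF x(2)])
      fix b assume b: "b \<in> F"
      show "c b * single (g b) 1 \<in> polys EA" using polys_subset_A[OF box cb[OF b]] .
      have "single (g b) 1 \<in> (polys EA :: 'k mpoly set)" using g(1)[OF b] box by (intro polys_single) blast
      moreover have "c b \<in> polys (full n)" using const_full x(4) b by blast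
      ultimately show "c b \<odot>\<^bsub>M\<^esub> b = h (c b * single (g b) 1)" using h_smult g(2)[OF b] by metis
    qed
    moreover have "(\<Sum>b\<in>F. c b * single (g b) 1) \<in> polys (box u Z)" using cb by (rule polys_sum)
    ultimately show "x \<in> h ` polys (box u Z)" by blast
  next
    fix x assume "x \<in> h ` polys (box u Z)"
    then obtain p where p: "p \<in> polys (box u Z)" "x = h p" by blast
    define F where "F = (\<lambda>a. h (single a 1)) ` keys p"
    have kp: "keys p \<subseteq> box u Z" using p(1) by (simp add: polys_def)
    have inj: "inj_on (\<lambda>a. h (single a 1)) (keys p)"
    proof (rule inj_onI)
      fix a b assume ab: "a \<in> keys p" "b \<in> keys p" "h (single a 1) = h (single b 1)"
      then have "single a (1::'k) = single b 1"
        using h_inj[OF box, of "single a 1" "single b 1"] kp by (auto intro: polys_single)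
      then show "a = b" by (metis lookup_single_eq lookup_single_not_eq one_neq_zero)
    qed
    \<comment> \<open>Linear combinations in \<open>lin_span\<close> are indexed by module elements,
      so the coefficients of p are found through the inverse of the injection that sends an exponent
      to the image of its monomial.\<close>
    define c :: "'b \<Rightarrow> 'k mpoly" where "c b = single 0 (lookup p (the_inv_into (keys p) (\<lambda>a. h (single a 1)) b))" for b
    have c: "c (h (single a 1)) = single 0 (lookup p a)" if "a \<in> keys p" for a
      using the_inv_into_f_f[OF inj that] by (simp add: c_def)
    have term_h: "single 0 (lookup p a) \<odot>\<^bsub>M\<^esub> h (single a 1) = h (single a (lookup p a))"
      "h (single a (lookup p a)) \<in> carrier M" "single a (lookup p a) \<in> polys EA" if "a \<in> keys p" for a
    proof -
      have "single a 1 \<in> (polys EA :: 'k mpoly set)" "single a (lookup p a) \<in> polys EA"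
        using that kp box by (auto intro!: polys_single)
      then show "single 0 (lookup p a) \<odot>\<^bsub>M\<^esub> h (single a 1) = h (single a (lookup p a))"
        "h (single a (lookup p a)) \<in> carrier M" "single a (lookup p a) \<in> polys EA"
        using h_smult[OF const_full[OF polys_single], of 0 "single a 1" "lookup p a"] h_closed[of "single a (lookup p a)"]
        by (auto simp: mult_single)
    qed
    have "finsum M (\<lambda>b. c b \<odot>\<^bsub>M\<^esub> b) F = finsum M (\<lambda>a. c (h (single a 1)) \<odot>\<^bsub>M\<^esub> h (single a 1)) (keys p)"
      unfolding F_def using term_h by (intro M.finsum_reindex inj) (auto simp: c)
    also have "\<dots> = h (\<Sum>a\<in>keys p. single a (lookup p a))"
      using term_h by (intro h_finsum) (auto simp: c)
    also have "\<dots> = x" using p(2) poly_expansion[of p] by simp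
    finally have "x = finsum M (\<lambda>b. c b \<odot>\<^bsub>M\<^esub> b) F" ..
    moreover have "finite F" "F \<subseteq> (\<lambda>a. h (single a 1)) ` box u Z" using kp by (auto simp: F_def)
    moreover have "c \<in> F \<rightarrow> polys {0}" by (auto simp: F_def c intro: polys_single)
    ultimately show "x \<in> {finsum M (\<lambda>b. c b \<odot>\<^bsub>M\<^esub> b) F | c F. finite F \<and>
       F \<subseteq> (\<lambda>a. h (single a 1)) ` box u Z \<and> c \<in> F \<rightarrow> polys {0}}" by blast
  qed
qed

lemma module_polys_box:
  assumes Z: "Z \<subseteq> {1..n}" and box: "box u Z \<subseteq> EA - EB"
  shows "Module.module (poly_ring Z) (M\<lparr>carrier := h ` polys (box u Z)\<rparr>)"
proof (rule Module.moduleI)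
  have A: "p \<in> polys EA" if "p \<in> polys (box u Z)" for p using polys_subset_A[OF box that] .
  have full: "a \<in> polys (full n)" if "a \<in> polys (expos_on Z)" for a :: "'k mpoly"
    using that polys_mono[OF expos_on_subset_full[OF Z]] by blast
  let ?N = "M\<lparr>carrier := h ` polys (box u Z)\<rparr>"
  have add: "h p \<oplus>\<^bsub>M\<^esub> h q = h (p + q)" if "p \<in> polys (box u Z)" "q \<in> polys (box u Z)" for p q
    using h_add[OF A A] that by simp
  have smult: "a \<odot>\<^bsub>M\<^esub> h p = h (a * p)" if "a \<in> polys (expos_on Z)" "p \<in> polys (box u Z)" for a p
    using h_smult[OF full A] that by simp
  show "cring (poly_ring Z :: 'k mpoly ring)" by (rule cring_poly_ring)
  show "abelian_group ?N"
  proof (rule abelian_groupI)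
    fix x assume "x \<in> carrier ?N"
    then obtain p where p: "p \<in> polys (box u Z)" "x = h p" by auto
    have "h (- p) \<oplus>\<^bsub>M\<^esub> x = \<zero>\<^bsub>M\<^esub>"
      using add[OF polys_uminus[OF p(1)] p(1)] p(2) by (simp add: h_zero)
    then show "\<exists>y\<in>carrier ?N. y \<oplus>\<^bsub>?N\<^esub> x = \<zero>\<^bsub>?N\<^esub>" using polys_uminus[OF p(1)] by auto
    show "\<zero>\<^bsub>?N\<^esub> \<oplus>\<^bsub>?N\<^esub> x = x"
      using M.add.l_one[OF h_closed[OF A[OF p(1)]]] p(2) by simp
  qed (use h_closed A polys_zero[of "box u Z"] in \<open>auto simp: add polys_add add_ac simp flip: h_zero\<close>)
  let ?R = "poly_ring Z :: 'k mpoly ring"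
  note simps = carrier_poly_ring_on add smult polys_add polys_box_mult distrib_left distrib_right mult.assoc
  have mult: "a * b \<in> polys (expos_on Z)" if "a \<in> polys (expos_on Z)" "b \<in> polys (expos_on Z)" for a b :: "'k mpoly"
    using polys_mult[OF that expos_on_plus] .
  show "a \<odot>\<^bsub>?N\<^esub> x \<in> carrier ?N" if "a \<in> carrier ?R" "x \<in> carrier ?N" for a x
    using that by (auto simp: simps)
  show "(a \<oplus>\<^bsub>?R\<^esub> b) \<odot>\<^bsub>?N\<^esub> x = a \<odot>\<^bsub>?N\<^esub> x \<oplus>\<^bsub>?N\<^esub> b \<odot>\<^bsub>?N\<^esub> x"
    if "a \<in> carrier ?R" "b \<in> carrier ?R" "x \<in> carrier ?N" for a b x
    using that by (auto simp: simps)
  show "a \<odot>\<^bsub>?N\<^esub> (x \<oplus>\<^bsub>?N\<^esub> y) = a \<odot>\<^bsub>?N\<^esub> x \<oplus>\<^bsub>?N\<^esub> a \<odot>\<^bsub>?N\<^esub> y"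
    if "a \<in> carrier ?R" "x \<in> carrier ?N" "y \<in> carrier ?N" for a x y
    using that by (auto simp: simps)
  show "(a \<otimes>\<^bsub>?R\<^esub> b) \<odot>\<^bsub>?N\<^esub> x = a \<odot>\<^bsub>?N\<^esub> (b \<odot>\<^bsub>?N\<^esub> x)"
    if "a \<in> carrier ?R" "b \<in> carrier ?R" "x \<in> carrier ?N" for a b x
    using that by (auto simp: simps mult)
  show "\<one>\<^bsub>?R\<^esub> \<odot>\<^bsub>?N\<^esub> x = x" if "x \<in> carrier ?N" for x
  proof -
    have "(1 :: 'k mpoly) \<in> polys (expos_on Z)" by (simp add: polys_def expos_on_def)
    then show ?thesis using that by (auto simp: smult)
  qed
qed

text \<open>The image of x^u alone is a basis: a polynomial supported in the box is c x^u for a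
  unique c in K[Z], and h is injective on such polynomials.\<close>

lemma stanley_space_box:
  assumes Z: "Z \<subseteq> {1..n}" and box: "box u Z \<subseteq> EA - EB"
  shows "stanley_space M (h (single u 1)) Z"
  unfolding stanley_space_def free_module_def monomial_span_eq[OF Z box]
proof (intro conjI exI[of _ "{h (single u 1)}"] ballI)
  let ?e = "h (single u 1)" and ?N = "M\<lparr>carrier := h ` polys (box u Z)\<rparr>"
  show "Module.module (poly_ring Z) ?N" by (rule module_polys_box[OF Z box])
  then interpret N: Module.module "poly_ring Z" ?N .
  have e: "single u 1 \<in> (polys (box u Z) :: 'k mpoly set)" by (intro polys_single box_self)
  then show "{?e} \<subseteq> carrier ?N" by auto
  have A: "p \<in> polys EA" if "p \<in> polys (box u Z)" for p using polys_subset_A[OF box that] .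
  have full: "a \<in> polys (full n)" if "a \<in> polys (expos_on Z)" for a :: "'k mpoly"
    using that polys_mono[OF expos_on_subset_full[OF Z]] by blast
  have sum: "finsum ?N (\<lambda>b. c b \<odot>\<^bsub>?N\<^esub> b) {b. c b \<noteq> \<zero>\<^bsub>poly_ring Z\<^esub>} = h (c ?e * single u 1)"
    if c: "range c \<subseteq> carrier (poly_ring Z)" "{b. c b \<noteq> \<zero>\<^bsub>poly_ring Z\<^esub>} \<subseteq> {?e}" for c
  proof -
    have ce: "c ?e \<in> polys (expos_on Z)" using c(1) by (auto simp: carrier_poly_ring_on)
    have smult: "c ?e \<odot>\<^bsub>M\<^esub> ?e = h (c ?e * single u 1)" using h_smult[OF full[OF ce] A[OF e]] ..
    show ?thesis
    proof (cases "c ?e = 0")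
      case True
      then have "{b. c b \<noteq> \<zero>\<^bsub>poly_ring Z\<^esub>} = {}" using c(2) by auto
      then show ?thesis using True h_zero by simp
    next
      case False
      then have "{b. c b \<noteq> \<zero>\<^bsub>poly_ring Z\<^esub>} = {?e}" using c(2) by auto
      moreover have "c ?e \<odot>\<^bsub>?N\<^esub> ?e \<in> carrier ?N" using polys_box_mult[OF ce e] by (simp add: smult)
      then have "finsum ?N (\<lambda>b. c b \<odot>\<^bsub>?N\<^esub> b) (insert ?e {}) = c ?e \<odot>\<^bsub>?N\<^esub> ?e"
        using N.finsum_insert[of "{}" ?e "\<lambda>b. c b \<odot>\<^bsub>?N\<^esub> b"] N.r_zero by simp
      ultimately show ?thesis by (simp add: smult)
    qed
  qed
  fix x assume "x \<in> carrier ?N"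
  then obtain p where p: "p \<in> polys (box u Z)" "x = h p" by auto
  obtain c0 where c0: "c0 \<in> polys (expos_on Z)" "p = c0 * single u 1" using polys_boxE[OF p(1)] by blast
  let ?P = "\<lambda>c. range c \<subseteq> carrier (poly_ring Z) \<and> finite {b. c b \<noteq> \<zero>\<^bsub>poly_ring Z\<^esub>} \<and>
    {b. c b \<noteq> \<zero>\<^bsub>poly_ring Z\<^esub>} \<subseteq> {?e} \<and> x = finsum ?N (\<lambda>b. c b \<odot>\<^bsub>?N\<^esub> b) {b. c b \<noteq> \<zero>\<^bsub>poly_ring Z\<^esub>}"
  show "\<exists>!c. ?P c"
  proof (rule ex1I[of _ "\<lambda>b. if b = ?e then c0 else 0"])
    let ?c = "\<lambda>b. if b = ?e then c0 else 0"
    have 1: "range ?c \<subseteq> carrier (poly_ring Z)" using c0 polys_zero by (auto simp: carrier_poly_ring_on)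
    have 2: "{b. ?c b \<noteq> \<zero>\<^bsub>poly_ring Z\<^esub>} \<subseteq> {?e}" by auto
    have 3: "finite {b. ?c b \<noteq> \<zero>\<^bsub>poly_ring Z\<^esub>}" using finite_subset[OF 2] by simp
    have 4: "x = finsum ?N (\<lambda>b. ?c b \<odot>\<^bsub>?N\<^esub> b) {b. ?c b \<noteq> \<zero>\<^bsub>poly_ring Z\<^esub>}"
      unfolding sum[OF 1 2] using p c0 by simp
    show "?P ?c" using 1 2 3 4 by (intro conjI)
    fix c assume c: "?P c"
    then have "h (c ?e * single u 1) = h p" using sum[of c] p by simp
    moreover have "c ?e * single u 1 \<in> polys (box u Z)"
      using c by (intro polys_box_mult e) (auto simp: carrier_poly_ring_on)
    ultimately have "c ?e * single u 1 = c0 * single u 1" using h_inj[OF box _ p(1)] c0(2) by blast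
    then have "c ?e = c0" using mult_right_cancel[OF single_1_nonzero] by blast
    moreover have "c b = 0" if "b \<noteq> ?e" for b using c that by auto
    ultimately show "c = ?c" by auto
  qed
qed

text \<open>Each element of M has exactly one representative supported on EA - EB, and its
  components are the restrictions of this representative to the boxes.\<close>

lemma direct_sum_boxes:
  assumes Z: "\<And>i. i < m \<Longrightarrow> box (u i) (Z i) \<subseteq> EA - EB"
    and part: "\<And>x. x \<in> EA - EB \<Longrightarrow> \<exists>!i. i < m \<and> x \<in> box (u i) (Z i)"
  shows "direct_sum M m (\<lambda>i. h ` polys (box (u i) (Z i)))"
  unfolding direct_sum_def
proof (intro conjI allI impI ballI)
  have A: "p \<in> polys EA" if "i < m" "p \<in> polys (box (u i) (Z i))" for i p
    using polys_subset_A[OF Z that(2)] that(1) .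
  then show "h ` polys (box (u i) (Z i)) \<subseteq> carrier M" if "i < m" for i using that h_closed by blast
  fix x assume "x \<in> carrier M"
  then obtain p0 where p0: "p0 \<in> polys EA" "x = h p0" using h_image by blast
  \<comment> \<open>Deleting the terms with exponent in EB does not change the class.\<close>
  define p where "p = restr (EA - EB) p0"
  have p: "p \<in> polys (EA - EB)" by (simp add: p_def restr_in_polys)
  have pA: "p \<in> polys EA" using polys_subset_A[OF order_refl p] .
  have "p0 - p \<in> polys EB"
    using p0(1) by (auto simp: polys_def p_def in_keys_iff lookup_minus lookup_restr split: if_splits)
  then have x: "x = h p" using h_eq_iff[OF p0(1) pA] p0(2) by simp
  have lookup_sum_boxes: "lookup (\<Sum>i<m. q i) a = lookup (q j) a"
    if q: "\<And>i. i < m \<Longrightarrow> q i \<in> polys (box (u i) (Z i))" and j: "j < m" "a \<in> box (u j) (Z j)"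
    for q :: "nat \<Rightarrow> 'k mpoly" and a j
  proof -
    have "a \<in> EA - EB" using Z j by blast
    then have "lookup (q i) a = 0" if "i < m" "i \<noteq> j" for i
      using part[of a] j that lookup_eq_0[OF q[OF that(1)]] by blast
    then have "(\<Sum>i<m. lookup (q i) a) = (\<Sum>i<m. if i = j then lookup (q j) a else 0)"
      by (intro sum.cong) auto
    then show ?thesis using j by (simp add: lookup_sum)
  qed
  have decomp: "p = (\<Sum>i<m. restr (box (u i) (Z i)) p)"
  proof (rule poly_mapping_eqI)
    fix a
    show "lookup p a = lookup (\<Sum>i<m. restr (box (u i) (Z i)) p) a"
    proof (cases "a \<in> EA - EB")
      case True
      then obtain j where j: "j < m" "a \<in> box (u j) (Z j)" using part by blast
      then show ?thesis
        using lookup_sum_boxes[of "\<lambda>i. restr (box (u i) (Z i)) p", OF restr_in_polys j]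
        by (simp add: lookup_restr)
    next
      case False
      then have "lookup p a = 0" using lookup_eq_0[OF p] by blast
      then show ?thesis by (simp add: lookup_sum lookup_restr sum.neutral)
    qed
  qed
  let ?y = "\<lambda>i\<in>{..<m}. h (restr (box (u i) (Z i)) p)"
  show "\<exists>!y. y \<in> (\<Pi>\<^sub>E i\<in>{..<m}. h ` polys (box (u i) (Z i))) \<and> x = finsum M y {..<m}"
  proof (rule ex1I[of _ ?y], rule conjI)
    show "?y \<in> (\<Pi>\<^sub>E i\<in>{..<m}. h ` polys (box (u i) (Z i)))" using restr_in_polys by auto
    have "finsum M ?y {..<m} = h (\<Sum>i<m. restr (box (u i) (Z i)) p)"
      using A restr_in_polys by (intro h_finsum) auto
    then show "x = finsum M ?y {..<m}" using decomp x by simp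
    fix y assume y: "y \<in> (\<Pi>\<^sub>E i\<in>{..<m}. h ` polys (box (u i) (Z i))) \<and> x = finsum M y {..<m}"
    have "\<forall>i\<in>{..<m}. \<exists>q. q \<in> polys (box (u i) (Z i)) \<and> y i = h q" using y by (auto simp: PiE_iff)
    then obtain q where q: "\<And>i. i < m \<Longrightarrow> q i \<in> polys (box (u i) (Z i))" "\<And>i. i < m \<Longrightarrow> y i = h (q i)"
      by (metis lessThan_iff)
    have "x = h (\<Sum>i<m. q i)" using y q A by (auto intro!: h_finsum)
    moreover have "(\<Sum>i<m. q i) \<in> polys (EA - EB)"
      using q(1) Z polys_mono by (intro polys_sum) blast
    ultimately have pq: "p = (\<Sum>i<m. q i)" using h_inj[OF order_refl p] x by simp
    have "restr (box (u j) (Z j)) p = q j" if "j < m" for j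
    proof (rule poly_mapping_eqI)
      fix a
      show "lookup (restr (box (u j) (Z j)) p) a = lookup (q j) a"
        using lookup_sum_boxes[OF q(1) that, of a] lookup_eq_0[OF q(1)[OF that], of a] pq
        by (simp add: lookup_restr)
    qed
    then show "y = ?y" using q(2) y by (intro extensionalityI[of _ "{..<m}"]) (auto simp: PiE_iff)
  qed
qed

text \<open>The boxes yield one Stanley decomposition of the required size. Since
  \<open>sdepth\<close> is a maximum, the set of all values must also be shown to be finite.\<close>

lemma sdepth_ge:
  assumes D: "box_partition D (EA - EB)" and D_sub: "\<And>d. d \<in> D \<Longrightarrow> snd d \<subseteq> {1..n} \<and> t \<le> card (snd d)"
    and nonempty: "EA - EB \<noteq> {}"
    and gr: "\<And>a. a \<in> EA - EB \<Longrightarrow> h (single a 1) \<in> gr (\<lambda>i. int (lookup a i))"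
  shows "t \<le> sdepth n M gr"
proof -
  obtain xs where xs: "set xs = D" "distinct xs"
    using D finite_distinct_list[of D] by (auto simp: box_partition_def)
  define L where "L = map (\<lambda>(u, Z). (h (single u 1), Z)) xs"
  have L: "L ! i = (h (single (fst (xs ! i)) 1), snd (xs ! i))" if "i < length xs" for i
    using that by (simp add: L_def case_prod_beta)
  have xs_D: "xs ! i \<in> D" if "i < length xs" for i
    using nth_mem[OF that] unfolding xs(1) .
  have set_L: "set L = (\<lambda>(u, Z). (h (single u 1), Z)) ` D" unfolding L_def set_map xs(1) ..
  have box: "box (fst d) (snd d) \<subseteq> EA - EB" if "d \<in> D" for d using box_partition_subset[OF D that] .
  have part: "\<exists>!i. i < length xs \<and> x \<in> box (fst (xs ! i)) (snd (xs ! i))" if "x \<in> EA - EB" for x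
  proof -
    have "\<exists>!d. d \<in> D \<and> x \<in> box (fst d) (snd d)" using D that by (simp add: box_partition_def)
    then obtain d where d: "d \<in> D" "x \<in> box (fst d) (snd d)"
      and uniq: "\<And>e. e \<in> D \<Longrightarrow> x \<in> box (fst e) (snd e) \<Longrightarrow> e = d"
      by blast
    obtain i where i: "i < length xs" "xs ! i = d" using d(1) xs by (metis in_set_conv_nth)
    show ?thesis
    proof (rule ex1I[of _ i])
      fix j assume j: "j < length xs \<and> x \<in> box (fst (xs ! j)) (snd (xs ! j))"
      then have "xs ! j = xs ! i" using uniq xs_D i by blast
      then show "j = i" using j i xs(2) nth_eq_iff_index_eq by blast
    qed (use i d in simp)
  qed
  have ds: "direct_sum M (length xs) (\<lambda>i. h ` polys (box (fst (xs ! i)) (snd (xs ! i))))"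
    by (rule direct_sum_boxes[OF box[OF xs_D] part])
  have span: "monomial_span M (fst (L ! i)) (snd (L ! i)) = h ` polys (box (fst (xs ! i)) (snd (xs ! i)))"
    if "i < length xs" for i
    using monomial_span_eq[OF conjunct1[OF D_sub[OF xs_D[OF that]]] box[OF xs_D[OF that]]] L[OF that] by simp
  have "length L = length xs" by (simp add: L_def)
  with ds have "direct_sum M (length L) (\<lambda>i. monomial_span M (fst (L ! i)) (snd (L ! i)))"
    by (simp only: direct_sum_cong[OF span])
  moreover have "v \<in> carrier M \<and> homogeneous n gr v \<and> Z \<subseteq> {1..n} \<and> stanley_space M v Z"
    if "(v, Z) \<in> set L" for v Z
  proof -
    from that obtain u where u: "(u, Z) \<in> D" "v = h (single u 1)" by (auto simp: set_L)
    have uX: "u \<in> EA - EB" using box_partition_apex[OF D u(1)] by simp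
    then have "u \<in> full n" using EA by (auto simp: upset_def)
    then have "(\<lambda>i. int (lookup u i)) \<in> degrees n" 
      unfolding degrees_def full_def by (simp add: subset_iff in_keys_iff) blast
    then have "homogeneous n gr v" 
      unfolding homogeneous_def u(2) using gr[OF uX] by (rule bexI[rotated, where x="\<lambda>i. int (lookup u i)"])
    moreover have "v \<in> carrier M" using uX h_closed[OF polys_single] u(2) by simp
    moreover have "Z \<subseteq> {1..n}" using D_sub[OF u(1)] by simp
    ultimately show ?thesis using stanley_space_box box[OF u(1)] u(2) by simp
  qed
  ultimately have "stanley_decomposition n M gr L" by (auto simp: stanley_decomposition_def)
  then have mem: "sdepth_decomposition L \<in> {sdepth_decomposition D | D. stanley_decomposition n M gr D}" by blast
  have finite_cards: "finite {card Z | v Z. (v, Z) \<in> set L'}" for L' :: "('b \<times> nat set) list"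
  proof -
    have "{card Z | v Z. (v, Z) \<in> set L'} = (\<lambda>(v, Z). card Z) ` set L'" by auto
    then show ?thesis by simp
  qed
  \<comment> \<open>Nonempty decompositions have values at most n. The empty list would have the
    unspecified value \<open>Min {}\<close>, which adds at most one element to the set.\<close>
  have "sdepth_decomposition L' \<in> {..n} \<union> {Min {}}" if L': "stanley_decomposition n M gr L'" for L'
  proof (cases "L' = []")
    case False
    then have "{card Z | v Z. (v, Z) \<in> set L'} \<noteq> {}" by (cases L') auto
    then have "sdepth_decomposition L' \<in> {card Z | v Z. (v, Z) \<in> set L'}"
      unfolding sdepth_decomposition_def by (rule Min_in[OF finite_cards])
    then obtain v Z where "sdepth_decomposition L' = card Z" "(v, Z) \<in> set L'" by blast
    moreover have "card Z \<le> n" if "(v, Z) \<in> set L'" for v Z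
      using L' that card_mono[of "{1..n}" Z] by (auto simp: stanley_decomposition_def)
    ultimately show ?thesis by simp
  qed (simp add: sdepth_decomposition_def)
  then have "{sdepth_decomposition D | D. stanley_decomposition n M gr D} \<subseteq> {..n} \<union> {Min {}}" by blast
  then have fin: "finite {sdepth_decomposition D | D. stanley_decomposition n M gr D}"
    by (rule finite_subset) simp
  obtain x where "x \<in> EA - EB" using nonempty by blast
  then obtain i where "i < length xs" using part by blast
  then have "set L \<noteq> {}" using xs_D by (auto simp: set_L)
  then have "{card Z | v Z. (v, Z) \<in> set L} \<noteq> {}" by (cases L) auto
  moreover have "t \<le> c" if "c \<in> {card Z | v Z. (v, Z) \<in> set L}" for c
  proof -
    from that obtain v Z where "(v, Z) \<in> set L" "c = card Z" by blast
    then obtain u where "(u, Z) \<in> D" by (auto simp: set_L)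
    then show ?thesis using D_sub[of "(u, Z)"] \<open>c = card Z\<close> by simp
  qed
  ultimately have "t \<le> sdepth_decomposition L"
    unfolding sdepth_decomposition_def using finite_cards by (intro Min.boundedI) auto
  also have "\<dots> \<le> sdepth n M gr" unfolding sdepth_def by (rule Max_ge[OF fin mem])
  finally show ?thesis .
qed

end

section \<open>Ideals of Borel type\<close>

lemma expos_on_eq_full: "expos_on {1..n} = full n" by (simp add: expos_on_def full_def)

text \<open>E consists of the exponents of all monomial multiples of the generators. Polynomials
  supported there are finite sums of multiples of generators, and conversely \<open>polys E\<close>
  is an ideal containing the generators.\<close>

lemma monomial_ideal_eq_polys:
  fixes I :: "'k::field mpoly set"
  assumes "monomial_ideal n I"
  obtains E where "upset n E" "I = polys E"
proof -
  interpret R: cring "poly_ring {1..n} :: 'k mpoly ring" by (rule cring_poly_ring)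
  obtain G where G: "G \<subseteq> monomials {1..n}" "I = genideal (poly_ring {1..n}) G"
    using assms by (auto simp: monomial_ideal_def)
  define E where "E = {b + a | a b. b \<in> full n \<and> a \<in> full n \<and> single a 1 \<in> G}"
  have E: "upset n E"
    unfolding upset_def E_def by (auto simp: full_plus) (metis add.assoc full_plus)
  have G_carrier: "G \<subseteq> carrier (poly_ring {1..n})"
    using G(1) by (auto simp: monomials_eq carrier_poly_ring expos_on_eq_full intro!: polys_single)
  have "G \<subseteq> polys E"
  proof
    fix g assume "g \<in> G"
    then obtain a where a: "g = single a 1" "a \<in> full n"
      using G(1) by (auto simp: monomials_eq expos_on_eq_full)
    then have "0 + a \<in> E" unfolding E_def using \<open>g \<in> G\<close> zero_in_full by blast
    then show "g \<in> polys E" using a by (simp add: polys_single)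
  qed
  then have "I \<subseteq> polys E" unfolding G(2) using R.genideal_minimal ideal_polys[OF E] by blast
  moreover have "polys E \<subseteq> I"
  proof
    interpret I: ideal I "poly_ring {1..n}" unfolding G(2) by (rule R.genideal_ideal[OF G_carrier])
    fix p assume p: "p \<in> (polys E :: 'k mpoly set)"
    have monom: "single x c \<in> I" if "x \<in> E" for x and c :: 'k
    proof -
      from that obtain a b where ab: "x = b + a" "b \<in> full n" "single a 1 \<in> G" by (auto simp: E_def)
      have "single a 1 \<in> I" unfolding G(2) using ab(3) R.genideal_self[OF G_carrier] by blast
      from I.I_l_closed[OF this, of "single b c"] show ?thesis
        using ab by (simp add: carrier_poly_ring polys_single mult_single)
    qed
    have "(\<Sum>x\<in>X. single x (lookup p x)) \<in> I" if "finite X" "X \<subseteq> E" for X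
      using that
    proof (induction X rule: finite_induct)
      case empty
      then show ?case using I.zero_closed by simp
    next
      case (insert x X)
      then have "single x (lookup p x) + (\<Sum>x\<in>X. single x (lookup p x)) \<in> I"
        using I.a_closed[OF monom] by simp
      then show ?case using insert by simp
    qed
    from this[of "keys p"] show "p \<in> I" using p poly_expansion[of p] by (simp add: polys_def)
  qed
  ultimately show ?thesis using E that by blast
qed

text \<open>That an upset in \<open>full n\<close> is closed under \<open>head q\<close> means that
  its minimal generators involve only x_1, ..., x_q.\<close>

definition head :: "nat \<Rightarrow> expo \<Rightarrow> expo" where
  "head q = Poly_Mapping.mapp (\<lambda>i k. if i \<le> q then k else 0)"

lemma lookup_head: "lookup (head q a) i = (if i \<le> q then lookup a i else 0)"
  by (auto simp: head_def lookup_mapp when_def in_keys_iff)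

lemma keys_head: "keys (head q a) = keys a \<inter> {..q}"
  by (auto simp: in_keys_iff lookup_head split: if_splits)

lemma head_full: "a \<in> full n \<Longrightarrow> head n a = a"
  by (intro poly_mapping_eqI) (auto simp: lookup_head full_def in_keys_iff)

lemma head_0: "a \<in> full n \<Longrightarrow> head 0 a = 0"
  by (intro poly_mapping_eqI) (auto simp: lookup_head full_def in_keys_iff)

lemma head_Suc: "head (Suc q) a = single (Suc q) (lookup a (Suc q)) + head q a"
  by (intro poly_mapping_eqI) (auto simp: lookup_head lookup_add lookup_single when_def le_Suc_eq)

lemma head_in_full: "a \<in> full n \<Longrightarrow> head q a \<in> full n"
  by (auto simp: full_def keys_head)

lemma head_tail:
  assumes "a \<in> full n"
  obtains b where "a = head q a + b" "keys b \<subseteq> {q+1..n}"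
proof
  show "a = head q a + (a - head q a)"
    by (intro poly_mapping_eqI) (simp add: lookup_add lookup_minus lookup_head)
  show "keys (a - head q a) \<subseteq> {q+1..n}"
    using assms by (auto simp: in_keys_iff lookup_minus lookup_head full_def subset_iff split: if_splits)
qed

lemma indet_power: "indet i ^ s = (single (single i s) 1 :: 'k::field mpoly)"
proof (induction s)
  case (Suc s)
  have "indet i ^ Suc s = (single (single i 1) 1 * single (single i s) 1 :: 'k mpoly)"
    using Suc by (simp add: indet_def)
  also have "\<dots> = single (single i (1 + s)) 1"
    unfolding single_add by (simp add: mult_single)
  finally show ?case unfolding plus_1_eq_Suc .
qed simp

text \<open>Here \<open>q\<close> is the largest index of a variable occurring in a minimal generator, and
  \<open>(x\<^sub>1, \<dots>, x\<^sub>q)\<close> is the annihilator of the monomial with exponent \<open>w\<close> modulo the ideal.\<close>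

lemma borel_type_socle:
  fixes E :: "expo set"
  assumes E: "upset n E" "E \<noteq> {}" "0 \<notin> E" and borel: "borel_type n (polys E :: 'k::field mpoly set)"
  obtains q w where "1 \<le> q" "q \<le> n" "\<And>a. a \<in> E \<Longrightarrow> head q a \<in> E"
    "w \<in> full n" "w \<notin> E" "\<And>i. i \<in> {1..q} \<Longrightarrow> single i 1 + w \<in> E"
proof -
  have E_full: "E \<subseteq> full n" using E(1) by (simp add: upset_def)
  define q where "q = (LEAST q. \<forall>a\<in>E. head q a \<in> E)"
  have n: "\<forall>a\<in>E. head n a \<in> E" using E_full head_full by auto
  then have q: "\<forall>a\<in>E. head q a \<in> E" "q \<le> n" unfolding q_def by (rule LeastI, rule Least_le)
  have "q \<noteq> 0"
  proof
    assume "q = 0"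
    moreover obtain a where "a \<in> E" using E(2) by blast
    moreover from this have "head 0 a = 0" using E_full head_0 by blast
    ultimately show False using q(1) E(3) by metis
  qed
  then obtain q' where q': "q = Suc q'" by (cases q) auto
  then have "\<not> (\<forall>a\<in>E. head q' a \<in> E)" using not_less_Least[of q' "\<lambda>q. \<forall>a\<in>E. head q a \<in> E"] by (simp add: q_def)
  \<comment> \<open>Minimality of q gives a monomial of E that leaves E when x_q and all later
    variables are dropped. For the remaining v, the product x_q^s v is in E but v is not.\<close>
  then obtain m where m: "m \<in> E" "head q' m \<notin> E" by blast
  define v s where "v = head q' m" and "s = lookup m q"
  have v: "v \<in> full n" "v \<notin> E" using m E_full head_in_full by (auto simp: v_def)
  have sv: "single q s + v \<in> E" using q(1) m(1) head_Suc[of q' m] by (auto simp: v_def s_def q')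
  then have s: "0 < s" using v(2) by (cases s) auto
  \<comment> \<open>The Borel condition trades x_q^s for a power of any earlier variable
    x_j.\<close>
  have "\<exists>t. single j t + v \<in> E" if j: "j \<in> {1..q}" for j
  proof (cases "j = q")
    case False
    let ?u = "single (single q s + v) 1 :: 'k mpoly"
    have "?u \<in> monomials {1..n} \<inter> polys E"
      using sv E_full by (auto simp: monomials_eq expos_on_eq_full intro: polys_single)
    moreover have "single v 1 \<in> (monomials {1..n} :: 'k mpoly set)"
      using v by (auto simp: monomials_eq expos_on_eq_full)
    moreover have "1 \<le> j \<and> j < q \<and> q \<le> n \<and> 0 < s \<and> ?u = indet q ^ s * single v 1"
      using j False q(2) s by (simp add: indet_power mult_single)
    ultimately obtain t where "indet j ^ t * single v 1 \<in> (polys E :: 'k mpoly set)"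
      using borel unfolding borel_type_def by blast
    then show ?thesis by (auto simp: indet_power mult_single polys_def)
  qed (use sv in blast)
  then obtain t where t: "\<And>j. j \<in> {1..q} \<Longrightarrow> single j (t j) + v \<in> E" by metis
  \<comment> \<open>Only finitely many monomials in x_1, ..., x_q keep v outside E. From one with
    the largest key, each further factor x_i with i <= q leads into E, so its product with v is the
    desired w.\<close>
  define S where "S = {a. keys a \<subseteq> {1..q} \<and> a + v \<notin> E}"
  have "S \<subseteq> bounded_expos {1..q} (\<Sum>j\<in>{1..q}. t j)"
  proof
    fix a assume a: "a \<in> S"
    have "lookup a i \<le> (\<Sum>j\<in>{1..q}. t j)" for i
    proof (cases "i \<in> {1..q}")
      case True
      have "\<not> t i \<le> lookup a i"
      proof
        assume "t i \<le> lookup a i"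
        then obtain b where b: "a = b + single i (t i)" "keys b \<subseteq> keys a" by (rule expo_split_single)
        have "b \<in> full n" using b(2) a q(2) by (auto simp: S_def full_def)
        then have "b + (single i (t i) + v) \<in> E" using E(1) t[OF True] unfolding upset_def by blast
        then show False using a b(1) by (simp add: S_def add.assoc)
      qed
      moreover have "t i \<le> (\<Sum>j\<in>{1..q}. t j)" using True by (intro member_le_sum) auto
      ultimately show ?thesis by simp
    next
      case False
      then have "i \<notin> keys a" using a by (auto simp: S_def)
      then show ?thesis by (simp add: in_keys_iff)
    qed
    then show "a \<in> bounded_expos {1..q} (\<Sum>j\<in>{1..q}. t j)" using a by (simp add: S_def bounded_expos_def)
  qed
  then have "finite S" by (rule finite_subset) (simp add: finite_bounded_expos)
  moreover have "0 \<in> S" using v by (simp add: S_def)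
  ultimately obtain a where a: "a \<in> S" and max: "\<And>b. b \<in> S \<Longrightarrow> key b \<le> key a"
    using finite_has_max_key[of S] by blast
  show ?thesis
  proof (rule that[of q "a + v"])
    show "1 \<le> q" using q' by simp
    show "a + v \<in> full n" using a v q(2) by (auto simp: S_def full_def keys_plus_nat)
    show "a + v \<notin> E" using a by (simp add: S_def)
    show "single i 1 + (a + v) \<in> E" if "i \<in> {1..q}" for i
    proof -
      have "deg (single i 1 + a) > deg a" by simp
      then have "single i 1 + a \<notin> S" using max deg_le_of_key_le by fastforce
      then show ?thesis using a that by (auto simp: S_def keys_plus_nat add.assoc)
    qed
  qed (use q in auto)
qed

section \<open>Partitions adapted to the last n - q variables\<close>

lemma box_partition_extend:
  assumes D: "box_partition D X" "\<And>d. d \<in> D \<Longrightarrow> snd d \<subseteq> {1..q}"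
    and X: "X \<subseteq> expos_on {1..q}" and q: "q \<le> n"
    and Y: "Y \<subseteq> full n" "\<And>a b. a \<in> expos_on {1..q} \<Longrightarrow> keys b \<subseteq> {q+1..n} \<Longrightarrow> a + b \<in> Y \<longleftrightarrow> a \<in> X"
  shows "box_partition ((\<lambda>(u, Z). (u + 0, Z \<union> {q+1..n})) ` D) Y"
proof -
  have "box_partition ((\<lambda>(u, Z). (u + 0, Z \<union> {q+1..n})) ` D) {x + 0 + v | x v. x \<in> X \<and> keys v \<subseteq> {q+1..n}}"
    using X by (intro box_partition_product[OF D(1), of "{q+1..n}"]) (fastforce simp: expos_on_def)+
  also have "{x + 0 + v | x v. x \<in> X \<and> keys v \<subseteq> {q+1..n}} = Y"
  proof (intro equalityI subsetI)
    fix y assume y: "y \<in> Y"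
    then have yf: "y \<in> full n" using Y(1) by blast
    then obtain b where b: "y = head q y + b" "keys b \<subseteq> {q+1..n}" by (rule head_tail)
    have "head q y \<in> expos_on {1..q}" using yf by (auto simp: expos_on_def keys_head full_def)
    then have "head q y \<in> X" using Y(2)[OF _ b(2)] y b(1) by metis
    then have "\<exists>x v. y = x + 0 + v \<and> x \<in> X \<and> keys v \<subseteq> {q+1..n}"
      using b by (intro exI[of _ "head q y"] exI[of _ b]) simp
    then show "y \<in> {x + 0 + v | x v. x \<in> X \<and> keys v \<subseteq> {q+1..n}}" by simp
  next
    fix y assume "y \<in> {x + 0 + v | x v. x \<in> X \<and> keys v \<subseteq> {q+1..n}}"
    then obtain x v where "y = x + v" "x \<in> X" "keys v \<subseteq> {q+1..n}" by auto
    then show "y \<in> Y" using Y(2)[of x v] X by blast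
  qed
  finally show ?thesis .
qed

lemma extended_boxes:
  assumes "snd d \<subseteq> {1..q}" "q \<le> n"
  shows "card (snd d \<union> {q+1..n}) = card (snd d) + (n - q)" "snd d \<union> {q+1..n} \<subseteq> {1..n}"
proof -
  have "card (snd d \<union> {q+1..n}) = card (snd d) + card {q+1..n}"
    using assms finite_subset[of "snd d" "{1..q}"] by (intro card_Un_disjoint) auto
  then show "card (snd d \<union> {q+1..n}) = card (snd d) + (n - q)" by simp
qed (use assms in auto)

text \<open>Membership in E depends only on the first q entries, so a partition in x_1, ..., x_q
  extends by adjoining the other n - q variables to every box. For E itself q >= 1 makes the
  original sets of free variables nonempty, whence the extra 1.\<close>

lemma upset_partitions:
  assumes E: "upset n E" and q: "1 \<le> q" "q \<le> n" and head: "\<And>a. a \<in> E \<Longrightarrow> head q a \<in> E"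
  shows "\<exists>D. box_partition D E \<and> (\<forall>d\<in>D. snd d \<subseteq> {1..n} \<and> n - q + 1 \<le> card (snd d))"
    and "\<exists>D. box_partition D (full n - E) \<and> (\<forall>d\<in>D. snd d \<subseteq> {1..n} \<and> n - q \<le> card (snd d))"
proof -
  define X where "X = E \<inter> expos_on {1..q}"
  have on_full: "a \<in> full n" if "a \<in> expos_on {1..q}" for a
    using that q by (auto simp: expos_on_def full_def)
  have "upset_on {1..q} X"
    unfolding upset_on_def
  proof (intro conjI ballI)
    fix a b assume "a \<in> X" "b \<in> expos_on {1..q}"
    then show "b + a \<in> X" using E on_full expos_on_plus by (auto simp: X_def upset_def)
  qed (simp add: X_def)
  note ex = box_partition_exists[OF finite_atLeastAtMost this]
  from conjunct1[OF ex] obtain D1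
    where D1: "box_partition D1 X" "\<And>d. d \<in> D1 \<Longrightarrow> snd d \<subseteq> {1..q} \<and> ({1..q} \<noteq> {} \<longrightarrow> snd d \<noteq> {})"
    by blast
  from conjunct2[OF ex] obtain D2
    where D2: "box_partition D2 (expos_on {1..q} - X)" "\<And>d. d \<in> D2 \<Longrightarrow> snd d \<subseteq> {1..q}"
    by blast
  have iff: "a + b \<in> E \<longleftrightarrow> a \<in> X" "a + b \<in> full n"
    if a: "a \<in> expos_on {1..q}" and b: "keys b \<subseteq> {q+1..n}" for a b
  proof -
    have bf: "b \<in> full n" using b q by (auto simp: full_def)
    then show "a + b \<in> full n" using on_full[OF a] by (simp add: full_plus)
    have "head q (a + b) = a"
    proof (rule poly_mapping_eqI)
      fix i
      have "i \<le> q \<Longrightarrow> i \<notin> keys b" "\<not> i \<le> q \<Longrightarrow> i \<notin> keys a"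
        using a b by (auto simp: expos_on_def)
      then show "lookup (head q (a + b)) i = lookup a i"
        by (auto simp: lookup_head lookup_add in_keys_iff)
    qed
    then have "a + b \<in> E \<Longrightarrow> a \<in> E" using head[of "a + b"] by simp
    moreover have "a \<in> E \<Longrightarrow> b + a \<in> E" using E bf unfolding upset_def by blast
    ultimately show "a + b \<in> E \<longleftrightarrow> a \<in> X" using a by (auto simp: X_def add.commute)
  qed
  have "box_partition ((\<lambda>(u, Z). (u + 0, Z \<union> {q+1..n})) ` D1) E"
    using D1 E iff(1) q by (intro box_partition_extend[of D1 X]) (auto simp: X_def upset_def)
  moreover have "snd d \<subseteq> {1..n} \<and> n - q + 1 \<le> card (snd d)"
    if "d \<in> (\<lambda>(u, Z). (u + 0, Z \<union> {q+1..n})) ` D1" for d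
  proof -
    from that obtain e where e: "e \<in> D1" "snd d = snd e \<union> {q+1..n}" by auto
    then have "snd e \<subseteq> {1..q}" "snd e \<noteq> {}" using D1(2) q by auto
    moreover from this have "card (snd e) \<noteq> 0" using finite_subset[of "snd e" "{1..q}"] by simp
    ultimately show ?thesis using extended_boxes[of e q n] q e(2) by simp
  qed
  ultimately show "\<exists>D. box_partition D E \<and> (\<forall>d\<in>D. snd d \<subseteq> {1..n} \<and> n - q + 1 \<le> card (snd d))"
    by blast
  have "box_partition ((\<lambda>(u, Z). (u + 0, Z \<union> {q+1..n})) ` D2) (full n - E)"
    using D2 iff q by (intro box_partition_extend[of D2 "expos_on {1..q} - X"]) auto
  moreover have "snd d \<subseteq> {1..n} \<and> n - q \<le> card (snd d)"
    if "d \<in> (\<lambda>(u, Z). (u + 0, Z \<union> {q+1..n})) ` D2" for d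
  proof -
    from that obtain e where e: "e \<in> D2" "snd d = snd e \<union> {q+1..n}" by auto
    then show ?thesis using extended_boxes[of e q n] D2(2) q by simp
  qed
  ultimately show "\<exists>D. box_partition D (full n - E) \<and> (\<forall>d\<in>D. snd d \<subseteq> {1..n} \<and> n - q \<le> card (snd d))"
    by blast
qed

lemma graded_presentation_ideal:
  assumes "upset n E"
  shows "graded_presentation n E {} (ideal_module (poly_ring {1..n}) (polys E :: 'k::field mpoly set)) (\<lambda>p. p)"
proof (rule graded_presentation.intro)
  show "Module.module (poly_ring {1..n}) (ideal_module (poly_ring {1..n}) (polys E :: 'k mpoly set))"
    by (rule module_ideal_module[OF cring_poly_ring ideal_polys[OF assms]])
qed (use assms upset_empty in \<open>auto simp: ideal_module_def\<close>)

lemma graded_presentation_quotient: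
  assumes E: "upset n E"
  shows "graded_presentation n (full n) E
     (quotient_module (poly_ring {1..n}) (polys E :: 'k::field mpoly set)) (a_r_coset (poly_ring {1..n}) (polys E))"
proof -
  let ?R = "poly_ring {1..n} :: 'k mpoly ring" and ?I = "polys E :: 'k mpoly set"
  interpret R: cring ?R by (rule cring_poly_ring)
  interpret I: ideal ?I ?R by (rule ideal_polys[OF E])
  interpret h: ring_hom_ring ?R "?R Quot ?I" "a_r_coset ?R ?I" by (rule I.rcos_ring_hom_ring)
  have M: "carrier (quotient_module ?R ?I) = carrier (?R Quot ?I)"
    "add (quotient_module ?R ?I) = add (?R Quot ?I)"
    "smult (quotient_module ?R ?I) a A = (?I +>\<^bsub>?R\<^esub> a) \<otimes>\<^bsub>?R Quot ?I\<^esub> A" for a A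
    by (simp_all add: quotient_module_def ring.defs)
  have minus: "p \<ominus>\<^bsub>?R\<^esub> q = p - q" if "q \<in> carrier ?R" for p q
  proof -
    have "- q \<in> carrier ?R" using that polys_uminus by (simp add: carrier_poly_ring)
    then have "\<ominus>\<^bsub>?R\<^esub> q = - q" using that by (intro R.minus_equality) auto
    then show ?thesis by (simp add: a_minus_def)
  qed
  show ?thesis
  proof (rule graded_presentation.intro)
    show "Module.module ?R (quotient_module ?R ?I)"
      by (rule module_quotient_module[OF cring_poly_ring ideal_polys[OF E]])
    show "a_r_coset ?R ?I ` polys (full n) = carrier (quotient_module ?R ?I)"
      unfolding M carrier_poly_ring[symmetric] by (auto simp: FactRing_def A_RCOSETS_def')
    fix p q :: "'k mpoly" assume pq: "p \<in> polys (full n)" "q \<in> polys (full n)"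
    then have pq': "p \<in> carrier ?R" "q \<in> carrier ?R" by (simp_all add: carrier_poly_ring)
    show "?I +>\<^bsub>?R\<^esub> (p + q) = (?I +>\<^bsub>?R\<^esub> p) \<oplus>\<^bsub>quotient_module ?R ?I\<^esub> (?I +>\<^bsub>?R\<^esub> q)"
      using h.hom_add[OF pq'] by (simp add: M)
    show "?I +>\<^bsub>?R\<^esub> (p * q) = p \<odot>\<^bsub>quotient_module ?R ?I\<^esub> (?I +>\<^bsub>?R\<^esub> q)"
      using h.hom_mult[OF pq'] by (simp add: M)
    show "(?I +>\<^bsub>?R\<^esub> p = ?I +>\<^bsub>?R\<^esub> q) \<longleftrightarrow> p - q \<in> ?I"
      using R.quotient_eq_iff_same_a_r_cos[OF I.is_ideal pq'] minus[OF pq'(2)] by simp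
  qed (use E upset_full in \<open>auto simp: upset_def\<close>)
qed

theorem proposition3p7:
  fixes n :: nat and I :: "'k::field mpoly set"
  assumes "borel_type n I"
    and "I \<noteq> {0}"
    and "I \<noteq> carrier (poly_ring {1..n})"
  shows "depth n (quotient_module (poly_ring {1..n}) I)
           \<le> enat (sdepth n (quotient_module (poly_ring {1..n}) I) (quotient_component n I))
       \<and> depth n (ideal_module (poly_ring {1..n}) I)
           \<le> enat (sdepth n (ideal_module (poly_ring {1..n}) I) (ideal_component n I))"
proof -
  obtain E where E: "upset n E" and I: "I = polys E"
    using monomial_ideal_eq_polys assms(1) unfolding borel_type_def by blast
  have "E \<noteq> {}" using assms(2) I by auto
  moreover have "0 \<notin> E"
  proof
    assume "0 \<in> E"
    then have "E = full n" using E unfolding upset_def by (metis add.right_neutral subsetI subset_antisym)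
    then show False using assms(3) I by (simp add: carrier_poly_ring)
  qed
  ultimately obtain q w where q: "1 \<le> q" "q \<le> n" "\<And>a. a \<in> E \<Longrightarrow> head q a \<in> E"
    and w: "w \<in> full n" "w \<notin> E" "\<And>i. i \<in> {1..q} \<Longrightarrow> single i 1 + w \<in> E"
    using borel_type_socle[OF E] assms(1) I by blast
  have component: "single a 1 \<in> (poly_component n (\<lambda>i. int (lookup a i)) :: 'k mpoly set)" if "a \<in> full n" for a
    using that by (simp add: poly_component_def carrier_poly_ring polys_single)

  interpret Q: graded_presentation n "full n" E "quotient_module (poly_ring {1..n}) I"
    "a_r_coset (poly_ring {1..n}) I" unfolding I by (rule graded_presentation_quotient[OF E])
  obtain D where D: "box_partition D (full n - E)" "\<And>d. d \<in> D \<Longrightarrow> snd d \<subseteq> {1..n} \<and> n - q \<le> card (snd d)"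
    using upset_partitions(2)[OF E q] by blast
  \<comment> \<open>The number n - q separates depth and Stanley depth of S/I; for I this role is
    played by n - q + 1.\<close>
  have "depth n (quotient_module (poly_ring {1..n}) I) \<le> enat (n - q)"
    using regular_length_quotient_le[OF _ w q(2)] by (rule Q.depth_le)
  moreover have "n - q \<le> sdepth n (quotient_module (poly_ring {1..n}) I) (quotient_component n I)"
  proof (rule Q.sdepth_ge[OF D])
    show "full n - E \<noteq> {}" using w by blast
  qed (use component in \<open>auto simp: quotient_component_def\<close>)
  moreover

  interpret P: graded_presentation n E "{}" "ideal_module (poly_ring {1..n}) I" "\<lambda>p. p"
    unfolding I by (rule graded_presentation_ideal[OF E])
  obtain D where D: "box_partition D (E - {})" "\<And>d. d \<in> D \<Longrightarrow> snd d \<subseteq> {1..n} \<and> n - q + 1 \<le> card (snd d)"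
    using upset_partitions(1)[OF E q] by auto
  have "depth n (ideal_module (poly_ring {1..n}) I) \<le> enat (n - q + 1)"
    using regular_length_ideal_le[OF _ w q(2,1)] by (rule P.depth_le)
  moreover have "n - q + 1 \<le> sdepth n (ideal_module (poly_ring {1..n}) I) (ideal_component n I)"
  proof (rule P.sdepth_ge[OF D])
    fix a assume "a \<in> E - {}"
    then show "single a 1 \<in> ideal_component n I (\<lambda>i. int (lookup a i))"
      using component E by (auto simp: ideal_component_def I upset_def intro: polys_single)
  qed (use \<open>E \<noteq> {}\<close> in auto)
  ultimately show ?thesis by (meson enat_ord_simps(1) order_trans)
qed

end
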